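(* Let $X$ be a finite set and let $(X,S)$ be a non-degenerate, involutive and braided set-theoretical solution of the quantum Yang-Baxter equation. Let $G$ be the structure group of $(X,S)$ and $M$ the monoid with the same presentation. Then: (i) The right least common multiple of the elements of $X$ is a Garside element in $M$. (ii) The homological dimension and the cohomological dimension of $G$ are equal to the cardinality of $X$. (iii) The group $G$ is $\Delta$-pure Garside (that is, the monoid $M$ is $\Delta$-pure Garside) if and only if $(X,S)$ is indecomposable.
   Context: Set-theoretical solutions. A set-theoretical solution is a pair $(X,S)$ with $X$ a non-empty set and $S:X^2\to X^2$ a bijection; write $S(x,y)=(S_1(x,y),S_2(x,y))$. It is non-degenerate if for all fixed $y,z\in X$ the maps $x\mapsto S_2(x,y)$ and $x\mapsto S_1(z,x)$ are bijections $X\to X$; involutive if $S^2=\mathrm{id}_{X^2}$; braided if $S^{12}S^{23}S^{12}=S^{23}S^{12}S^{23}$ on $X^3$, where $S^{12}=S\times \mathrm{id}_X$ and $S^{23}=\mathrm{id}_X\times S$. The structure group $G$ is the group generated by $X$ with defining relations $xy=tz$ whenever $S(x,y)=(t,z)$; $M$ is the monoid with the same generators and relations. Decomposability. A subset $Y\subseteq X$ is invariant if $S(Y\times Y)\subseteq Y\times Y$; an invariant subset $Y$ is non-degenerate if $(Y,S|_{Y\times Y})$ is non-degenerate. $(X,S)$ is decomposable if $X$ is a union of two non-empty disjoint non-degenerate invariant subsets, and indecomposable otherwise. Garside notions. In $M$, $x$ is a left divisor of $z$ if $z=xt$ for some $t$ (right divisors analogously). The right lcm $x\vee y$ (and the right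 lcm of a finite set of elements) is the common right multiple that left-divides every common right multiple. The right complement $x\setminus y$ is the element with $x\vee y=x(x\setminus y)$. An atom is an element $x\neq1$ such that $x=yz$ implies $y=1$ or $z=1$; a monoid is atomic if it is generated by its atoms and for each element the lengths of its decompositions into atoms are bounded. A Gaussian monoid is an atomic, left and right cancellative monoid in which any two elements have left and right gcds and lcms. A Garside element is an element $\Delta\in M$ whose left divisors coincide with its right divisors, are finite in number, and generate $M$. A Garside monoid is a Gaussian monoid containing a Garside element. $M$ is $\Delta$-pure if for all $x,y\in X$ one has $\Delta_x=\Delta_y$, where $\Delta_x=\bigvee\{b\setminus x : b\in M\}$ ($\vee$ denotes right lcm). *)

theory Defs
  imports
    "HOL-Algebra.Bij"
    "HOL-Algebra.Divisibility"
    "HOL-Algebra.FiniteProduct"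
    "HOL-Algebra.Product_Groups"
    "HOL-Library.Extended_Nat"
    "HOL-Library.Infinite_Typeclass"
begin

section \<open>Set-theoretical solutions\<close>

definition set_solution :: "'a set \<Rightarrow> ('a \<times> 'a \<Rightarrow> 'a \<times> 'a) \<Rightarrow> bool" where
  "set_solution X S \<longleftrightarrow> X \<noteq> {} \<and> bij_betw S (X \<times> X) (X \<times> X)"

definition nondegenerate :: "'a set \<Rightarrow> ('a \<times> 'a \<Rightarrow> 'a \<times> 'a) \<Rightarrow> bool" where
  "nondegenerate X S \<longleftrightarrow>
     (\<forall>y\<in>X. bij_betw (\<lambda>x. snd (S (x, y))) X X) \<and>
     (\<forall>z\<in>X. bij_betw (\<lambda>x. fst (S (z, x))) X X)"

definition involutive :: "'a set \<Rightarrow> ('a \<times> 'a \<Rightarrow> 'a \<times> 'a) \<Rightarrow> bool" where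
  "involutive X S \<longleftrightarrow> (\<forall>p \<in> X \<times> X. S (S p) = p)"

definition act12 :: "('a \<times> 'a \<Rightarrow> 'a \<times> 'a) \<Rightarrow> 'a \<times> 'a \<times> 'a \<Rightarrow> 'a \<times> 'a \<times> 'a" where
  "act12 S = (\<lambda>(x, y, z). (fst (S (x, y)), snd (S (x, y)), z))"

definition act23 :: "('a \<times> 'a \<Rightarrow> 'a \<times> 'a) \<Rightarrow> 'a \<times> 'a \<times> 'a \<Rightarrow> 'a \<times> 'a \<times> 'a" where
  "act23 S = (\<lambda>(x, y, z). (x, S (y, z)))"

definition braided :: "'a set \<Rightarrow> ('a \<times> 'a \<Rightarrow> 'a \<times> 'a) \<Rightarrow> bool" where
  "braided X S \<longleftrightarrow>
     (\<forall>p \<in> X \<times> X \<times> X. act12 S (act23 S (act12 S p)) = act23 S (act12 S (act23 S p)))"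

definition invariant_subset :: "'a set \<Rightarrow> ('a \<times> 'a \<Rightarrow> 'a \<times> 'a) \<Rightarrow> 'a set \<Rightarrow> bool" where
  "invariant_subset X S Y \<longleftrightarrow> Y \<subseteq> X \<and> S ` (Y \<times> Y) \<subseteq> Y \<times> Y"

definition decomposable :: "'a set \<Rightarrow> ('a \<times> 'a \<Rightarrow> 'a \<times> 'a) \<Rightarrow> bool" where
  "decomposable X S \<longleftrightarrow>
     (\<exists>Y Z. Y \<noteq> {} \<and> Z \<noteq> {} \<and> Y \<inter> Z = {} \<and> X = Y \<union> Z \<and>
        invariant_subset X S Y \<and> nondegenerate Y S \<and>
        invariant_subset X S Z \<and> nondegenerate Z S)"

abbreviation indecomposable :: "'a set \<Rightarrow> ('a \<times> 'a \<Rightarrow> 'a \<times> 'a) \<Rightarrow> bool" where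
  "indecomposable X S \<equiv> \<not> decomposable X S"


section \<open>Presentations, the structure monoid and the structure group\<close>

text \<open>The congruence on the free monoid \<^term>\<open>lists A\<close> generated by a set of pairs of words.\<close>

inductive word_cong :: "'a set \<Rightarrow> ('a list \<times> 'a list) set \<Rightarrow> 'a list \<Rightarrow> 'a list \<Rightarrow> bool"
  for A :: "'a set" and R :: "('a list \<times> 'a list) set" where
  refl: "u \<in> lists A \<Longrightarrow> word_cong A R u u"
| rel: "(u, v) \<in> R \<Longrightarrow> u \<in> lists A \<Longrightarrow> v \<in> lists A \<Longrightarrow> p \<in> lists A \<Longrightarrow> q \<in> lists A
         \<Longrightarrow> word_cong A R (p @ u @ q) (p @ v @ q)"
| sym: "word_cong A R u v \<Longrightarrow> word_cong A R v u"
| trans: "word_cong A R u v \<Longrightarrow> word_cong A R v w \<Longrightarrow> word_cong A R u w"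

definition word_class :: "'a set \<Rightarrow> ('a list \<times> 'a list) set \<Rightarrow> 'a list \<Rightarrow> 'a list set" where
  "word_class A R u = {v. word_cong A R u v}"

definition presented_monoid :: "'a set \<Rightarrow> ('a list \<times> 'a list) set \<Rightarrow> 'a list set monoid" where
  "presented_monoid A R =
     \<lparr>carrier = word_class A R ` lists A,
      monoid.mult = (\<lambda>C D. \<Union>u\<in>C. \<Union>v\<in>D. word_class A R (u @ v)),
      one = word_class A R []\<rparr>"

definition structure_relations :: "'a set \<Rightarrow> ('a \<times> 'a \<Rightarrow> 'a \<times> 'a) \<Rightarrow> ('a list \<times> 'a list) set" where
  "structure_relations X S =
     {([x, y], [t, z]) | x y t z. x \<in> X \<and> y \<in> X \<and> S (x, y) = (t, z)}"

definition structure_monoid :: "'a set \<Rightarrow> ('a \<times> 'a \<Rightarrow> 'a \<times> 'a) \<Rightarrow> 'a list set monoid" where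
  "structure_monoid X S = presented_monoid X (structure_relations X S)"

definition monoid_gen :: "'a set \<Rightarrow> ('a \<times> 'a \<Rightarrow> 'a \<times> 'a) \<Rightarrow> 'a \<Rightarrow> 'a list set" where
  "monoid_gen X S x = word_class X (structure_relations X S) [x]"

text \<open>
  A group presentation is read as a monoid presentation on the alphabet of signed generators,
  \<^term>\<open>(x, True)\<close> standing for \<^term>\<open>x\<close> and \<^term>\<open>(x, False)\<close> for its inverse.
\<close>

definition group_relations ::
    "'a set \<Rightarrow> ('a list \<times> 'a list) set \<Rightarrow> (('a \<times> bool) list \<times> ('a \<times> bool) list) set" where
  "group_relations X R =
     {(map (\<lambda>x. (x, True)) u, map (\<lambda>x. (x, True)) v) | u v. (u, v) \<in> R} \<union>
     {([(x, b), (x, \<not> b)], []) | x b. x \<in> X}"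

definition structure_group :: "'a set \<Rightarrow> ('a \<times> 'a \<Rightarrow> 'a \<times> 'a) \<Rightarrow> ('a \<times> bool) list set monoid" where
  "structure_group X S =
     presented_monoid (X \<times> UNIV) (group_relations X (structure_relations X S))"

lemma word_cong_lists: "word_cong A R u v \<Longrightarrow> u \<in> lists A \<and> v \<in> lists A"
  by (induction rule: word_cong.induct) auto

lemma word_cong_context:
  assumes "word_cong A R u v" "p \<in> lists A" "q \<in> lists A"
  shows "word_cong A R (p @ u @ q) (p @ v @ q)"
  using assms
proof (induction rule: word_cong.induct)
  case (refl u)
  then show ?case by (intro word_cong.refl) auto
next
  case (rel u v p' q')
  then show ?case
    using word_cong.rel[of u v R A "p @ p'" "q' @ q"] by auto
next
  case (sym u v)
  then show ?case by (simp add: word_cong.sym)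
next
  case (trans u v w)
  then show ?case by (metis word_cong.trans)
qed

lemma word_cong_append:
  assumes "word_cong A R u u'" "word_cong A R v v'"
  shows "word_cong A R (u @ v) (u' @ v')"
proof (rule word_cong.trans)
  show "word_cong A R (u @ v) (u' @ v)"
    using word_cong_context[OF assms(1), of "[]" v] word_cong_lists[OF assms(2)] by simp
  show "word_cong A R (u' @ v) (u' @ v')"
    using word_cong_context[OF assms(2), of u' "[]"] word_cong_lists[OF assms(1)] by simp
qed

lemma word_class_self: "u \<in> lists A \<Longrightarrow> u \<in> word_class A R u"
  unfolding word_class_def mem_Collect_eq by (rule word_cong.refl)

lemma word_class_eq_iff:
  assumes "u \<in> lists A" "v \<in> lists A"
  shows "word_class A R u = word_class A R v \<longleftrightarrow> word_cong A R u v"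
proof
  assume "word_class A R u = word_class A R v"
  moreover have "v \<in> word_class A R v"
    by (rule word_class_self[OF assms(2)])
  ultimately show "word_cong A R u v"
    unfolding word_class_def by blast
next
  assume uv: "word_cong A R u v"
  have "word_cong A R u w \<longleftrightarrow> word_cong A R v w" for w
    using word_cong.trans[OF uv, of w] word_cong.trans[OF word_cong.sym[OF uv], of w] by blast
  then show "word_class A R u = word_class A R v"
    unfolding word_class_def by (intro Collect_cong)
qed

lemma presented_monoid_mult:
  assumes "u \<in> lists A" "v \<in> lists A"
  shows "word_class A R u \<otimes>\<^bsub>presented_monoid A R\<^esub> word_class A R v = word_class A R (u @ v)"
proof -
  have *: "word_class A R (u' @ v') = word_class A R (u @ v)"
    if "u' \<in> word_class A R u" "v' \<in> word_class A R v" for u' v'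
  proof -
    have c: "word_cong A R u u'" "word_cong A R v v'"
      using that by (simp_all add: word_class_def)
    have "word_cong A R (u' @ v') (u @ v)"
      by (rule word_cong.sym[OF word_cong_append[OF c]])
    moreover from this have "u' @ v' \<in> lists A" "u @ v \<in> lists A"
      using word_cong_lists by blast+
    ultimately show ?thesis by (simp only: word_class_eq_iff)
  qed
  have "(\<Union>u'\<in>word_class A R u. \<Union>v'\<in>word_class A R v. word_class A R (u' @ v'))
      = (\<Union>u'\<in>word_class A R u. \<Union>v'\<in>word_class A R v. word_class A R (u @ v))"
    by (intro SUP_cong HOL.refl *)
  also have "\<dots> = word_class A R (u @ v)"
    using word_class_self[OF assms(1)] word_class_self[OF assms(2)]
    by (metis (no_types) SUP_const empty_iff)
  finally show ?thesis by (simp add: presented_monoid_def)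
qed

lemma presented_monoidE:
  assumes "x \<in> carrier (presented_monoid A R)"
  obtains u where "u \<in> lists A" "x = word_class A R u"
  using assms unfolding presented_monoid_def partial_object.simps by (elim imageE)

lemma monoid_presented_monoid: "monoid (presented_monoid A R)"
proof
  show "x \<otimes>\<^bsub>presented_monoid A R\<^esub> y \<in> carrier (presented_monoid A R)"
    if xy: "x \<in> carrier (presented_monoid A R)" "y \<in> carrier (presented_monoid A R)" for x y
  proof -
    obtain u v where "u \<in> lists A" "v \<in> lists A" "x = word_class A R u" "y = word_class A R v"
      using xy by (meson presented_monoidE)
    then have "x \<otimes>\<^bsub>presented_monoid A R\<^esub> y = word_class A R (u @ v)" "u @ v \<in> lists A"
      by (simp_all only: presented_monoid_mult append_in_lists_conv simp_thms)
    then show ?thesis by (simp add: presented_monoid_def del: in_lists_conv_set)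
  qed
  show "x \<otimes>\<^bsub>presented_monoid A R\<^esub> y \<otimes>\<^bsub>presented_monoid A R\<^esub> z =
        x \<otimes>\<^bsub>presented_monoid A R\<^esub> (y \<otimes>\<^bsub>presented_monoid A R\<^esub> z)"
    if xyz: "x \<in> carrier (presented_monoid A R)" "y \<in> carrier (presented_monoid A R)"
       "z \<in> carrier (presented_monoid A R)" for x y z
  proof -
    obtain u v w where "u \<in> lists A" "v \<in> lists A" "w \<in> lists A"
      and "x = word_class A R u" "y = word_class A R v" "z = word_class A R w"
      using xyz by (meson presented_monoidE)
    then show ?thesis by (simp add: presented_monoid_mult)
  qed
  have one: "\<one>\<^bsub>presented_monoid A R\<^esub> = word_class A R []"
    by (simp add: presented_monoid_def)
  show "\<one>\<^bsub>presented_monoid A R\<^esub> \<in> carrier (presented_monoid A R)"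
    by (auto simp: presented_monoid_def)
  show "\<one>\<^bsub>presented_monoid A R\<^esub> \<otimes>\<^bsub>presented_monoid A R\<^esub> x = x"
       "x \<otimes>\<^bsub>presented_monoid A R\<^esub> \<one>\<^bsub>presented_monoid A R\<^esub> = x"
    if x: "x \<in> carrier (presented_monoid A R)" for x
  proof -
    obtain u where "u \<in> lists A" "x = word_class A R u"
      using x by (rule presented_monoidE)
    then show "\<one>\<^bsub>presented_monoid A R\<^esub> \<otimes>\<^bsub>presented_monoid A R\<^esub> x = x"
       "x \<otimes>\<^bsub>presented_monoid A R\<^esub> \<one>\<^bsub>presented_monoid A R\<^esub> = x"
      by (simp_all add: one presented_monoid_mult)
  qed
qed

lemma group_structure_group: "group (structure_group X S)"
proof -
  define A :: "('a \<times> bool) set" where "A = X \<times> UNIV"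
  define R where "R = group_relations X (structure_relations X S)"
  have G: "structure_group X S = presented_monoid A R"
    by (simp add: structure_group_def A_def R_def)
  have inv: "\<exists>v \<in> lists A. word_cong A R (v @ u) []" if "u \<in> lists A" for u
    using that
  proof (induction u rule: list.induct)
    case Nil
    then show ?case by (intro bexI[of _ "[]"]) (auto intro: word_cong.refl)
  next
    case (Cons a u)
    then obtain v where v: "v \<in> lists A" "word_cong A R (v @ u) []" by auto
    obtain x b where a: "a = (x, b)" by (cases a)
    have xX: "x \<in> X" using Cons.prems by (auto simp: a A_def)
    have "([(x, \<not> b), (x, \<not> \<not> b)], []) \<in> R"
      using xX unfolding R_def group_relations_def by blast
    then have "word_cong A R (v @ [(x, \<not> b), a] @ u) (v @ [] @ u)"
      using v(1) Cons.prems xX by (intro word_cong.rel) (auto simp: a A_def)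
    then have "word_cong A R ((v @ [(x, \<not> b)]) @ (a # u)) []"
      using v(2) by (auto intro: word_cong.trans)
    moreover have "v @ [(x, \<not> b)] \<in> lists A" using v(1) xX by (auto simp: A_def)
    ultimately show ?case by blast
  qed
  interpret monoid "presented_monoid A R" by (rule monoid_presented_monoid)
  show ?thesis unfolding G
  proof (rule group_l_invI)
    fix x assume "x \<in> carrier (presented_monoid A R)"
    then obtain u where u: "u \<in> lists A" "x = word_class A R u"
      by (rule presented_monoidE)
    obtain v where v: "v \<in> lists A" "word_cong A R (v @ u) []" using inv[OF u(1)] by blast
    have "word_class A R v \<otimes>\<^bsub>presented_monoid A R\<^esub> x = \<one>\<^bsub>presented_monoid A R\<^esub>"
      using u v presented_monoid_mult[OF v(1) u(1)]
      by (auto simp: word_class_eq_iff presented_monoid_def)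
    moreover have "word_class A R v \<in> carrier (presented_monoid A R)"
      using v(1) by (auto simp: presented_monoid_def)
    ultimately show "\<exists>y\<in>carrier (presented_monoid A R).
        y \<otimes>\<^bsub>presented_monoid A R\<^esub> x = \<one>\<^bsub>presented_monoid A R\<^esub>" by blast
  qed
qed


section \<open>Garside monoids\<close>

text \<open>
  In a noncommutative monoid the relation \<^const>\<open>factor\<close> of the library is left divisibility, so
  \<^const>\<open>isgcd\<close> and \<^const>\<open>islcm\<close> are left gcds and right lcms. Right divisors, right gcds
  and left lcms are the same notions in the opposite monoid.
\<close>

definition opposite :: "('a, 'b) monoid_scheme \<Rightarrow> ('a, 'b) monoid_scheme" where
  "opposite M = M\<lparr>monoid.mult := \<lambda>x y. y \<otimes>\<^bsub>M\<^esub> x\<rparr>"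

definition left_divisors :: "('a, 'b) monoid_scheme \<Rightarrow> 'a \<Rightarrow> 'a set" where
  "left_divisors M z = {x \<in> carrier M. x divides\<^bsub>M\<^esub> z}"

definition right_divisors :: "('a, 'b) monoid_scheme \<Rightarrow> 'a \<Rightarrow> 'a set" where
  "right_divisors M z = {x \<in> carrier M. x divides\<^bsub>opposite M\<^esub> z}"

definition is_right_lcm :: "('a, 'b) monoid_scheme \<Rightarrow> 'a set \<Rightarrow> 'a \<Rightarrow> bool" where
  "is_right_lcm M A m \<longleftrightarrow>
     m \<in> carrier M \<and> (\<forall>a\<in>A. a divides\<^bsub>M\<^esub> m) \<and>
     (\<forall>w\<in>carrier M. (\<forall>a\<in>A. a divides\<^bsub>M\<^esub> w) \<longrightarrow> m divides\<^bsub>M\<^esub> w)"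

definition right_lcm :: "('a, 'b) monoid_scheme \<Rightarrow> 'a set \<Rightarrow> 'a" where
  "right_lcm M A = (THE m. is_right_lcm M A m)"

definition right_complement :: "('a, 'b) monoid_scheme \<Rightarrow> 'a \<Rightarrow> 'a \<Rightarrow> 'a" where
  "right_complement M x y =
     (THE c. c \<in> carrier M \<and> right_lcm M {x, y} = x \<otimes>\<^bsub>M\<^esub> c)"

definition word_product :: "('a, 'b) monoid_scheme \<Rightarrow> 'a list \<Rightarrow> 'a" where
  "word_product M w = foldr (\<otimes>\<^bsub>M\<^esub>) w \<one>\<^bsub>M\<^esub>"

definition generates_monoid :: "('a, 'b) monoid_scheme \<Rightarrow> 'a set \<Rightarrow> bool" where
  "generates_monoid M A \<longleftrightarrow> A \<subseteq> carrier M \<and> carrier M = word_product M ` lists A"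

definition atoms :: "('a, 'b) monoid_scheme \<Rightarrow> 'a set" where
  "atoms M = {x \<in> carrier M. x \<noteq> \<one>\<^bsub>M\<^esub> \<and>
     (\<forall>y\<in>carrier M. \<forall>z\<in>carrier M. x = y \<otimes>\<^bsub>M\<^esub> z \<longrightarrow> y = \<one>\<^bsub>M\<^esub> \<or> z = \<one>\<^bsub>M\<^esub>)}"

definition atomic_monoid :: "('a, 'b) monoid_scheme \<Rightarrow> bool" where
  "atomic_monoid M \<longleftrightarrow> monoid M \<and> generates_monoid M (atoms M) \<and>
     (\<forall>x\<in>carrier M. \<exists>N. \<forall>w\<in>lists (atoms M). word_product M w = x \<longrightarrow> length w \<le> N)"

definition gaussian_monoid :: "('a, 'b) monoid_scheme \<Rightarrow> bool" where
  "gaussian_monoid M \<longleftrightarrow> atomic_monoid M \<and> monoid_cancel M \<and>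
     (\<forall>x\<in>carrier M. \<forall>y\<in>carrier M.
        (\<exists>d\<in>carrier M. d gcdof\<^bsub>M\<^esub> x y) \<and>
        (\<exists>m\<in>carrier M. m lcmof\<^bsub>M\<^esub> x y) \<and>
        (\<exists>d\<in>carrier M. d gcdof\<^bsub>opposite M\<^esub> x y) \<and>
        (\<exists>m\<in>carrier M. m lcmof\<^bsub>opposite M\<^esub> x y))"

definition garside_element :: "('a, 'b) monoid_scheme \<Rightarrow> 'a \<Rightarrow> bool" where
  "garside_element M \<Delta> \<longleftrightarrow> \<Delta> \<in> carrier M \<and>
     left_divisors M \<Delta> = right_divisors M \<Delta> \<and>
     finite (left_divisors M \<Delta>) \<and>
     generates_monoid M (left_divisors M \<Delta>)"

definition garside_monoid :: "('a, 'b) monoid_scheme \<Rightarrow> bool" where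
  "garside_monoid M \<longleftrightarrow> gaussian_monoid M \<and> (\<exists>\<Delta>. garside_element M \<Delta>)"

definition complements :: "('a, 'b) monoid_scheme \<Rightarrow> 'a \<Rightarrow> 'a set" where
  "complements M x = {right_complement M b x | b. b \<in> carrier M}"

definition Delta_of :: "('a, 'b) monoid_scheme \<Rightarrow> 'a \<Rightarrow> 'a" where
  "Delta_of M x = right_lcm M (complements M x)"

text \<open>
  The first conjunct guarantees that the descriptions \<^term>\<open>Delta_of M x\<close> denote; it holds in
  every Garside monoid.
\<close>

definition Delta_pure :: "('a, 'b) monoid_scheme \<Rightarrow> 'a set \<Rightarrow> bool" where
  "Delta_pure M A \<longleftrightarrow>
     (\<forall>x\<in>A. \<exists>!m. is_right_lcm M (complements M x) m) \<and>
     (\<forall>x\<in>A. \<forall>y\<in>A. Delta_of M x = Delta_of M y)"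


section \<open>Homology and cohomology of groups\<close>

text \<open>
  A \<open>G\<close>-module is an abelian group \<open>A\<close>, written multiplicatively, with a left action of
  \<open>G\<close> by automorphisms. Homology and cohomology with coefficients in \<open>A\<close> are computed by the
  standard inhomogeneous (bar) complexes: \<open>n\<close>-cochains are all functions \<open>G\<^sup>n \<rightarrow> A\<close>, and
  \<open>n\<close>-chains are the finitely supported ones, \<open>c\<close> standing for the sum of the
  \<open>c s \<otimes> [s\<^sub>1|\<dots>|s\<^sub>n]\<close>.
\<close>

definition G_module :: "('g, 'k) monoid_scheme \<Rightarrow> ('m, 'l) monoid_scheme \<Rightarrow> ('g \<Rightarrow> 'm \<Rightarrow> 'm) \<Rightarrow> bool" where
  "G_module G A \<phi> \<longleftrightarrow> group G \<and> comm_group A \<and> \<phi> \<in> hom G (AutoGroup A)"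

definition tuples :: "('g, 'k) monoid_scheme \<Rightarrow> nat \<Rightarrow> 'g list set" where
  "tuples G n = {s \<in> lists (carrier G). length s = n}"

text \<open>The \<open>i\<close>-th face of a bar cell \<open>[g\<^sub>1|\<dots>|g\<^sub>n]\<close>, for \<open>i \<le> n\<close>; list positions start at \<open>0\<close>.\<close>

definition bar_face :: "('g, 'k) monoid_scheme \<Rightarrow> nat \<Rightarrow> 'g list \<Rightarrow> 'g list" where
  "bar_face G i s =
     (if i = 0 then tl s
      else if i = length s then butlast s
      else take (i - 1) s @ [s ! (i - 1) \<otimes>\<^bsub>G\<^esub> s ! i] @ drop (i + 1) s)"

definition cochain_group :: "('g, 'k) monoid_scheme \<Rightarrow> ('m, 'l) monoid_scheme \<Rightarrow> nat \<Rightarrow> ('g list \<Rightarrow> 'm) monoid" where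
  "cochain_group G A n = product_group (tuples G n) (\<lambda>_. A)"

definition chain_group :: "('g, 'k) monoid_scheme \<Rightarrow> ('m, 'l) monoid_scheme \<Rightarrow> nat \<Rightarrow> ('g list \<Rightarrow> 'm) monoid" where
  "chain_group G A n = sum_group (tuples G n) (\<lambda>_. A)"

text \<open>\<open>(\<delta>f)(g\<^sub>1,\<dots>,g\<^sub>n\<^sub>+\<^sub>1) = g\<^sub>1 f(g\<^sub>2,\<dots>,g\<^sub>n\<^sub>+\<^sub>1) + \<Sum>\<^sub>i (-1)\<^sup>i f(\<dots>,g\<^sub>ig\<^sub>i\<^sub>+\<^sub>1,\<dots>) + (-1)\<^sup>n\<^sup>+\<^sup>1 f(g\<^sub>1,\<dots>,g\<^sub>n)\<close>\<close>

definition coboundary ::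
    "('g, 'k) monoid_scheme \<Rightarrow> ('m, 'l) monoid_scheme \<Rightarrow> ('g \<Rightarrow> 'm \<Rightarrow> 'm) \<Rightarrow> nat \<Rightarrow>
     ('g list \<Rightarrow> 'm) \<Rightarrow> ('g list \<Rightarrow> 'm)" where
  "coboundary G A \<phi> n f =
     (\<lambda>s \<in> tuples G (Suc n).
        finprod A
          (\<lambda>i. (if i = 0 then \<phi> (hd s) (f (bar_face G 0 s)) else f (bar_face G i s))
                 [^]\<^bsub>A\<^esub> ((- 1) ^ i :: int))
          {..Suc n})"

text \<open>
  \<open>\<partial>(a \<otimes> [g\<^sub>1|\<dots>|g\<^sub>n]) = g\<^sub>1\<^sup>-\<^sup>1a \<otimes> [g\<^sub>2|\<dots>|g\<^sub>n] + \<Sum>\<^sub>i (-1)\<^sup>i a \<otimes> [\<dots>|g\<^sub>ig\<^sub>i\<^sub>+\<^sub>1|\<dots>] + (-1)\<^sup>n a \<otimes> [g\<^sub>1|\<dots>|g\<^sub>n\<^sub>-\<^sub>1]\<close>,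
  where \<open>A\<close> is made a right module through the inverse. Below, \<open>n\<close> is the degree of the target.
\<close>

definition boundary ::
    "('g, 'k) monoid_scheme \<Rightarrow> ('m, 'l) monoid_scheme \<Rightarrow> ('g \<Rightarrow> 'm \<Rightarrow> 'm) \<Rightarrow> nat \<Rightarrow>
     ('g list \<Rightarrow> 'm) \<Rightarrow> ('g list \<Rightarrow> 'm)" where
  "boundary G A \<phi> n c =
     (\<lambda>t \<in> tuples G n.
        finprod A
          (\<lambda>s. finprod A
             (\<lambda>i. (if i = 0 then \<phi> (inv\<^bsub>G\<^esub> (hd s)) (c s) else c s) [^]\<^bsub>A\<^esub> ((- 1) ^ i :: int))
             {i \<in> {..Suc n}. bar_face G i s = t})
          {s \<in> tuples G (Suc n). c s \<noteq> \<one>\<^bsub>A\<^esub>})"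

definition cocycles ::
    "('g, 'k) monoid_scheme \<Rightarrow> ('m, 'l) monoid_scheme \<Rightarrow> ('g \<Rightarrow> 'm \<Rightarrow> 'm) \<Rightarrow> nat \<Rightarrow>
     ('g list \<Rightarrow> 'm) set" where
  "cocycles G A \<phi> n = kernel (cochain_group G A n) (cochain_group G A (Suc n)) (coboundary G A \<phi> n)"

definition coboundaries ::
    "('g, 'k) monoid_scheme \<Rightarrow> ('m, 'l) monoid_scheme \<Rightarrow> ('g \<Rightarrow> 'm \<Rightarrow> 'm) \<Rightarrow> nat \<Rightarrow>
     ('g list \<Rightarrow> 'm) set" where
  "coboundaries G A \<phi> n =
     (case n of 0 \<Rightarrow> {\<one>\<^bsub>cochain_group G A 0\<^esub>}
      | Suc m \<Rightarrow> coboundary G A \<phi> m ` carrier (cochain_group G A m))"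

definition cycles ::
    "('g, 'k) monoid_scheme \<Rightarrow> ('m, 'l) monoid_scheme \<Rightarrow> ('g \<Rightarrow> 'm \<Rightarrow> 'm) \<Rightarrow> nat \<Rightarrow>
     ('g list \<Rightarrow> 'm) set" where
  "cycles G A \<phi> n =
     (case n of 0 \<Rightarrow> carrier (chain_group G A 0)
      | Suc m \<Rightarrow> kernel (chain_group G A (Suc m)) (chain_group G A m) (boundary G A \<phi> m))"

definition boundaries ::
    "('g, 'k) monoid_scheme \<Rightarrow> ('m, 'l) monoid_scheme \<Rightarrow> ('g \<Rightarrow> 'm \<Rightarrow> 'm) \<Rightarrow> nat \<Rightarrow>
     ('g list \<Rightarrow> 'm) set" where
  "boundaries G A \<phi> n = boundary G A \<phi> n ` carrier (chain_group G A (Suc n))"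

definition group_cohomology ::
    "('g, 'k) monoid_scheme \<Rightarrow> ('m, 'l) monoid_scheme \<Rightarrow> ('g \<Rightarrow> 'm \<Rightarrow> 'm) \<Rightarrow> nat \<Rightarrow>
     ('g list \<Rightarrow> 'm) set monoid" where
  "group_cohomology G A \<phi> n =
     (cochain_group G A n)\<lparr>carrier := cocycles G A \<phi> n\<rparr> Mod coboundaries G A \<phi> n"

definition group_homology ::
    "('g, 'k) monoid_scheme \<Rightarrow> ('m, 'l) monoid_scheme \<Rightarrow> ('g \<Rightarrow> 'm \<Rightarrow> 'm) \<Rightarrow> nat \<Rightarrow>
     ('g list \<Rightarrow> 'm) set monoid" where
  "group_homology G A \<phi> n =
     (chain_group G A n)\<lparr>carrier := cycles G A \<phi> n\<rparr> Mod boundaries G A \<phi> n"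

text \<open>
  The dimensions are the suprema of the degrees \<open>n\<close> such that \<open>H\<^sup>n(G; A) \<noteq> 0\<close>, respectively
  \<open>H\<^sub>n(G; A) \<noteq> 0\<close>, for some \<open>G\<close>-module \<open>A\<close>. Since HOL cannot quantify over all types at
  once, the type \<open>'m\<close> carrying the coefficient modules is a parameter. For countable \<open>G\<close> the
  value is the same for all infinite \<open>'m\<close>: a nonzero homology class survives in a finitely generated
  submodule, and a nonzero cohomology class of degree \<open>n\<close> is the image of the universal one, whose
  coefficients are the \<open>n\<close>-chains of the bar resolution modulo boundaries.
\<close>

definition cohomological_dimension :: "'m::infinite itself \<Rightarrow> ('g, 'k) monoid_scheme \<Rightarrow> enat" where
  "cohomological_dimension T G =
     Sup {enat n | n. \<exists>(A :: 'm monoid) \<phi>. G_module G A \<phi> \<and>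
       carrier (group_cohomology G A \<phi> n) \<noteq> {\<one>\<^bsub>group_cohomology G A \<phi> n\<^esub>}}"

definition homological_dimension :: "'m::infinite itself \<Rightarrow> ('g, 'k) monoid_scheme \<Rightarrow> enat" where
  "homological_dimension T G =
     Sup {enat n | n. \<exists>(A :: 'm monoid) \<phi>. G_module G A \<phi> \<and>
       carrier (group_homology G A \<phi> n) \<noteq> {\<one>\<^bsub>group_homology G A \<phi> n\<^esub>}}"

end

theory Submission
  imports Defs "HOL-Algebra.Free_Abelian_Groups" "HOL-Algebra.Elementary_Groups" "HOL-Combinatorics.Cycles"
begin

text \<open>
  Write \<open>\<gamma> x y\<close> for the first component of \<open>S (x, y)\<close>. The braid relation says that \<open>\<gamma>\<close> turns the
  defining relations \<open>xy = tz\<close> into identities between permutations of \<open>X\<close>, so the structure monoid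
  \<open>M\<close> and the structure group \<open>G\<close> act on \<open>X\<close>. Involutivity makes \<open>x \<mapsto> e\<^sub>x\<close> extend to 1-cocycles
  \<open>v\<close> with values in the lattice of integer functions on \<open>X\<close>, that is, \<open>v(ab) = v(a) + a v(b)\<close>. The point on
  which everything rests is that these cocycles are bijective: \<open>v\<close> identifies \<open>M\<close> with the functions
  \<open>X \<rightarrow> \<nat>\<close> and \<open>G\<close> with the functions \<open>X \<rightarrow> \<int>\<close>, the product being addition twisted by permutations of
  the coordinates (this is the \<open>I\<close>-structure of Etingof, Schedler and Soloviev). For the monoid, a word
  can be rewritten to start with any letter in the support of its vector
  (\<open>pull_letter\<close>, \<open>cong_if_word_v_eq\<close>); for the group, every element becomes positive after
  multiplication by a central element of \<open>M\<close> with constant vector (\<open>fraction_exists\<close>). The locales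
  \<open>lattice_monoid\<close> and \<open>lattice_cocycle\<close> retain only the bijective cocycle, and the three claims
  become statements about integer vectors.

  Garside element. Left divisibility is the pointwise order of vectors, so the right lcm of the generators is the
  vector constantly \<open>1\<close> and its left divisors are the \<open>0/1\<close> vectors. A right divisor contributes a permuted
  copy of its vector, hence is also a \<open>0/1\<close> vector, and taking complements shows that there are as many right as
  left divisors. Right-sided cancellation and lattice properties hold because the opposite monoid
  belongs to the mirrored solution.

  Dimension. The group \<open>G\<close> acts on the lattice preserving its pointwise order. The chains
  \<open>g\<^sub>0 < \<dots> < g\<^sub>k\<close> with \<open>g\<^sub>k \<le> g\<^sub>0 + 1\<close> are the simplices of the Freudenthal triangulation of Euclidean space;
  they span an acyclic invariant subcomplex of the bar complex (\<open>acyclic\<close>) whose simplices have at most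
  \<open>|X| + 1\<close> vertices. An equivariant chain map into it is equivariantly homotopic to the identity of
  the bar complex and is zero above degree \<open>|X|\<close>; the homotopy contracts the bar complex there
  (\<open>truncated_contraction\<close>), so no module has homology or cohomology in these degrees. In degree \<open>|X|\<close>,
  the group contains translations by nonzero multiples of all unit vectors. They span a torus whose
  fundamental cycle pairs nontrivially with the \<open>|X|\<close>-fold cup product of the cocycle \<open>v\<close>
  (\<open>cup_torus\<close>). The coefficients are the integer functions on \<open>X\<^sup>|\<^sup>X\<^sup>|\<close>: this module is countable, so it has
  a copy on any infinite type, and translations act trivially on it.

  Purity. The right complements of a generator \<open>x\<close> are \<open>1\<close> and the generators \<open>b\<^sup>-\<^sup>1 x\<close> with \<open>b\<close> not left divisible by
  \<open>x\<close>, and \<open>\<Delta>\<^sub>x\<close> is the indicator of this set \<open>C\<close>. Non-degeneracy on the right forces \<open>C\<close> to be stable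
  under all \<open>\<gamma> z\<close>, so \<open>C\<close> is the orbit of \<open>x\<close>, while the decompositions of \<open>X\<close> are
  exactly the partitions into two nonempty stable sets.
\<close>

section \<open>Simplicial chains on lists\<close>

abbreviation cells :: "('g \<Rightarrow>\<^sub>0 int) \<Rightarrow> 'g set" where
  "cells x \<equiv> Poly_Mapping.keys x"

definition cons :: "'g \<Rightarrow> ('g list \<Rightarrow>\<^sub>0 int) \<Rightarrow> ('g list \<Rightarrow>\<^sub>0 int)" where
  "cons a = frag_extend (\<lambda>l. frag_of (a # l))"

definition tr :: "('g \<Rightarrow> 'h) \<Rightarrow> ('g list \<Rightarrow>\<^sub>0 int) \<Rightarrow> ('h list \<Rightarrow>\<^sub>0 int)" where
  "tr f = frag_extend (\<lambda>l. frag_of (map f l))"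

text \<open>
  The simplicial boundary, in the recursive form in which the face omitting the first
  vertex is split off. The empty list is kept as a simplex of degree \<open>-1\<close>, so that the complex is
  augmented and acyclicity needs no special case in degree \<open>0\<close>.
\<close>

primrec face_sum :: "'g list \<Rightarrow> ('g list \<Rightarrow>\<^sub>0 int)" where
  "face_sum [] = 0"
| "face_sum (a # l) = frag_of l - cons a (face_sum l)"

definition bd :: "('g list \<Rightarrow>\<^sub>0 int) \<Rightarrow> ('g list \<Rightarrow>\<^sub>0 int)" where
  "bd = frag_extend face_sum"

text \<open>
  The signed triangulation of the prism between a simplex and its image under \<open>t\<close>.
\<close>

primrec prism_list :: "('g \<Rightarrow> 'g) \<Rightarrow> 'g list \<Rightarrow> ('g list \<Rightarrow>\<^sub>0 int)" where
  "prism_list t [] = 0"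
| "prism_list t (a # l) = frag_of (a # map t (a # l)) - cons a (prism_list t l)"

definition prism :: "('g \<Rightarrow> 'g) \<Rightarrow> ('g list \<Rightarrow>\<^sub>0 int) \<Rightarrow> ('g list \<Rightarrow>\<^sub>0 int)" where
  "prism t = frag_extend (prism_list t)"

lemma cons_simps [simp]:
  "cons a 0 = 0" "cons a (x + y) = cons a x + cons a y" "cons a (x - y) = cons a x - cons a y"
  "cons a (- x) = - cons a x" "cons a (frag_of l) = frag_of (a # l)"
  "cons a (frag_cmul k x) = frag_cmul k (cons a x)"
  by (simp_all add: cons_def frag_extend_add frag_extend_diff frag_extend_minus frag_extend_cmul)

lemma tr_simps [simp]:
  "tr f 0 = 0" "tr f (x + y) = tr f x + tr f y" "tr f (x - y) = tr f x - tr f y"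
  "tr f (- x) = - tr f x" "tr f (frag_of l) = frag_of (map f l)"
  "tr f (frag_cmul k x) = frag_cmul k (tr f x)"
  by (simp_all add: tr_def frag_extend_add frag_extend_diff frag_extend_minus frag_extend_cmul)

lemma bd_simps [simp]:
  "bd 0 = 0" "bd (x + y) = bd x + bd y" "bd (x - y) = bd x - bd y"
  "bd (- x) = - bd x" "bd (frag_of l) = face_sum l"
  "bd (frag_cmul k x) = frag_cmul k (bd x)"
  by (simp_all add: bd_def frag_extend_add frag_extend_diff frag_extend_minus frag_extend_cmul)

lemma prism_simps [simp]:
  "prism t 0 = 0" "prism t (x + y) = prism t x + prism t y" "prism t (x - y) = prism t x - prism t y"
  "prism t (- x) = - prism t x" "prism t (frag_of l) = prism_list t l"
  "prism t (frag_cmul k x) = frag_cmul k (prism t x)"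
  by (simp_all add: prism_def frag_extend_add frag_extend_diff frag_extend_minus frag_extend_cmul)

text \<open>
  Identities between linear maps of chains need to be checked on simplices only; most
  identities below are proved in this way.
\<close>

lemma additive_eqI:
  fixes F F' :: "('b \<Rightarrow>\<^sub>0 int) \<Rightarrow> 'c::ab_group_add"
  assumes "\<And>x y. F (x - y) = F x - F y" "\<And>x y. F' (x - y) = F' x - F' y"
    and "\<And>l. l \<in> cells x \<Longrightarrow> F (frag_of l) = F' (frag_of l)"
  shows "F x = F' x"
proof -
  have "F 0 = 0" "F' 0 = 0"
    using assms(1)[of 0 0] assms(2)[of 0 0] by simp_all
  then show ?thesis
    by (intro frag_induction[where P = "\<lambda>x. F x = F' x", OF order_refl[of "cells x"]])
      (simp_all add: assms)
qed

text \<open>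
  Adding a vertex in front is a contracting homotopy; hence \<open>bd \<circ> bd = 0\<close> is an immediate
  induction.
\<close>

lemma bd_cons [simp]: "bd (cons a x) = x - cons a (bd x)"
  by (rule additive_eqI) (auto simp: algebra_simps)

lemma bd_face_sum [simp]: "bd (face_sum l) = 0"
  by (induction l) auto

lemma bd_bd [simp]: "bd (bd x) = 0"
  by (rule additive_eqI) auto

lemma tr_cons: "tr f (cons a x) = cons (f a) (tr f x)"
  by (rule additive_eqI) (auto simp: algebra_simps)

lemma tr_face_sum: "tr f (face_sum l) = face_sum (map f l)"
  by (induction l) (auto simp: tr_cons)

lemma tr_bd: "tr f (bd x) = bd (tr f x)"
  by (rule additive_eqI) (auto simp: tr_face_sum)

lemma tr_tr: "tr f (tr g x) = tr (f \<circ> g) x"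
  by (rule additive_eqI) (auto simp: comp_def)

lemma tr_cong: "(\<And>l a. l \<in> cells x \<Longrightarrow> a \<in> set l \<Longrightarrow> f a = g a) \<Longrightarrow> tr f x = tr g x"
  unfolding tr_def by (rule frag_extend_eq) (auto simp: frag_of_eq)

lemma keys_cons: "cells (cons a x) \<subseteq> (#) a ` cells x"
  unfolding cons_def using keys_frag_extend[of "\<lambda>l. frag_of (a # l)" x] by (auto simp: keys_frag_of)

lemma keys_tr: "cells (tr f x) \<subseteq> map f ` cells x"
  unfolding tr_def using keys_frag_extend[of "\<lambda>l. frag_of (map f l)" x] by (auto simp: keys_frag_of)

text \<open>
  Faces in the usual numbering, to be compared with \<open>bar_face\<close> later.
\<close>

definition del :: "nat \<Rightarrow> 'g list \<Rightarrow> 'g list" where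
  "del i l = take i l @ drop (Suc i) l"

lemma face_sum_eq: "face_sum l = (\<Sum>i<length l. frag_cmul ((- 1) ^ i) (frag_of (del i l)))"
proof (induction l)
  case Nil
  then show ?case by simp
next
  case (Cons a l)
  have *: "cons a (sum f I) = (\<Sum>i\<in>I. cons a (f i))" if "finite I" for f and I :: "nat set"
    using that by (induction I) auto
  show ?case
    unfolding list.size add_0_right add_Suc_right sum.lessThan_Suc_shift
    by (simp add: Cons * del_def flip: sum_negf)
qed

lemma keys_face_sum: "cells (face_sum l) \<subseteq> (\<lambda>i. del i l) ` {..<length l}"
  unfolding face_sum_eq
  by (rule order_trans[OF keys_sum]) (auto simp: keys_frag_of split: if_splits)

lemma keys_bd: "cells (bd x) \<subseteq> {del i l | i l. l \<in> cells x \<and> i < length l}"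
proof -
  have "cells (bd x) \<subseteq> (\<Union>l\<in>cells x. cells (face_sum l))"
    unfolding bd_def by (rule keys_frag_extend)
  then show ?thesis using keys_face_sum by blast
qed

lemma length_del: "i < length l \<Longrightarrow> length (del i l) = length l - 1"
  by (auto simp: del_def)

lemma set_del: "set (del i l) \<subseteq> set l"
  by (auto simp: del_def dest: in_set_takeD in_set_dropD)

lemma keys_sub: "cells x \<subseteq> A \<Longrightarrow> cells y \<subseteq> A \<Longrightarrow> cells (x - y) \<subseteq> A" for A
  using keys_diff[of x y] by blast

lemma keys_plus: "cells x \<subseteq> A \<Longrightarrow> cells y \<subseteq> A \<Longrightarrow> cells (x + y) \<subseteq> A" for A
  using keys_add[of x y] by blast

lemma keys_frag_extendI: "(\<And>l. l \<in> cells x \<Longrightarrow> cells (f l) \<subseteq> A) \<Longrightarrow> cells (frag_extend f x) \<subseteq> A"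
  using keys_frag_extend[of f x] by blast

lemma prism_cons: "prism t (cons a x) = cons a (tr t (cons a x)) - cons a (prism t x)"
  by (rule additive_eqI) (auto simp: algebra_simps)

lemma prism_homotopy_list: "bd (prism_list t l) + prism t (face_sum l) = frag_of (map t l) - frag_of l"
proof (induction l)
  case (Cons a l)
  have 1: "prism t (face_sum l) = frag_of (map t l) - frag_of l - bd (prism_list t l)"
    using Cons by (simp add: algebra_simps)
  show ?case
    by (simp add: prism_cons tr_cons 1 tr_face_sum)
qed simp

lemma prism_homotopy: "bd (prism t x) + prism t (bd x) = tr t x - x"
  by (rule additive_eqI) (auto simp: prism_homotopy_list algebra_simps)

lemma tr_prism_list:
  assumes "\<And>a. a \<in> set l \<Longrightarrow> f (t a) = t (f a)"
  shows "tr f (prism_list t l) = prism_list t (map f l)"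
  using assms by (induction l) (auto simp: tr_cons frag_of_eq)

lemma keys_prism_list: "cells (prism_list t l) \<subseteq> {m. length m = Suc (length l) \<and> set m \<subseteq> set l \<union> t ` set l}"
proof (induction l)
  case (Cons a l)
  show ?case unfolding prism_list.simps
  proof (rule keys_sub)
    show "cells (cons a (prism_list t l)) \<subseteq> {m. length m = Suc (length (a # l)) \<and> set m \<subseteq> set (a # l) \<union> t ` set (a # l)}"
      using Cons keys_cons[of a "prism_list t l"] by fastforce
  qed (auto simp: keys_frag_of)
qed simp

section \<open>Groups that are lattices: acyclicity of the local chains\<close>

text \<open>
  The abstract form of the structure group: a bijective 1-cocycle into the integer functions on
  \<open>X\<close>. The group acts on these functions on the left by \<open>u \<mapsto> u \<circ> \<tau> g\<close>; storing the inverse permutation \<open>\<tau>\<close> instead of the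
  permutation itself is what makes this formula free of inverses, and it reverses the order of composition.
\<close>

locale lattice_cocycle = group G for G (structure) +
  fixes X :: "'x set" and v :: "'a \<Rightarrow> 'x \<Rightarrow> int" and \<tau> :: "'a \<Rightarrow> 'x \<Rightarrow> 'x"
  assumes finite_X: "finite X"
    and v_bij: "bij_betw v (carrier G) {u. \<forall>x. x \<notin> X \<longrightarrow> u x = 0}"
    and \<tau>_permutes: "g \<in> carrier G \<Longrightarrow> \<tau> g permutes X"
    and v_mult: "g \<in> carrier G \<Longrightarrow> h \<in> carrier G \<Longrightarrow> v (g \<otimes> h) = (\<lambda>x. v g x + v h (\<tau> g x))"
    and \<tau>_mult: "g \<in> carrier G \<Longrightarrow> h \<in> carrier G \<Longrightarrow> \<tau> (g \<otimes> h) = \<tau> h \<circ> \<tau> g"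
begin

definition le :: "'a \<Rightarrow> 'a \<Rightarrow> bool" where
  "le g h \<longleftrightarrow> (\<forall>x. v g x \<le> v h x)"

definition near :: "'a \<Rightarrow> 'a \<Rightarrow> bool" where
  "near g h \<longleftrightarrow> (\<forall>x. v h x \<le> v g x + 1)"

text \<open>
  Vertex lists of simplices of the Freudenthal triangulation: the cubes
  \<open>[g, g + 1]\<close> cut along their chains of vertices. Since left multiplication preserves the pointwise order, it
  preserves these lists together with the order of their vertices, so that no orientation characters occur.
\<close>

definition local_chain :: "'a list \<Rightarrow> bool" where
  "local_chain l \<longleftrightarrow> set l \<subseteq> carrier G \<and> sorted_wrt (\<lambda>g h. le g h \<and> g \<noteq> h) l \<and>
     (\<forall>g\<in>set l. \<forall>h\<in>set l. near g h)"

lemma v_outside: "g \<in> carrier G \<Longrightarrow> x \<notin> X \<Longrightarrow> v g x = 0"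
  using v_bij by (auto simp: bij_betw_def)

lemma v_inj: "g \<in> carrier G \<Longrightarrow> h \<in> carrier G \<Longrightarrow> (\<And>x. x \<in> X \<Longrightarrow> v g x = v h x) \<Longrightarrow> g = h"
proof -
  assume a: "g \<in> carrier G" "h \<in> carrier G" "\<And>x. x \<in> X \<Longrightarrow> v g x = v h x"
  then have "v g = v h" by (intro ext) (metis v_outside)
  then show "g = h" using a v_bij by (auto simp: bij_betw_def inj_on_def)
qed

lemma v_surj:
  assumes "\<And>x. x \<notin> X \<Longrightarrow> u x = 0"
  obtains g where "g \<in> carrier G" "v g = u"
proof -
  have "u \<in> v ` carrier G"
    using assms v_bij by (simp add: bij_betw_def)
  then show ?thesis using that by blast
qed

lemma le_refl [simp]: "le g g"
  by (simp add: le_def)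

lemma le_trans: "le g h \<Longrightarrow> le h k \<Longrightarrow> le g k"
  unfolding le_def by (meson order_trans)

lemma all_\<tau>: "k \<in> carrier G \<Longrightarrow> (\<forall>x. P (\<tau> k x)) \<longleftrightarrow> (\<forall>x. P x)"
  by (metis \<tau>_permutes permutes_surj surjD)

lemma le_mult: "k \<in> carrier G \<Longrightarrow> g \<in> carrier G \<Longrightarrow> h \<in> carrier G \<Longrightarrow> le (k \<otimes> g) (k \<otimes> h) \<longleftrightarrow> le g h"
  using all_\<tau>[of k "\<lambda>x. v g x \<le> v h x"] by (simp add: le_def v_mult)

lemma near_mult:
  "k \<in> carrier G \<Longrightarrow> g \<in> carrier G \<Longrightarrow> h \<in> carrier G \<Longrightarrow> near (k \<otimes> g) (k \<otimes> h) \<longleftrightarrow> near g h"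
  using all_\<tau>[of k "\<lambda>x. v h x \<le> v g x + 1"] by (simp add: near_def v_mult)

lemma local_chain_map:
  assumes "k \<in> carrier G" "local_chain l"
  shows "local_chain (map ((\<otimes>) k) l)"
proof -
  have c: "set l \<subseteq> carrier G" using assms(2) by (simp add: local_chain_def)
  have "sorted_wrt (\<lambda>g h. le (k \<otimes> g) (k \<otimes> h) \<and> k \<otimes> g \<noteq> k \<otimes> h) l"
    by (rule sorted_wrt_mono_rel[of _ "\<lambda>g h. le g h \<and> g \<noteq> h"])
      (use assms c in \<open>auto simp: le_mult local_chain_def subset_iff\<close>)
  then show ?thesis
    using assms c by (auto simp: local_chain_def sorted_wrt_map near_mult subset_iff)
qed

lemma local_chain_Cons:
  "local_chain (p # l) \<longleftrightarrow>
     p \<in> carrier G \<and> local_chain l \<and> (\<forall>g\<in>set l. le p g \<and> p \<noteq> g \<and> near p g \<and> near g p)"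
  by (auto simp: local_chain_def near_def)

lemma sorted_wrt_del: "sorted_wrt R l \<Longrightarrow> sorted_wrt R (del i l)"
proof -
  assume "sorted_wrt R l"
  then have "sorted_wrt R (take i l @ drop i l)" by simp
  then have "sorted_wrt R (take i l)" "sorted_wrt R (drop i l)"
    and *: "\<forall>x\<in>set (take i l). \<forall>y\<in>set (drop i l). R x y"
    unfolding sorted_wrt_append by auto
  moreover have "sorted_wrt R (drop (Suc i) l)" "set (drop (Suc i) l) \<subseteq> set (drop i l)"
    using \<open>sorted_wrt R l\<close> by (auto intro: sorted_wrt_drop set_drop_subset_set_drop simp: set_drop_subset_set_drop)
  ultimately show ?thesis
    unfolding del_def sorted_wrt_append using * by blast
qed

lemma local_chain_del: "local_chain l \<Longrightarrow> local_chain (del i l)"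
  using set_del[of i l] unfolding local_chain_def by (blast intro: sorted_wrt_del)

text \<open>
  The coordinate sum grows strictly along a chain but by at most \<open>|X|\<close> in total. This bound is the
  geometric dimension, and the source of the upper bound for the homological dimension.
\<close>

lemma length_local_chain:
  assumes "local_chain l"
  shows "length l \<le> Suc (card X)"
proof -
  define s where "s g = (\<Sum>x\<in>X. v g x)" for g
  have lt: "s g < s h" if *: "le g h" "g \<noteq> h" "g \<in> carrier G" "h \<in> carrier G" for g h
  proof -
    obtain x where "x \<in> X" "v g x \<noteq> v h x" using * v_inj[of g h] by blast
    then show ?thesis
      unfolding s_def using *(1) finite_X
      by (intro sum_strict_mono_ex1) (auto simp: le_def order.strict_iff_order)
  qed
  have carr: "set l \<subseteq> carrier G" using assms by (simp add: local_chain_def)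
  have "sorted_wrt (\<lambda>g h. s g < s h) l"
    by (rule sorted_wrt_mono_rel[of _ "\<lambda>g h. le g h \<and> g \<noteq> h"])
      (use assms lt subsetD[OF carr] in \<open>simp_all add: local_chain_def\<close>)
  then have sd: "sorted_wrt (<) (map s l)" by (simp add: sorted_wrt_map)
  show ?thesis
  proof (cases l)
    case (Cons a l')
    have "set (map s l) \<subseteq> {s a..s a + int (card X)}"
    proof
      fix y assume "y \<in> set (map s l)"
      then obtain g where g: "g \<in> set l" "y = s g" by auto
      have "s a \<le> s g" using sd g Cons by (auto simp: less_imp_le)
      moreover have "s g \<le> (\<Sum>x\<in>X. v a x + 1)"
        unfolding s_def using assms g Cons by (intro sum_mono) (auto simp: local_chain_def near_def)
      ultimately show "y \<in> {s a..s a + int (card X)}"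
        by (simp add: g(2) s_def sum.distrib)
    qed
    then have "card (set (map s l)) \<le> card {s a..s a + int (card X)}"
      by (intro card_mono) auto
    moreover have "distinct (map s l)" using sd strict_sorted_iff by blast
    ultimately show ?thesis using distinct_card[of "map s l"] by simp
  qed simp
qed

text \<open>
  The pointwise order is locally finite, so acyclicity can be proved by induction over finite sets of vertices.
\<close>

lemma finite_interval: "finite {g \<in> carrier G. le b g \<and> le g a}"
proof -
  let ?I = "{g \<in> carrier G. le b g \<and> le g a}"
  have "finite (\<Pi>\<^sub>E x\<in>X. {v b x..v a x})"
    using finite_X by (intro finite_PiE) auto
  moreover have "(\<lambda>g. restrict (v g) X) ` ?I \<subseteq> (\<Pi>\<^sub>E x\<in>X. {v b x..v a x})"
    by (auto simp: le_def)
  moreover have "inj_on (\<lambda>g. restrict (v g) X) ?I"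
    by (rule inj_onI) (metis (no_types, lifting) CollectD restrict_apply v_inj)
  ultimately show ?thesis by (meson finite_subset inj_on_finite)
qed

definition chains :: "'a set \<Rightarrow> nat \<Rightarrow> ('a list \<Rightarrow>\<^sub>0 int) set" where
  "chains W n = {x. cells x \<subseteq> {l. local_chain l \<and> set l \<subseteq> W \<and> length l = n}}"

lemma chains_diff: "x \<in> chains W n \<Longrightarrow> y \<in> chains W n \<Longrightarrow> x - y \<in> chains W n"
  unfolding chains_def using keys_sub by blast

lemma chains_plus: "x \<in> chains W n \<Longrightarrow> y \<in> chains W n \<Longrightarrow> x + y \<in> chains W n"
  unfolding chains_def using keys_plus by blast

lemma chains_mono: "W \<subseteq> W' \<Longrightarrow> chains W n \<subseteq> chains W' n"
  unfolding chains_def by blast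

lemma bd_chains: "x \<in> chains W (Suc n) \<Longrightarrow> bd x \<in> chains W n"
  using keys_bd[of x] unfolding chains_def
  by (fastforce simp: length_del local_chain_del dest: subsetD[OF set_del])

lemma frag_extend_chains: "(\<And>l. l \<in> cells x \<Longrightarrow> f l \<in> chains W n) \<Longrightarrow> frag_extend f x \<in> chains W n"
  unfolding chains_def using keys_frag_extendI[of x f "{l. local_chain l \<and> set l \<subseteq> W \<and> length l = n}"] by blast

lemma cons_inj: "cons p x = cons p y \<longleftrightarrow> x = y"
proof
  have "Poly_Mapping.lookup (cons p x) (p # l) = Poly_Mapping.lookup x l" for x l
  proof -
    have "(\<lambda>x. Poly_Mapping.lookup (cons p x) (p # l)) x = (\<lambda>x. Poly_Mapping.lookup x l) x"
      by (rule additive_eqI) (auto simp: lookup_minus)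
    then show ?thesis .
  qed
  then show "cons p x = cons p y \<Longrightarrow> x = y"
    by (metis poly_mapping_eqI)
qed simp

text \<open>
  A minimal vertex can only be the first one of a simplex. So a chain splits into the cone from
  that vertex over a chain in its link, and a part that avoids the vertex.
\<close>

lemma decompose_chain:
  assumes "x \<in> chains W (Suc n)" and p: "p \<in> W" and min: "\<And>g. g \<in> W \<Longrightarrow> le g p \<Longrightarrow> g = p"
  obtains y x' where "x = cons p y + x'" "x' \<in> chains (W - {p}) (Suc n)"
    "y \<in> chains {g \<in> W. le p g \<and> g \<noteq> p \<and> near p g} n"
proof -
  have 1: "l \<in> {l. \<exists>m. l = p # m}" if "local_chain l" "set l \<subseteq> W" "p \<in> set l" for l
    using that min by (cases l) (auto simp: local_chain_Cons)
  let ?A = "{l. local_chain l \<and> set l \<subseteq> W \<and> length l = Suc n \<and> hd l = p}"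
  let ?B = "{l. local_chain l \<and> set l \<subseteq> W - {p} \<and> length l = Suc n}"
  have "cells x \<subseteq> ?A \<union> ?B"
  proof
    fix l assume "l \<in> cells x"
    then have l: "local_chain l" "set l \<subseteq> W" "length l = Suc n" using assms(1) by (auto simp: chains_def)
    then show "l \<in> ?A \<union> ?B" using 1[of l] by auto
  qed
  then obtain a b where ab: "cells a \<subseteq> ?A" "cells b \<subseteq> ?B" "a + b = x"
    by (rule frag_split)
  define y where "y = frag_extend (\<lambda>l. frag_of (tl l)) a"
  have "cons p y = a"
  proof -
    have "(\<lambda>a. cons p (frag_extend (\<lambda>l. frag_of (tl l)) a)) a = (\<lambda>a. a) a"
    proof (rule additive_eqI)
      fix l assume "l \<in> cells a"
      then have "length l = Suc n" "hd l = p" using ab(1) by auto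
      then show "cons p (frag_extend (\<lambda>l. frag_of (tl l)) (frag_of l)) = frag_of l"
        by (cases l) auto
    qed (auto simp: frag_extend_diff)
    then show ?thesis by (simp add: y_def)
  qed
  moreover have "y \<in> chains {g \<in> W. le p g \<and> g \<noteq> p \<and> near p g} n"
    unfolding y_def
  proof (rule frag_extend_chains)
    fix l assume "l \<in> cells a"
    then have "local_chain l" "set l \<subseteq> W" "length l = Suc n" "hd l = p" using ab(1) by auto
    then show "frag_of (tl l) \<in> chains {g \<in> W. le p g \<and> g \<noteq> p \<and> near p g} n"
      by (cases l) (auto simp: chains_def keys_frag_of local_chain_Cons)
  qed
  moreover have "b \<in> chains (W - {p}) (Suc n)" using ab(2) by (simp add: chains_def)
  ultimately show ?thesis using that ab(3) by blast
qed

text \<open>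
  Remove a minimal vertex \<open>p\<close> from an upper set \<open>W\<close> of \<open>{g. g \<le> a}\<close>. Its link in \<open>W\<close> is
  \<open>{g. p < g \<le> c}\<close> for \<open>c = min a (p + 1)\<close>, again an upper set of the same kind. By induction the
  link and \<open>W - {p}\<close> are acyclic, and hence so is \<open>W\<close>.
\<close>

lemma acyclic_upset:
  assumes "finite W" "W \<subseteq> {g \<in> carrier G. le g a}" "a \<in> W"
    and "\<And>g h. g \<in> W \<Longrightarrow> h \<in> carrier G \<Longrightarrow> le g h \<Longrightarrow> le h a \<Longrightarrow> h \<in> W"
    and "x \<in> chains W n" "bd x = 0"
  shows "\<exists>y\<in>chains W (Suc n). bd y = x"
  using assms
proof (induction "card W" arbitrary: W a x n rule: less_induct)
  case less
  have aG: "a \<in> carrier G" using less.prems by blast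
  show ?case
  proof (cases n)
    case 0
    then have "cells x \<subseteq> {[]}" using less.prems(5) by (auto simp: chains_def)
    then have x: "x = frag_cmul (Poly_Mapping.lookup x []) (frag_of [])"
      by (intro poly_mapping_eqI) (auto simp: in_keys_iff)
    show ?thesis
    proof
      show "bd (frag_cmul (Poly_Mapping.lookup x []) (frag_of [a])) = x"
        using x by simp
      show "frag_cmul (Poly_Mapping.lookup x []) (frag_of [a]) \<in> chains W (Suc n)"
        unfolding chains_def using less.prems(3) aG 0 keys_cmul[of "Poly_Mapping.lookup x []" "frag_of [a]"]
        by (auto simp: keys_frag_of local_chain_def near_def)
    qed
  next
    case (Suc m)
    show ?thesis
    proof (cases "W = {a}")
      case True
      have one: "l = [a]" if "l \<in> cells x" for l
      proof -
        have l: "local_chain l" "set l \<subseteq> {a}" "length l = Suc m"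
          using that less.prems(5) Suc True by (auto simp: chains_def)
        then obtain l' where l': "l = a # l'" by (cases l) auto
        then have "l' = []" using l by (cases l') (auto simp: local_chain_Cons)
        then show ?thesis using l' by simp
      qed
      then have x: "x = frag_cmul (Poly_Mapping.lookup x [a]) (frag_of [a])"
        by (intro poly_mapping_eqI) (auto simp: in_keys_iff)
      then have "bd x = frag_cmul (Poly_Mapping.lookup x [a]) (frag_of [])"
        by (metis bd_simps(5,6) cons_simps(1) diff_zero face_sum.simps)
      then have "x = 0" using less.prems(6) x by simp
      then show ?thesis by (intro bexI[of _ 0]) (auto simp: chains_def)
    next
      case False
      obtain p where p: "p \<in> W" "p \<noteq> a" and min: "\<And>g. g \<in> W \<Longrightarrow> le g p \<Longrightarrow> g = p"
      proof -
        obtain b where b: "b \<in> W" "b \<noteq> a" using False less.prems(3) by blast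
        define s where "s g = (\<Sum>x\<in>X. v g x)" for g
        obtain p where p: "p \<in> W" "\<And>g. g \<in> W \<Longrightarrow> s p \<le> s g"
          using arg_min_on_def arg_min_if_finite[of W s] less.prems(1) b by (metis empty_iff linorder_not_le)
        have eq: "g = h" if "le g h" "s h \<le> s g" "g \<in> W" "h \<in> W" for g h
        proof (rule v_inj)
          show "g \<in> carrier G" "h \<in> carrier G" using that less.prems(2) by auto
          fix x assume "x \<in> X"
          have "(\<Sum>x\<in>X. v h x - v g x) = 0"
            using that sum_mono[of X "v g" "v h"] by (simp add: s_def sum_subtractf le_def)
          then show "v g x = v h x"
            using sum_nonneg_eq_0_iff[OF finite_X, of "\<lambda>x. v h x - v g x"] that(1) \<open>x \<in> X\<close>
            by (simp add: le_def)
        qed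
        show ?thesis
        proof (rule that)
          show "p \<in> W" by fact
          show "g = p" if "g \<in> W" "le g p" for g using eq[of g p] that p by blast
          show "p \<noteq> a" using eq[of b a] b p less.prems(2,3) by blast
        qed
      qed
      have pG: "p \<in> carrier G" and pa: "le p a" using p less.prems(2) by auto
      obtain c where c: "c \<in> carrier G" "v c = (\<lambda>x. min (v a x) (v p x + 1) * (if x \<in> X then 1 else 0))"
        by (rule v_surj[of "\<lambda>x. min (v a x) (v p x + 1) * (if x \<in> X then 1 else 0)"]) auto
      have c': "v c x = min (v a x) (v p x + 1)" for x
        using c v_outside[OF aG] v_outside[OF pG] by (cases "x \<in> X") auto
      define L where "L = {g \<in> W. le p g \<and> g \<noteq> p \<and> near p g}"
      have pc: "le p c" using pa by (auto simp: le_def c')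
      have ca: "le c a" by (auto simp: le_def c')
      have cW: "c \<in> W" using less.prems(4)[OF p(1) c(1) pc ca] .
      obtain x0 where x0: "v p x0 \<noteq> v a x0" using p pG aG v_inj by blast
      then have "v c x0 \<noteq> v p x0" using pa by (auto simp: c' le_def min_def)
      then have "c \<noteq> p" by blast
      then have "c \<in> L" using cW pc by (simp add: L_def near_def c')
      obtain y x' where x: "x = cons p y + x'" "x' \<in> chains (W - {p}) n" "y \<in> chains L m"
        using decompose_chain[OF less.prems(5)[unfolded Suc] p(1) min] unfolding L_def Suc by blast
      \<comment> \<open>the other terms of \<open>bd x = 0\<close> avoid the vertex \<open>p\<close>\<close>
      have "cons p (bd y) = 0"
      proof -
        have eq: "cons p (bd y) = y + bd x'" using less.prems(6) x(1) by (simp add: algebra_simps)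
        have "bd x' \<in> chains (W - {p}) m" using bd_chains x(2) Suc by blast
        moreover have "y \<in> chains (W - {p}) m"
          using x(3) chains_mono[of L "W - {p}" m] by (auto simp: L_def)
        ultimately have "cells (cons p (bd y)) \<subseteq> {l. set l \<subseteq> W - {p}}"
          unfolding eq using chains_plus[of y "W - {p}" m "bd x'"] by (auto simp: chains_def)
        moreover have "cells (cons p (bd y)) \<subseteq> {l. p \<in> set l}"
          using keys_cons[of p "bd y"] by auto
        ultimately have "cells (cons p (bd y)) = {}" by blast
        then show ?thesis by simp
      qed
      then have "bd y = 0" using cons_inj[of p "bd y" 0] by simp
      have "\<exists>y'\<in>chains L (Suc m). bd y' = y"
      proof (rule less.hyps)
        have "L \<subset> W" using p(1) by (auto simp: L_def)
        then show "card L < card W" using less.prems(1) by (simp add: psubset_card_mono)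
        show "finite L" using less.prems(1) by (simp add: L_def)
        show "L \<subseteq> {g \<in> carrier G. le g c}"
          using less.prems(2) by (auto simp: L_def le_def near_def c')
        show "h \<in> L" if "g \<in> L" "h \<in> carrier G" "le g h" "le h c" for g h
        proof -
          have "h \<in> W" using less.prems(4)[of g h] that le_trans[OF _ ca] by (auto simp: L_def)
          moreover have "le p h" using that le_trans[of p g h] by (auto simp: L_def)
          moreover have "near p h" using that(4) by (auto simp: le_def near_def c')
          moreover have "h \<noteq> p" using that(1,3) min[of g] by (auto simp: L_def)
          ultimately show ?thesis by (simp add: L_def)
        qed
      qed (use \<open>c \<in> L\<close> \<open>bd y = 0\<close> x in auto)
      then obtain y' where y': "y' \<in> chains L (Suc m)" "bd y' = y" by blast
      have py': "cons p y' \<in> chains W (Suc n)"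
        unfolding cons_def
      proof (rule frag_extend_chains)
        fix l assume "l \<in> cells y'"
        then have "local_chain l" "set l \<subseteq> L" "length l = n" using y'(1) Suc by (auto simp: chains_def)
        then show "frag_of (p # l) \<in> chains W (Suc n)"
          using pG p(1) by (fastforce simp: chains_def keys_frag_of local_chain_Cons L_def near_def le_def
              intro: order_trans[OF _ less_imp_le])
      qed
      have sub: "chains (W - {p}) k \<subseteq> chains W k" for k by (rule chains_mono) auto
      have "\<exists>y''\<in>chains (W - {p}) (Suc n). bd y'' = y' + x'"
      proof (rule less.hyps)
        show "card (W - {p}) < card W" using less.prems(1) p(1) by (meson card_Diff1_less)
        show "y' + x' \<in> chains (W - {p}) n"
          using x(2) y'(1) chains_mono[of L "W - {p}" "Suc m"] Suc by (auto simp: L_def intro: chains_plus)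
        show "bd (y' + x') = 0" using less.prems(6) x(1) \<open>bd y = 0\<close> y'(2) by simp
        show "h \<in> W - {p}" if "g \<in> W - {p}" "h \<in> carrier G" "le g h" "le h a" for g h
          using that less.prems(4)[of g h] min[of g] by auto
      qed (use less.prems p in auto)
      then obtain y'' where y'': "y'' \<in> chains (W - {p}) (Suc n)" "bd y'' = y' + x'" by blast
      show ?thesis
      proof
        show "bd (y'' - cons p y') = x" using y''(2) y'(2) x(1) by simp
        show "y'' - cons p y' \<in> chains W (Suc n)" using sub y''(1) py' by (blast intro: chains_diff)
      qed
    qed
  qed
qed

lemma finite_bounds:
  assumes "finite A" "A \<subseteq> carrier G"
  obtains a b where "a \<in> carrier G" "b \<in> carrier G" "le b a" "\<And>g. g \<in> A \<Longrightarrow> le b g \<and> le g a"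
proof -
  have "\<exists>a\<in>carrier G. \<exists>b\<in>carrier G. le b a \<and> (\<forall>g\<in>A. le b g \<and> le g a)"
    using assms
  proof (induction A rule: finite_induct)
    case empty
    show ?case by (intro bexI[of _ \<one>]) auto
  next
    case (insert h A)
    then obtain a b where ab: "a \<in> carrier G" "b \<in> carrier G" "le b a" "\<forall>g\<in>A. le b g \<and> le g a" by auto
    obtain a' where a': "a' \<in> carrier G" "v a' = (\<lambda>x. max (v a x) (v h x))"
      by (rule v_surj[of "\<lambda>x. max (v a x) (v h x)"]) (use ab insert.prems v_outside in auto)
    obtain b' where b': "b' \<in> carrier G" "v b' = (\<lambda>x. min (v b x) (v h x))"
      by (rule v_surj[of "\<lambda>x. min (v b x) (v h x)"]) (use ab insert.prems v_outside in auto)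
    have "le b' b" "le b' h" "le a a'" "le h a'"
      using a' b' by (auto simp: le_def)
    then show ?case
      using a' b' ab by (intro bexI[of _ a'] bexI[of _ b']) (auto intro: le_trans)
  qed
  then show ?thesis using that by blast
qed

lemma acyclic:
  assumes "x \<in> chains (carrier G) n" "bd x = 0"
  shows "\<exists>y\<in>chains (carrier G) (Suc n). bd y = x"
proof -
  have "finite (\<Union>(set ` cells x))" "\<Union>(set ` cells x) \<subseteq> carrier G"
    using assms(1) by (auto simp: chains_def)
  then obtain a b where ab: "a \<in> carrier G" "b \<in> carrier G" "le b a"
    "\<And>g. g \<in> \<Union>(set ` cells x) \<Longrightarrow> le b g \<and> le g a"
    by (rule finite_bounds) blast
  let ?W = "{g \<in> carrier G. le b g \<and> le g a}"
  have "\<exists>y\<in>chains ?W (Suc n). bd y = x"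
  proof (rule acyclic_upset)
    show "x \<in> chains ?W n" using ab(4) assms(1) by (fastforce simp: chains_def)
    show "a \<in> ?W" using ab by simp
    show "h \<in> ?W" if "g \<in> ?W" "h \<in> carrier G" "le g h" "le h a" for g h
      using that le_trans[of b g h] by simp
  qed (use assms(2) in \<open>auto simp: finite_interval\<close>)
  then show ?thesis using chains_mono[of ?W "carrier G"] by blast
qed

end

section \<open>Contracting the bar complex above the rank\<close>

context group
begin

text \<open>
  The representative of an orbit whose first vertex is the neutral element. Left
  multiplication is free on nonempty lists, so a map defined on representatives extends uniquely to an
  equivariant one.
\<close>

definition based :: "'a list \<Rightarrow> 'a list" where
  "based l = map ((\<otimes>) (inv (hd l))) l"

text \<open>
  Vertex lists of \<open>n\<close> elements, that is, simplices of degree \<open>n - 1\<close>.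
\<close>

definition bar :: "nat \<Rightarrow> 'a list set" where
  "bar n = {l. set l \<subseteq> carrier G \<and> length l = n}"

lemma cells_face_sum_bar: "l \<in> bar (Suc n) \<Longrightarrow> cells (face_sum l) \<subseteq> bar n"
  using keys_face_sum[of l] set_del unfolding bar_def by (fastforce simp: length_del)

lemma map_bar: "g \<in> carrier G \<Longrightarrow> l \<in> bar n \<Longrightarrow> map ((\<otimes>) g) l \<in> bar n"
  by (auto simp: bar_def)

lemma cells_tr_bar: "g \<in> carrier G \<Longrightarrow> cells x \<subseteq> bar n \<Longrightarrow> cells (tr ((\<otimes>) g) x) \<subseteq> bar n"
  using keys_tr[of "(\<otimes>) g" x] map_bar by blast

lemma cells_cons_bar: "g \<in> carrier G \<Longrightarrow> cells x \<subseteq> bar n \<Longrightarrow> cells (cons g x) \<subseteq> bar (Suc n)"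
  using keys_cons[of g x] unfolding bar_def by fastforce

lemma tr_mult_mult:
  "g \<in> carrier G \<Longrightarrow> h \<in> carrier G \<Longrightarrow> cells x \<subseteq> bar n \<Longrightarrow>
     tr ((\<otimes>) g) (tr ((\<otimes>) h) x) = tr ((\<otimes>) (g \<otimes> h)) x"
  unfolding tr_tr by (rule tr_cong) (auto simp: bar_def m_assoc subset_iff)

lemma based_bar: "l \<in> bar (Suc n) \<Longrightarrow> based l \<in> bar (Suc n)"
  by (cases l) (auto simp: bar_def based_def)

lemma hd_bar: "l \<in> bar (Suc n) \<Longrightarrow> hd l \<in> carrier G"
  by (cases l) (auto simp: bar_def)

lemma map_hd_based: "l \<in> bar (Suc n) \<Longrightarrow> map ((\<otimes>) (hd l)) (based l) = l"
proof (cases l)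
  case (Cons a m)
  assume "l \<in> bar (Suc n)"
  then have "set l \<subseteq> carrier G" "a \<in> carrier G" using Cons by (auto simp: bar_def)
  then show ?thesis by (auto simp: based_def Cons m_assoc[symmetric] intro!: map_idI)
qed (simp add: bar_def)

lemma based_map: "g \<in> carrier G \<Longrightarrow> l \<in> bar (Suc n) \<Longrightarrow> based (map ((\<otimes>) g) l) = based l"
proof (cases l)
  case (Cons a m)
  assume g: "g \<in> carrier G" and "l \<in> bar (Suc n)"
  then have l: "set l \<subseteq> carrier G" "a \<in> carrier G" using Cons by (auto simp: bar_def)
  have "inv (g \<otimes> a) \<otimes> (g \<otimes> b) = inv a \<otimes> b" if "b \<in> carrier G" for b
    using g l that by (simp add: inv_mult_group m_assoc) (simp add: m_assoc[symmetric])
  then show ?thesis using l by (auto simp: based_def Cons)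
qed (simp add: bar_def)

lemma equivariant_extend:
  assumes "\<And>l. l \<in> bar n \<Longrightarrow> f (map ((\<otimes>) g) l) = tr ((\<otimes>) g) (f l)" "cells x \<subseteq> bar n"
  shows "frag_extend f (tr ((\<otimes>) g) x) = tr ((\<otimes>) g) (frag_extend f x)"
  by (rule additive_eqI) (use assms in \<open>auto simp: frag_extend_diff\<close>)


definition equivariant_map :: "('a list \<Rightarrow> ('a list \<Rightarrow>\<^sub>0 int)) \<Rightarrow> 'a list \<Rightarrow> ('a list \<Rightarrow>\<^sub>0 int)" where
  "equivariant_map f l = tr ((\<otimes>) (hd l)) (f (based l))"

lemma equivariant_map_equivariant:
  assumes "g \<in> carrier G" "l \<in> bar (Suc n)" "cells (f (based l)) \<subseteq> bar k"
  shows "equivariant_map f (map ((\<otimes>) g) l) = tr ((\<otimes>) g) (equivariant_map f l)"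
proof -
  have "l \<noteq> []" using assms(2) by (auto simp: bar_def)
  then show ?thesis
    using assms by (simp add: equivariant_map_def based_map tr_mult_mult[where n = k] hd_bar hd_map)
qed

end

context lattice_cocycle
begin

lemma chains_bar: "x \<in> chains (carrier G) n \<Longrightarrow> cells x \<subseteq> bar n"
  unfolding chains_def bar_def by blast

text \<open>
  A non-equivariant choice of bounding chains; equivariance is restored by choosing only on
  representatives of orbits.
\<close>

definition filling :: "nat \<Rightarrow> ('a list \<Rightarrow>\<^sub>0 int) \<Rightarrow> ('a list \<Rightarrow>\<^sub>0 int)" where
  "filling n x = (SOME y. y \<in> chains (carrier G) n \<and> bd y = x)"

lemma filling:
  assumes "x \<in> chains (carrier G) n" "bd x = 0"
  shows "filling (Suc n) x \<in> chains (carrier G) (Suc n)" "bd (filling (Suc n) x) = x"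
  using someI_ex[of "\<lambda>y. y \<in> chains (carrier G) (Suc n) \<and> bd y = x"] acyclic[OF assms]
  unfolding filling_def by blast+

text \<open>
  An equivariant chain map from the bar complex to the local chains, by the method of acyclic models:
  the image of a simplex fills the image of its boundary.
\<close>

primrec local_map :: "nat \<Rightarrow> 'a list \<Rightarrow> ('a list \<Rightarrow>\<^sub>0 int)" where
  "local_map 0 = frag_of"
| "local_map (Suc n) =
     equivariant_map (\<lambda>l. filling (Suc n) (frag_extend (local_map n) (face_sum l)))"

text \<open>
  The homotopy between the identity and \<open>local_map\<close>, built by the same recursion, with the explicit contraction
  \<open>cons \<one>\<close> of the bar complex in place of a choice.
\<close>

primrec homotopy :: "nat \<Rightarrow> 'a list \<Rightarrow> ('a list \<Rightarrow>\<^sub>0 int)" where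
  "homotopy 0 = (\<lambda>l. 0)"
| "homotopy (Suc n) =
     equivariant_map (\<lambda>l. cons \<one> (frag_of l - local_map (Suc n) l -
       frag_extend (homotopy n) (face_sum l)))"

lemma tr_chains:
  assumes "g \<in> carrier G" "x \<in> chains (carrier G) n"
  shows "tr ((\<otimes>) g) x \<in> chains (carrier G) n"
  unfolding tr_def
proof (rule frag_extend_chains)
  fix l assume "l \<in> cells x"
  then have "local_chain l" "length l = n" using assms(2) by (auto simp: chains_def)
  then have "local_chain (map ((\<otimes>) g) l)" "length l = n" using assms(1) local_chain_map by auto
  then show "frag_of (map ((\<otimes>) g) l) \<in> chains (carrier G) n"
    by (auto simp: chains_def keys_frag_of local_chain_def)
qed

lemma local_map_extend:
  assumes "\<And>l. l \<in> bar n \<Longrightarrow> local_map n l \<in> chains (carrier G) n" "cells x \<subseteq> bar n"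
  shows "frag_extend (local_map n) x \<in> chains (carrier G) n"
  by (rule frag_extend_chains) (use assms in auto)

lemma local_map:
  assumes "l \<in> bar n"
  shows "local_map n l \<in> chains (carrier G) n \<and>
     bd (local_map n l) = (case n of 0 \<Rightarrow> 0 | Suc m \<Rightarrow> frag_extend (local_map m) (face_sum l)) \<and>
     (\<forall>g\<in>carrier G. local_map n (map ((\<otimes>) g) l) = tr ((\<otimes>) g) (local_map n l))"
  using assms
proof (induction n arbitrary: l)
  case 0
  then show ?case by (auto simp: bar_def chains_def keys_frag_of local_chain_def)
next
  case (Suc n)
  define l0 where "l0 = based l"
  define z where "z = frag_extend (local_map n) (face_sum l0)"
  have l0: "l0 \<in> bar (Suc n)" and hG: "hd l \<in> carrier G"
    using Suc.prems by (auto simp: l0_def based_bar hd_bar)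
  have ext: "bd (frag_extend (local_map n) x) =
      (case n of 0 \<Rightarrow> 0 | Suc m \<Rightarrow> frag_extend (local_map m) (bd x))" if "cells x \<subseteq> bar n" for x
  proof (cases n)
    case 0
    show ?thesis
      by (rule additive_eqI[of "\<lambda>x. bd (frag_extend (local_map n) x)"])
        (use that Suc.IH 0 in \<open>auto simp: frag_extend_diff\<close>)
  next
    case (Suc m)
    show ?thesis
      by (rule additive_eqI[of "\<lambda>x. bd (frag_extend (local_map n) x)"])
        (use that Suc.IH Suc in \<open>auto simp: frag_extend_diff simp del: local_map.simps\<close>)
  qed
  have "bd z = 0"
    unfolding z_def ext[OF cells_face_sum_bar[OF l0]] by (simp split: nat.split)
  moreover have zc: "z \<in> chains (carrier G) n"
    unfolding z_def by (rule local_map_extend) (use Suc.IH cells_face_sum_bar[OF l0] in auto)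
  ultimately have f: "filling (Suc n) z \<in> chains (carrier G) (Suc n)" "bd (filling (Suc n) z) = z"
    using filling by blast+
  have T: "local_map (Suc n) l = tr ((\<otimes>) (hd l)) (filling (Suc n) z)"
    by (simp add: equivariant_map_def z_def l0_def)
  have "bd (local_map (Suc n) l) = tr ((\<otimes>) (hd l)) z"
    by (simp only: T tr_bd[symmetric] f)
  also have "\<dots> = frag_extend (local_map n) (tr ((\<otimes>) (hd l)) (face_sum l0))"
    unfolding z_def using Suc.IH cells_face_sum_bar[OF l0] hG by (intro equivariant_extend[symmetric]) auto
  also have "\<dots> = frag_extend (local_map n) (face_sum l)"
    by (simp add: tr_face_sum l0_def map_hd_based[OF Suc.prems])
  finally have "bd (local_map (Suc n) l) = frag_extend (local_map n) (face_sum l)" .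
  moreover have "local_map (Suc n) l \<in> chains (carrier G) (Suc n)"
    unfolding T by (rule tr_chains[OF hG f(1)])
  moreover have "local_map (Suc n) (map ((\<otimes>) g) l) = tr ((\<otimes>) g) (local_map (Suc n) l)"
    if "g \<in> carrier G" for g
    unfolding local_map.simps
    by (rule equivariant_map_equivariant[OF that Suc.prems])
      (use chains_bar[OF f(1)] in \<open>simp add: z_def l0_def\<close>)
  ultimately show ?case by simp
qed

lemma homotopy:
  assumes "l \<in> bar n"
  shows "cells (homotopy n l) \<subseteq> bar (Suc n) \<and>
     bd (homotopy n l) = frag_of l - local_map n l -
       (case n of 0 \<Rightarrow> 0 | Suc m \<Rightarrow> frag_extend (homotopy m) (face_sum l)) \<and>
     (\<forall>g\<in>carrier G. homotopy n (map ((\<otimes>) g) l) = tr ((\<otimes>) g) (homotopy n l))"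
  using assms
proof (induction n arbitrary: l)
  case 0
  then show ?case by simp
next
  case (Suc n)
  define l0 where "l0 = based l"
  define w where "w = frag_of l0 - local_map (Suc n) l0 - frag_extend (homotopy n) (face_sum l0)"
  have l0: "l0 \<in> bar (Suc n)" and hG: "hd l \<in> carrier G"
    using Suc.prems by (auto simp: l0_def based_bar hd_bar)
  have wc: "cells w \<subseteq> bar (Suc n)"
    unfolding w_def
  proof (intro keys_sub keys_frag_extendI)
    show "cells (local_map (Suc n) l0) \<subseteq> bar (Suc n)" using local_map[OF l0] chains_bar by blast
    show "cells (homotopy n m) \<subseteq> bar (Suc n)" if "m \<in> cells (face_sum l0)" for m
      using Suc.IH that cells_face_sum_bar[OF l0] by blast
  qed (use l0 in \<open>simp add: keys_frag_of\<close>)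
  have ext: "bd (frag_extend (homotopy n) x) = x - frag_extend (local_map n) x -
      (case n of 0 \<Rightarrow> 0 | Suc m \<Rightarrow> frag_extend (homotopy m) (bd x))" if "cells x \<subseteq> bar n" for x
  proof (cases n)
    case 0
    show ?thesis
      by (rule additive_eqI[of "\<lambda>x. bd (frag_extend (homotopy n) x)"])
        (use that Suc.IH 0 in \<open>auto simp: frag_extend_diff\<close>)
  next
    case (Suc m)
    show ?thesis
      by (rule additive_eqI[of "\<lambda>x. bd (frag_extend (homotopy n) x)"])
        (use that Suc.IH Suc in \<open>auto simp: frag_extend_diff simp del: local_map.simps homotopy.simps\<close>)
  qed
  have "bd w = 0"
    using local_map[OF l0] ext[OF cells_face_sum_bar[OF l0]]
    by (auto simp: w_def simp del: local_map.simps split: nat.split)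
  have H: "homotopy (Suc n) l = tr ((\<otimes>) (hd l)) (cons \<one> w)"
    by (simp add: equivariant_map_def w_def l0_def del: local_map.simps)
  have "bd (homotopy (Suc n) l) = tr ((\<otimes>) (hd l)) w"
    using \<open>bd w = 0\<close> by (simp only: H tr_bd[symmetric] bd_cons cons_simps diff_zero)
  also have "\<dots> = frag_of (map ((\<otimes>) (hd l)) l0) - tr ((\<otimes>) (hd l)) (local_map (Suc n) l0)
      - tr ((\<otimes>) (hd l)) (frag_extend (homotopy n) (face_sum l0))"
    by (simp add: w_def del: local_map.simps)
  also have "tr ((\<otimes>) (hd l)) (frag_extend (homotopy n) (face_sum l0)) =
      frag_extend (homotopy n) (tr ((\<otimes>) (hd l)) (face_sum l0))"
    using Suc.IH cells_face_sum_bar[OF l0] hG by (intro equivariant_extend[symmetric]) auto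
  also have "tr ((\<otimes>) (hd l)) (local_map (Suc n) l0) = local_map (Suc n) (map ((\<otimes>) (hd l)) l0)"
    using local_map[OF l0] hG by simp
  finally have "bd (homotopy (Suc n) l) =
      frag_of l - local_map (Suc n) l - frag_extend (homotopy n) (face_sum l)"
    by (simp add: tr_face_sum l0_def map_hd_based[OF Suc.prems] del: local_map.simps)
  moreover have c1: "cells (cons \<one> w) \<subseteq> bar (Suc (Suc n))"
    by (rule cells_cons_bar[OF one_closed wc])
  then have "cells (homotopy (Suc n) l) \<subseteq> bar (Suc (Suc n))"
    unfolding H by (rule cells_tr_bar[OF hG])
  moreover have "homotopy (Suc n) (map ((\<otimes>) g) l) = tr ((\<otimes>) g) (homotopy (Suc n) l)"
    if "g \<in> carrier G" for g
    unfolding homotopy.simps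
    by (rule equivariant_map_equivariant[OF that Suc.prems])
      (use c1 in \<open>simp add: w_def l0_def del: local_map.simps\<close>)
  ultimately show ?case by simp
qed

text \<open>
  There are no local chains with more than \<open>|X| + 1\<close> vertices, so \<open>local_map\<close> is zero on lists of
  that length, and the homotopy alone reproduces every simplex.
\<close>

lemma truncated_contraction:
  assumes "n > card X" "l \<in> bar (Suc n)"
  shows "bd (homotopy (Suc n) l) + frag_extend (homotopy n) (face_sum l) = frag_of l"
proof -
  have "l' \<notin> cells (local_map (Suc n) l)" for l'
    using local_map[OF assms(2)] length_local_chain[of l'] assms(1) by (auto simp: chains_def simp del: local_map.simps)
  then have "local_map (Suc n) l = 0" by (metis keys_eq_empty ex_in_conv)
  then show ?thesis using homotopy[OF assms(2)] by (simp del: homotopy.simps local_map.simps)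
qed

end

section \<open>Homogeneous coordinates and cohomology of modules\<close>

text \<open>
  The extension of \<open>F\<close> to integral combinations, for values in an abelian group written
  multiplicatively.
\<close>

definition lin :: "('m, 'l) monoid_scheme \<Rightarrow> ('c \<Rightarrow> 'm) \<Rightarrow> ('c \<Rightarrow>\<^sub>0 int) \<Rightarrow> 'm" where
  "lin K F = (SOME h. h \<in> hom (free_Abelian_group UNIV) K \<and> (\<forall>c. h (frag_of c) = F c))"

lemma hom_finprod:
  assumes "comm_group K" "comm_group L" "h \<in> hom K L" "f \<in> I \<rightarrow> carrier K"
  shows "h (finprod K f I) = finprod L (\<lambda>i. h (f i)) I"
proof -
  interpret K: comm_group K by fact
  interpret L: comm_group L by fact
  interpret h: group_hom K L h
    using assms(3) by unfold_locales
  show ?thesis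
    using assms(4)
  proof (induction I rule: infinite_finite_induct)
    case (insert i I)
    then have c: "f \<in> I \<rightarrow> carrier K" "f i \<in> carrier K" "h (f i) \<in> carrier L" "(\<lambda>i. h (f i)) \<in> I \<rightarrow> carrier L" by (auto simp: Pi_iff)
    show ?case
      by (simp only: K.finprod_insert[OF insert.hyps c(1,2)] L.finprod_insert[OF insert.hyps c(4,3)]
          h.hom_mult[OF c(2) K.finprod_closed[OF c(1)]] insert.IH[OF c(1)])
  qed auto
qed

context comm_group
begin

lemma lin:
  assumes "\<And>c. F c \<in> carrier G"
  shows "lin G F \<in> hom (free_Abelian_group UNIV) G" "lin G F (frag_of c) = F c"
proof -
  obtain h where "h \<in> hom (free_Abelian_group UNIV) G" "\<And>c. h (frag_of c) = F c"
    using assms by (auto intro: free_Abelian_group_universal[of F UNIV])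
  then have "lin G F \<in> hom (free_Abelian_group UNIV) G \<and> (\<forall>c. lin G F (frag_of c) = F c)"
    unfolding lin_def
    using someI[of "\<lambda>h. h \<in> hom (free_Abelian_group UNIV) G \<and> (\<forall>c. h (frag_of c) = F c)" h] by simp
  then show "lin G F \<in> hom (free_Abelian_group UNIV) G" "lin G F (frag_of c) = F c" by auto
qed

lemma lin_of: "(\<And>c. F c \<in> carrier G) \<Longrightarrow> lin G F (frag_of c) = F c"
  by (rule lin(2)) blast

lemma lin_group_hom: "(\<And>c. F c \<in> carrier G) \<Longrightarrow> group_hom (free_Abelian_group UNIV) G (lin G F)"
  using lin(1)[of F] by (simp add: group_hom_def group_hom_axioms_def is_group)

lemma lin_closed [simp]: "(\<And>c. F c \<in> carrier G) \<Longrightarrow> lin G F x \<in> carrier G"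
  using group_hom.hom_closed[OF lin_group_hom[of F], of x] by simp

lemma lin_add: "(\<And>c. F c \<in> carrier G) \<Longrightarrow> lin G F (x + y) = lin G F x \<otimes> lin G F y"
  using group_hom.hom_mult[OF lin_group_hom[of F], of x y] by simp

lemma lin_zero: "(\<And>c. F c \<in> carrier G) \<Longrightarrow> lin G F 0 = \<one>"
  using group_hom.hom_one[OF lin_group_hom[of F]] by simp

lemma lin_minus: "(\<And>c. F c \<in> carrier G) \<Longrightarrow> lin G F (- x) = inv lin G F x"
  using group_hom.hom_inv[OF lin_group_hom[of F], of x] by simp

lemma lin_diff: "(\<And>c. F c \<in> carrier G) \<Longrightarrow> lin G F (x - y) = lin G F x \<otimes> inv lin G F y"
  using lin_add[of F x "- y"] lin_minus[of F y] by simp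

lemma lin_cmul: "(\<And>c. F c \<in> carrier G) \<Longrightarrow> lin G F (frag_cmul k x) = lin G F x [^] k"
  using group_hom.hom_int_pow[OF lin_group_hom[of F], of x k] by simp

lemma lin_sum:
  assumes "\<And>c. F c \<in> carrier G" "finite I"
  shows "lin G F (sum f I) = finprod G (\<lambda>i. lin G F (f i)) I"
  using assms(2) by (induction I rule: finite_induct) (auto simp: assms lin_zero lin_add)

lemma multiplicative_eqI:
  assumes "\<And>x y. P (x - y) = P x \<otimes> inv P y" "\<And>x y. Q (x - y) = Q x \<otimes> inv Q y"
    and "P 0 \<in> carrier G" "Q 0 \<in> carrier G"
    and "\<And>c. c \<in> cells x \<Longrightarrow> P (frag_of c) = Q (frag_of c)"
  shows "P x = Q x"
proof -
  have "P 0 = \<one>" "Q 0 = \<one>" using assms(1)[of 0 0] assms(2)[of 0 0] assms(3,4) by auto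
  then show ?thesis
    by (intro frag_induction[where P = "\<lambda>x. P x = Q x", OF order_refl[of "cells x"]])
      (simp_all add: assms)
qed

lemma lin_cong: "(\<And>c. F c \<in> carrier G) \<Longrightarrow> (\<And>c. F' c \<in> carrier G) \<Longrightarrow>
    (\<And>c. c \<in> cells x \<Longrightarrow> F c = F' c) \<Longrightarrow> lin G F x = lin G F' x"
  by (rule multiplicative_eqI) (auto simp: lin_diff lin_of)

lemma lin_frag_extend:
  "(\<And>c. F c \<in> carrier G) \<Longrightarrow> lin G F (frag_extend f x) = lin G (\<lambda>c. lin G F (f c)) x"
  by (rule multiplicative_eqI) (auto simp: lin_diff lin_of frag_extend_diff)

lemma lin_mult:
  "(\<And>c. F c \<in> carrier G) \<Longrightarrow> (\<And>c. F' c \<in> carrier G) \<Longrightarrow>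
    lin G (\<lambda>c. F c \<otimes> F' c) x = lin G F x \<otimes> lin G F' x"
  by (rule multiplicative_eqI) (auto simp: lin_diff lin_of inv_mult m_ac)

lemma lin_one: "lin G (\<lambda>c. \<one>) x = \<one>"
  by (rule multiplicative_eqI) (auto simp: lin_diff lin_of)

lemma lin_hom_compose:
  assumes "comm_group L" "h \<in> hom G L" "\<And>c. F c \<in> carrier G"
  shows "h (lin G F x) = lin L (\<lambda>c. h (F c)) x"
proof -
  interpret L: comm_group L by fact
  interpret h: group_hom G L h using assms(2) by unfold_locales
  show ?thesis
    by (rule L.multiplicative_eqI) (auto simp: assms(3) lin_diff lin_of L.lin_diff L.lin_of)
qed

lemma gfinprod_hom:
  assumes "comm_group L" "h \<in> hom G L" "f \<in> I \<rightarrow> carrier G" "finite {i \<in> I. f i \<noteq> \<one>}"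
  shows "h (gfinprod G f I) = gfinprod L (\<lambda>i. h (f i)) I"
proof -
  interpret L: comm_group L by fact
  interpret h: group_hom G L h using assms(2) by unfold_locales
  let ?J = "{i \<in> I. f i \<noteq> \<one>}"
  have c: "(\<lambda>i. h (f i)) \<in> I \<rightarrow> carrier L" "f \<in> ?J \<rightarrow> carrier G" "(\<lambda>i. h (f i)) \<in> ?J \<rightarrow> carrier L"
    using assms(3) by (auto simp: Pi_iff)
  have "h (gfinprod G f I) = gfinprod L (\<lambda>i. h (f i)) ?J"
    using assms(4) c by (simp add: gfinprod_def hom_finprod[OF _ assms(1,2)] comm_group_axioms flip: L.gfinprod_eq_finprod)
  also have "\<dots> = gfinprod L (\<lambda>i. h (f i)) I"
    by (rule L.gfinprod_mono_neutral_cong_left) (use c in auto)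
  finally show ?thesis .
qed

end

text \<open>
  Stated for a mere subset \<open>Z\<close> in place of a subgroup, so that it applies to cocycles and cycles
  without first proving that these contain the coboundaries and boundaries.
\<close>

lemma quotient_trivial_iff:
  assumes "group K" "subgroup B K" "Z \<subseteq> carrier K" "\<one>\<^bsub>K\<^esub> \<in> Z"
  shows "carrier (K\<lparr>carrier := Z\<rparr> Mod B) = {\<one>\<^bsub>K\<lparr>carrier := Z\<rparr> Mod B\<^esub>} \<longleftrightarrow> Z \<subseteq> B"
proof -
  interpret K: group K by fact
  interpret B: subgroup B K by fact
  have coset: "B #>\<^bsub>K\<lparr>carrier := Z\<rparr>\<^esub> a = B #>\<^bsub>K\<^esub> a" for a
    by (simp add: r_coset_def)
  have "B #>\<^bsub>K\<^esub> a = B \<longleftrightarrow> a \<in> B" if "a \<in> Z" for a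
    using that assms(2,3) K.coset_join1[of B a] K.coset_join2[of a B] B.subset by auto
  then show ?thesis
    using assms(4) by (auto simp: FactGroup_def RCOSETS_def coset)
qed

context group
begin

text \<open>
  The bar cell \<open>[s\<^sub>1|\<dots>|s\<^sub>n]\<close> as the simplex \<open>(g, g s\<^sub>1, g s\<^sub>1 s\<^sub>2, \<dots>)\<close> in homogeneous coordinates;
  \<open>increments\<close> goes back.
\<close>

primrec vertices :: "'a \<Rightarrow> 'a list \<Rightarrow> 'a list" where
  "vertices g [] = [g]"
| "vertices g (x # s) = g # vertices (g \<otimes> x) s"

fun increments :: "'a list \<Rightarrow> 'a list" where
  "increments (a # b # l) = (inv a \<otimes> b) # increments (b # l)"
| "increments l = []"

lemma hd_vertices [simp]: "hd (vertices g s) = g"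
  by (cases s) auto

lemma vertices_bar: "g \<in> carrier G \<Longrightarrow> s \<in> tuples G n \<Longrightarrow> vertices g s \<in> bar (Suc n)"
  by (induction s arbitrary: g n) (auto simp: bar_def tuples_def)

lemma map_vertices: "h \<in> carrier G \<Longrightarrow> g \<in> carrier G \<Longrightarrow> set s \<subseteq> carrier G \<Longrightarrow> map ((\<otimes>) h) (vertices g s) = vertices (h \<otimes> g) s"
  by (induction s arbitrary: g) (auto simp: m_assoc)

lemma increments_tuples: "l \<in> bar (Suc n) \<Longrightarrow> increments l \<in> tuples G n"
  by (induction l arbitrary: n rule: increments.induct) (auto simp: bar_def tuples_def)

lemma vertices_increments: "l \<in> bar (Suc n) \<Longrightarrow> vertices (hd l) (increments l) = l"
proof (induction l arbitrary: n rule: increments.induct)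
  case (1 a b l)
  have "a \<otimes> (inv a \<otimes> b) = b" using 1 by (simp add: bar_def m_assoc[symmetric])
  moreover have "b # l \<in> bar (Suc (n - 1))" using 1 by (auto simp: bar_def)
  ultimately show ?case using 1(1) by simp
qed (auto simp: bar_def)

lemma increments_vertices: "g \<in> carrier G \<Longrightarrow> set s \<subseteq> carrier G \<Longrightarrow> increments (vertices g s) = s"
proof (induction s arbitrary: g)
  case (Cons x s)
  then show ?case by (cases s) (auto simp: m_assoc[symmetric])
qed simp

lemma increments_map: "g \<in> carrier G \<Longrightarrow> l \<in> bar (Suc n) \<Longrightarrow> increments (map ((\<otimes>) g) l) = increments l"
  using vertices_increments[of l n] increments_tuples[of l n] hd_bar[of l n]
    map_vertices[of g "hd l" "increments l"] increments_vertices[of "g \<otimes> hd l" "increments l"]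
  by (auto simp: tuples_def in_lists_conv_set subset_iff)

lemma bar_face_Suc:
  assumes "i > 0" "s \<noteq> []"
  shows "bar_face G (Suc i) (x # s) = x # bar_face G i s"
  using assms by (cases i) (auto simp: bar_face_def)

text \<open>
  Bar faces are simplicial faces: omitting an inner vertex multiplies two neighbouring
  entries, and omitting the first one moves the base point, which is where the action on the coefficients enters.
\<close>

lemma del_vertices:
  assumes "s \<noteq> []" "set s \<subseteq> carrier G" "i \<le> length s" "g \<in> carrier G"
  shows "del i (vertices g s) = vertices (if i = 0 then g \<otimes> hd s else g) (bar_face G i s)"
  using assms
proof (induction s arbitrary: i g)
  case (Cons x s)
  consider "i = 0" | "i = 1" | j where "i = Suc j" "j > 0" by (cases i) auto
  then show ?case
  proof cases
    case 1
    then show ?thesis by (simp add: del_def bar_face_def)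
  next
    case 2
    then show ?thesis using Cons.prems by (cases s) (auto simp: del_def bar_face_def m_assoc)
  next
    case (3 j)
    then have "s \<noteq> []" using Cons.prems by auto
    then show ?thesis using 3 Cons.IH[of j "g \<otimes> x"] Cons.prems by (simp add: bar_face_Suc del_def)
  qed
qed simp

lemma bar_face_tuples:
  assumes "s \<in> tuples G (Suc n)" "i \<le> Suc n"
  shows "bar_face G i s \<in> tuples G n"
proof -
  have s: "length s = Suc n" "set s \<subseteq> carrier G" using assms(1) by (auto simp: tuples_def)
  have "set (tl s) \<subseteq> carrier G" "set (butlast s) \<subseteq> carrier G" "set (take k s) \<subseteq> carrier G"
    "set (drop k s) \<subseteq> carrier G" for k
    using s(2) by (auto dest: list.set_sel(2) in_set_butlastD in_set_takeD in_set_dropD simp: subset_iff)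
      (metis list.sel(2) list.set_sel(2) subsetD)
  moreover have "s ! (i - 1) \<otimes> s ! i \<in> carrier G" if "0 < i" "i < Suc n"
    using that s by (intro m_closed) (auto simp: subset_iff)
  ultimately show ?thesis
    using assms(2) s by (auto simp: tuples_def bar_face_def in_lists_conv_set subset_iff)
qed

lemma face_sum_vertices:
  assumes "s \<in> tuples G (Suc n)" "g \<in> carrier G"
  shows "face_sum (vertices g s) = (\<Sum>i\<le>Suc n. frag_cmul ((- 1) ^ i)
           (frag_of (vertices (if i = 0 then g \<otimes> hd s else g) (bar_face G i s))))"
proof -
  have s: "s \<noteq> []" "set s \<subseteq> carrier G" "length s = Suc n" using assms(1) by (auto simp: tuples_def)
  have "length (vertices g s) = Suc (Suc n)" using vertices_bar[OF assms(2,1)] by (simp add: bar_def)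
  then show ?thesis
    unfolding face_sum_eq lessThan_Suc_atMost
    using s assms(2) by (intro sum.cong) (auto simp: lessThan_Suc_atMost del_vertices)
qed

end

abbreviation trivial_cohomology where
  "trivial_cohomology G A \<phi> n \<equiv>
     carrier (group_cohomology G A \<phi> n) = {\<one>\<^bsub>group_cohomology G A \<phi> n\<^esub>}"

abbreviation trivial_homology where
  "trivial_homology G A \<phi> n \<equiv>
     carrier (group_homology G A \<phi> n) = {\<one>\<^bsub>group_homology G A \<phi> n\<^esub>}"

locale group_module = G: group G + A: comm_group A
  for G :: "('g, 'k) monoid_scheme" (structure) and A :: "('m, 'l) monoid_scheme" (structure) +
  fixes \<phi> :: "'g \<Rightarrow> 'm \<Rightarrow> 'm"
  assumes \<phi>_hom: "\<phi> \<in> hom G (AutoGroup A)"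
begin

lemma \<phi>_auto: "g \<in> carrier G \<Longrightarrow> \<phi> g \<in> hom A A \<and> bij_betw (\<phi> g) (carrier A) (carrier A)"
  using \<phi>_hom unfolding hom_def AutoGroup_def auto_def Bij_def by auto

lemma \<phi>_closed [simp]: "g \<in> carrier G \<Longrightarrow> a \<in> carrier A \<Longrightarrow> \<phi> g a \<in> carrier A"
  using \<phi>_auto by (auto simp: hom_def)

lemma \<phi>_group_hom: "g \<in> carrier G \<Longrightarrow> group_hom A A (\<phi> g)"
  using \<phi>_auto by unfold_locales auto

lemma \<phi>_mult: "g \<in> carrier G \<Longrightarrow> a \<in> carrier A \<Longrightarrow> b \<in> carrier A \<Longrightarrow>
    \<phi> g (a \<otimes>\<^bsub>A\<^esub> b) = \<phi> g a \<otimes>\<^bsub>A\<^esub> \<phi> g b"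
  using \<phi>_auto by (auto simp: hom_def)

lemma \<phi>_unit: "g \<in> carrier G \<Longrightarrow> \<phi> g \<one>\<^bsub>A\<^esub> = \<one>\<^bsub>A\<^esub>"
  using group_hom.hom_one[OF \<phi>_group_hom] .

lemma \<phi>_compose:
  assumes "g \<in> carrier G" "h \<in> carrier G" "a \<in> carrier A"
  shows "\<phi> (g \<otimes> h) a = \<phi> g (\<phi> h a)"
proof -
  have "\<phi> (g \<otimes> h) = \<phi> g \<otimes>\<^bsub>AutoGroup A\<^esub> \<phi> h"
    using \<phi>_hom assms by (auto simp: hom_def)
  moreover have "\<phi> g \<in> Bij (carrier A)" "\<phi> h \<in> Bij (carrier A)"
    using \<phi>_hom assms unfolding hom_def AutoGroup_def auto_def by auto
  ultimately show ?thesis using assms by (simp add: AutoGroup_def BijGroup_def compose_def)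
qed

lemma \<phi>_one: "a \<in> carrier A \<Longrightarrow> \<phi> \<one> a = a"
proof -
  assume a: "a \<in> carrier A"
  have "\<phi> \<one> (\<phi> \<one> a) = \<phi> \<one> a"
    using \<phi>_compose[of "\<one>" "\<one>" a] a by simp
  then show ?thesis
    using \<phi>_auto[of "\<one>"] a \<phi>_closed[of "\<one>" a]
    unfolding bij_betw_def by (meson G.one_closed inj_onD)
qed

abbreviation Co where "Co n \<equiv> cochain_group G A n"

text \<open>
  The equivariant function on simplices that corresponds to an inhomogeneous cochain. The default
  value \<open>\<one>\<close> makes it total with values in the module, as \<open>lin\<close> requires.
\<close>

definition homog :: "('g list \<Rightarrow> 'm) \<Rightarrow> nat \<Rightarrow> 'g list \<Rightarrow> 'm" where
  "homog f n l = (if l \<in> G.bar (Suc n) then \<phi> (hd l) (f (G.increments l)) else \<one>\<^bsub>A\<^esub>)"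

lemma cochain_carrier: "carrier (Co n) = tuples G n \<rightarrow>\<^sub>E carrier A"
  by (simp add: cochain_group_def)

lemma homog_closed [simp]:
  assumes "f \<in> carrier (Co n)"
  shows "homog f n l \<in> carrier A"
proof (cases "l \<in> G.bar (Suc n)")
  case True
  then have "f (G.increments l) \<in> carrier A"
    using assms G.increments_tuples[OF True] unfolding cochain_carrier by auto
  then show ?thesis using True G.hd_bar[OF True] by (simp add: homog_def)
qed (simp add: homog_def)

lemma homog_vertices:
  assumes "s \<in> tuples G n" "g \<in> carrier G"
  shows "homog f n (G.vertices g s) = \<phi> g (f s)"
  using G.vertices_bar[OF assms(2,1)] assms by (simp add: homog_def G.increments_vertices tuples_def in_lists_conv_set subset_iff)

lemma homog_map:
  assumes "f \<in> carrier (Co n)" "g \<in> carrier G" "l \<in> G.bar (Suc n)"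
  shows "homog f n (map ((\<otimes>) g) l) = \<phi> g (homog f n l)"
proof -
  have "f (G.increments l) \<in> carrier A"
    using assms(1) G.increments_tuples[OF assms(3)] unfolding cochain_carrier by auto
  moreover have "l \<noteq> []" using assms(3) by (auto simp: G.bar_def)
  ultimately show ?thesis
    using assms by (simp add: homog_def G.map_bar G.increments_map hd_map \<phi>_compose G.hd_bar)
qed

lemma lin_homog_tr:
  assumes "f \<in> carrier (Co n)" "g \<in> carrier G" "cells x \<subseteq> G.bar (Suc n)"
  shows "lin A (homog f n) (tr ((\<otimes>) g) x) = \<phi> g (lin A (homog f n) x)"
proof -
  interpret p: group_hom A A "\<phi> g" using \<phi>_group_hom assms(2) .
  show ?thesis
    by (rule A.multiplicative_eqI)
      (use assms in \<open>auto simp: A.lin_diff A.lin_of homog_map subset_iff\<close>)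
qed

text \<open>
  In homogeneous coordinates the coboundary is composition with the simplicial boundary.
\<close>

lemma lin_homog_vertices:
  assumes "f \<in> carrier (Co n)" "g \<in> carrier G" "s \<in> tuples G (Suc n)"
  shows "lin A (homog f n) (face_sum (G.vertices g s)) = \<phi> g (coboundary G A \<phi> n f s)"
proof -
  have f: "f t \<in> carrier A" if "t \<in> tuples G n" for t
    using that assms(1) unfolding cochain_carrier by auto
  have hs: "hd s \<in> carrier G" using assms(3) by (cases s) (auto simp: tuples_def)
  have *: "lin A (homog f n) (face_sum (G.vertices \<one> s)) = coboundary G A \<phi> n f s"
    unfolding G.face_sum_vertices[OF assms(3) G.one_closed]
    using assms(3) f hs
    by (auto simp: A.lin_sum A.lin_cmul assms A.lin_of coboundary_def homog_vertices G.bar_face_tuples \<phi>_one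
        simp del: sum.atMost_Suc A.finprod_Suc intro!: A.finprod_cong')
  have t: "map ((\<otimes>) g) (G.vertices \<one> s) = G.vertices g s"
    using assms by (simp add: G.map_vertices tuples_def in_lists_conv_set subset_iff)
  show ?thesis
    unfolding *[symmetric] t[symmetric] tr_face_sum[symmetric]
    by (rule lin_homog_tr) (use assms G.cells_face_sum_bar[OF G.vertices_bar] in auto)
qed

lemma coboundary_closed:
  assumes "f \<in> carrier (Co n)"
  shows "coboundary G A \<phi> n f \<in> carrier (Co (Suc n))"
proof -
  have "coboundary G A \<phi> n f s \<in> carrier A" if s: "s \<in> tuples G (Suc n)" for s
  proof -
    have f: "f t \<in> carrier A" if "t \<in> tuples G n" for t
      using that assms(1) unfolding cochain_carrier by auto
    have hs: "hd s \<in> carrier G" using s by (cases s) (auto simp: tuples_def)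
    show ?thesis using s f hs
      by (auto simp: coboundary_def G.bar_face_tuples[OF s] intro!: A.finprod_closed A.int_pow_closed)
  qed
  then show ?thesis unfolding cochain_carrier by (auto simp: coboundary_def)
qed

lemma coboundary_hom: "coboundary G A \<phi> n \<in> hom (Co n) (Co (Suc n))"
proof (rule homI)
  fix f f' assume f: "f \<in> carrier (Co n)" "f' \<in> carrier (Co n)"
  define h where "h = f \<otimes>\<^bsub>Co n\<^esub> f'"
  have hs: "h t = f t \<otimes>\<^bsub>A\<^esub> f' t" "f t \<in> carrier A" "f' t \<in> carrier A" if "t \<in> tuples G n" for t
    using that f unfolding cochain_carrier by (auto simp: h_def cochain_group_def)
  have h: "h \<in> carrier (Co n)"
    using f unfolding cochain_carrier by (auto simp: h_def cochain_group_def)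
  have eq: "homog h n = (\<lambda>l. homog f n l \<otimes>\<^bsub>A\<^esub> homog f' n l)"
    using hs G.increments_tuples G.hd_bar by (auto simp: homog_def fun_eq_iff \<phi>_mult)
  have "coboundary G A \<phi> n h s = coboundary G A \<phi> n f s \<otimes>\<^bsub>A\<^esub> coboundary G A \<phi> n f' s"
    if s: "s \<in> tuples G (Suc n)" for s
  proof -
    have c: "coboundary G A \<phi> n k s = lin A (homog k n) (face_sum (G.vertices \<one> s))"
      if "k \<in> carrier (Co n)" for k
    proof -
      have "coboundary G A \<phi> n k s \<in> carrier A"
        using coboundary_closed[OF that] s unfolding cochain_carrier by (rule PiE_mem)
      then show ?thesis using lin_homog_vertices[OF that G.one_closed s] by (simp add: \<phi>_one)
    qed
    show ?thesis using f h by (simp add: c eq A.lin_mult)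
  qed
  then show "coboundary G A \<phi> n (f \<otimes>\<^bsub>Co n\<^esub> f') =
      coboundary G A \<phi> n f \<otimes>\<^bsub>Co (Suc n)\<^esub> coboundary G A \<phi> n f'"
    unfolding h_def[symmetric]
    by (auto simp: cochain_group_def coboundary_def fun_eq_iff)
qed (rule coboundary_closed)

lemma group_cochain: "group (Co n)"
  by (simp add: cochain_group_def)

lemma subgroup_coboundaries: "subgroup (coboundaries G A \<phi> n) (Co n)"
proof (cases n)
  case 0
  then show ?thesis using group.triv_subgroup[OF group_cochain[of 0]] by (simp add: coboundaries_def)
next
  case (Suc m)
  interpret d: group_hom "Co m" "Co (Suc m)" "coboundary G A \<phi> m"
    using group_cochain coboundary_hom by (simp add: group_hom_def group_hom_axioms_def)
  show ?thesis using d.img_is_subgroup by (simp add: Suc coboundaries_def)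
qed

lemma group_cohomology_trivial_iff:
  "trivial_cohomology G A \<phi> n \<longleftrightarrow>
     cocycles G A \<phi> n \<subseteq> coboundaries G A \<phi> n"
  unfolding group_cohomology_def
proof (rule quotient_trivial_iff[OF group_cochain subgroup_coboundaries])
  show "cocycles G A \<phi> n \<subseteq> carrier (Co n)"
    by (auto simp: cocycles_def kernel_def)
  show "\<one>\<^bsub>Co n\<^esub> \<in> cocycles G A \<phi> n"
    using hom_one[OF coboundary_hom group_cochain group_cochain] group.is_monoid[OF group_cochain]
    by (auto simp: cocycles_def kernel_def intro: monoid.one_closed simp del: one_product_group)
qed

lemma cocycle_lin:
  assumes "f \<in> cocycles G A \<phi> n" "cells x \<subseteq> G.bar (Suc (Suc n))"
  shows "lin A (homog f n) (bd x) = \<one>\<^bsub>A\<^esub>"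
proof -
  have f: "f \<in> carrier (Co n)" "coboundary G A \<phi> n f = (\<lambda>s\<in>tuples G (Suc n). \<one>\<^bsub>A\<^esub>)"
    using assms(1) by (auto simp: cocycles_def kernel_def cochain_group_def)
  have "lin A (homog f n) (face_sum l) = \<one>\<^bsub>A\<^esub>" if l: "l \<in> G.bar (Suc (Suc n))" for l
  proof -
    have s: "G.increments l \<in> tuples G (Suc n)" using G.increments_tuples l .
    have "lin A (homog f n) (face_sum (G.vertices (hd l) (G.increments l))) = \<one>\<^bsub>A\<^esub>"
      using f s G.hd_bar[OF l] by (simp add: lin_homog_vertices \<phi>_unit)
    then show ?thesis by (simp add: G.vertices_increments[OF l])
  qed
  then have "lin A (\<lambda>l. lin A (homog f n) (face_sum l)) x = lin A (\<lambda>l. \<one>\<^bsub>A\<^esub>) x"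
    using f(1) assms(2) by (intro A.lin_cong) (auto simp: subset_iff)
  then show ?thesis
    using f(1) by (simp add: bd_def A.lin_frag_extend A.lin_one)
qed

end

section \<open>Vanishing above the rank\<close>

text \<open>
  Exactly the part of a contracting homotopy that makes homology and cohomology vanish in
  degree \<open>n\<close>: simplices of degree \<open>n\<close> are lists of length \<open>Suc n\<close>, and \<open>H\<close>, \<open>H'\<close> are the homotopy in degrees \<open>n - 1\<close> and \<open>n\<close>.
\<close>

definition (in group) contraction :: "nat \<Rightarrow> ('a list \<Rightarrow> ('a list \<Rightarrow>\<^sub>0 int)) \<Rightarrow> ('a list \<Rightarrow> ('a list \<Rightarrow>\<^sub>0 int)) \<Rightarrow> bool" where
  "contraction n H H' \<longleftrightarrow>
     (\<forall>l\<in>bar n. cells (H l) \<subseteq> bar (Suc n) \<and> (\<forall>g\<in>carrier G. H (map ((\<otimes>) g) l) = tr ((\<otimes>) g) (H l))) \<and>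
     (\<forall>l\<in>bar (Suc n). cells (H' l) \<subseteq> bar (Suc (Suc n)) \<and>
        (\<forall>g\<in>carrier G. H' (map ((\<otimes>) g) l) = tr ((\<otimes>) g) (H' l))) \<and>
     (\<forall>l\<in>bar (Suc n). bd (H' l) + frag_extend H (face_sum l) = frag_of l)"

lemma (in lattice_cocycle) contraction_homotopy:
  "n > card X \<Longrightarrow> contraction n (homotopy n) (homotopy (Suc n))"
  unfolding contraction_def using homotopy truncated_contraction by blast

lemma (in comm_monoid) gfinprod_cong_mem:
  "(\<And>i. i \<in> I \<Longrightarrow> f i = g i) \<Longrightarrow> g \<in> I \<rightarrow> carrier G \<Longrightarrow> gfinprod G f I = gfinprod G g I"
  by (rule gfinprod_cong) (auto simp: simp_implies_def)

context group_module
begin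

lemma bar_tuples:
  assumes "l \<in> G.bar (Suc n)"
  obtains g s where "g \<in> carrier G" "s \<in> tuples G n" "l = G.vertices g s"
  using that[OF G.hd_bar[OF assms] G.increments_tuples[OF assms]] G.vertices_increments[OF assms] by simp

text \<open>
  A cocycle \<open>f\<close> is the coboundary of \<open>f \<circ> H\<close>: by the contraction \<open>f\<close> equals
  \<open>f \<circ> H \<circ> bd\<close> plus \<open>f \<circ> bd \<circ> H'\<close>, and the last term is trivial.
\<close>

lemma cohomology_vanishes:
  assumes "G.contraction (Suc m) H H'"
  shows "trivial_cohomology G A \<phi> (Suc m)"
  unfolding group_cohomology_trivial_iff
proof
  fix f assume cyc: "f \<in> cocycles G A \<phi> (Suc m)"
  then have f: "f \<in> carrier (Co (Suc m))" by (auto simp: cocycles_def kernel_def)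
  define b where "b = (\<lambda>s\<in>tuples G m. lin A (homog f (Suc m)) (H (G.vertices \<one> s)))"
  have b: "b \<in> carrier (Co m)"
    unfolding cochain_carrier b_def using f by simp
  have homog_b: "homog b m l = lin A (homog f (Suc m)) (H l)" if l: "l \<in> G.bar (Suc m)" for l
  proof -
    obtain g s where gs: "g \<in> carrier G" "s \<in> tuples G m" "l = G.vertices g s"
      using l by (rule bar_tuples)
    have 1: "G.vertices \<one> s \<in> G.bar (Suc m)" using gs G.vertices_bar by simp
    have "homog b m l = \<phi> g (lin A (homog f (Suc m)) (H (G.vertices \<one> s)))"
      using gs by (simp add: homog_vertices b_def)
    also have "\<dots> = lin A (homog f (Suc m)) (tr ((\<otimes>) g) (H (G.vertices \<one> s)))"
      using assms 1 gs(1) by (subst lin_homog_tr[OF f]) (auto simp: G.contraction_def)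
    also have "tr ((\<otimes>) g) (H (G.vertices \<one> s)) = H (map ((\<otimes>) g) (G.vertices \<one> s))"
      using assms 1 gs(1) by (auto simp: G.contraction_def)
    also have "map ((\<otimes>) g) (G.vertices \<one> s) = l"
      using gs by (simp add: G.map_vertices tuples_def in_lists_conv_set subset_iff)
    finally show ?thesis .
  qed
  have "coboundary G A \<phi> m b s = f s" if s: "s \<in> tuples G (Suc m)" for s
  proof -
    define l where "l = G.vertices \<one> s"
    have l: "l \<in> G.bar (Suc (Suc m))" using G.vertices_bar s by (simp add: l_def)
    have fs: "f s \<in> carrier A" using f s unfolding cochain_carrier by auto
    have "coboundary G A \<phi> m b s \<in> carrier A"
      using coboundary_closed[OF b] s unfolding cochain_carrier by (rule PiE_mem)
    then have "coboundary G A \<phi> m b s = lin A (homog b m) (face_sum l)"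
      using lin_homog_vertices[OF b G.one_closed s] by (simp add: l_def \<phi>_one)
    also have "\<dots> = lin A (\<lambda>l. lin A (homog f (Suc m)) (H l)) (face_sum l)"
      using G.cells_face_sum_bar[OF l] homog_b b f by (intro A.lin_cong) (auto simp: subset_iff)
    also have "\<dots> = lin A (homog f (Suc m)) (frag_extend H (face_sum l))"
      using f by (simp add: A.lin_frag_extend)
    also have "frag_extend H (face_sum l) = frag_of l - bd (H' l)"
      using assms l by (auto simp: G.contraction_def algebra_simps)
    also have "lin A (homog f (Suc m)) (frag_of l - bd (H' l)) = homog f (Suc m) l"
      using f assms l cocycle_lin[OF cyc, of "H' l"] by (simp add: A.lin_diff A.lin_of G.contraction_def)
    also have "\<dots> = f s"
      using s fs by (simp add: l_def homog_vertices \<phi>_one)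
    finally show ?thesis .
  qed
  then have "coboundary G A \<phi> m b = f"
    using f unfolding cochain_carrier by (intro ext) (auto simp: coboundary_def)
  then show "f \<in> coboundaries G A \<phi> (Suc m)"
    using b by (auto simp: coboundaries_def)
qed

abbreviation Ch where "Ch n \<equiv> chain_group G A n"

definition single :: "nat \<Rightarrow> 'g list \<Rightarrow> 'm \<Rightarrow> ('g list \<Rightarrow> 'm)" where
  "single n s a = (\<lambda>t\<in>tuples G n. if t = s then a else \<one>\<^bsub>A\<^esub>)"

text \<open>
  The chain \<open>a \<otimes> l\<close> for a simplex \<open>l\<close> in homogeneous coordinates: moving the first vertex to the neutral element
  acts on \<open>a\<close> by its inverse.
\<close>

definition tensor :: "nat \<Rightarrow> 'm \<Rightarrow> 'g list \<Rightarrow> ('g list \<Rightarrow> 'm)" where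
  "tensor n a l = (if l \<in> G.bar (Suc n) then single n (G.increments l) (\<phi> (inv (hd l)) a)
     else \<one>\<^bsub>Ch n\<^esub>)"

abbreviation tensor_lin :: "nat \<Rightarrow> 'm \<Rightarrow> ('g list \<Rightarrow>\<^sub>0 int) \<Rightarrow> ('g list \<Rightarrow> 'm)" where
  "tensor_lin n a \<equiv> lin (Ch n) (tensor n a)"

lemma chain_carrier:
  "carrier (Ch n) = {c \<in> tuples G n \<rightarrow>\<^sub>E carrier A. finite {s \<in> tuples G n. c s \<noteq> \<one>\<^bsub>A\<^esub>}}"
  by (simp add: chain_group_def carrier_sum_group)

lemma chain_mult: "c \<otimes>\<^bsub>Ch n\<^esub> c' = (\<lambda>t\<in>tuples G n. c t \<otimes>\<^bsub>A\<^esub> c' t)"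
  by (simp add: chain_group_def)

lemma comm_group_chain: "comm_group (Ch n)"
proof (rule group.group_comm_groupI)
  show "group (Ch n)" by (simp add: chain_group_def)
  show "x \<otimes>\<^bsub>Ch n\<^esub> y = y \<otimes>\<^bsub>Ch n\<^esub> x"
    if "x \<in> carrier (Ch n)" "y \<in> carrier (Ch n)" for x y
    using that by (auto simp: chain_mult chain_carrier fun_eq_iff PiE_mem intro!: A.m_comm)
qed

sublocale chain: comm_group "Ch n" for n
  by (rule comm_group_chain)

lemma single_closed:
  assumes "a \<in> carrier A"
  shows "single n s a \<in> carrier (Ch n)"
proof -
  have "finite {t \<in> tuples G n. single n s a t \<noteq> \<one>\<^bsub>A\<^esub>}"
    by (rule finite_subset[of _ "{s}"]) (auto simp: single_def)
  then show ?thesis using assms by (auto simp: chain_carrier single_def)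
qed

lemma single_hom: "single n s \<in> hom A (Ch n)"
  by (rule homI) (auto simp: single_closed, auto simp: single_def chain_mult fun_eq_iff)

lemma tensor_closed: "a \<in> carrier A \<Longrightarrow> tensor n a l \<in> carrier (Ch n)"
  using G.hd_bar[of l n] by (simp add: tensor_def single_closed)

lemma tensor_lin_closed: "a \<in> carrier A \<Longrightarrow> tensor_lin n a x \<in> carrier (Ch n)"
  using tensor_closed by simp

lemma tensor_lin_hom: "(\<lambda>a. tensor_lin n a x) \<in> hom A (Ch n)"
proof (rule homI)
  fix a b assume ab: "a \<in> carrier A" "b \<in> carrier A"
  have "tensor n (a \<otimes>\<^bsub>A\<^esub> b) = (\<lambda>l. tensor n a l \<otimes>\<^bsub>Ch n\<^esub> tensor n b l)"
  proof
    fix l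
    show "tensor n (a \<otimes>\<^bsub>A\<^esub> b) l = tensor n a l \<otimes>\<^bsub>Ch n\<^esub> tensor n b l"
      using ab hom_mult[OF single_hom] G.hd_bar[of l n] by (simp add: tensor_def \<phi>_mult)
  qed
  then show "tensor_lin n (a \<otimes>\<^bsub>A\<^esub> b) x = tensor_lin n a x \<otimes>\<^bsub>Ch n\<^esub> tensor_lin n b x"
    using ab by (simp add: chain.lin_mult tensor_closed)
qed (rule tensor_lin_closed)

lemma tensor_lin_one: "tensor_lin n \<one>\<^bsub>A\<^esub> x = \<one>\<^bsub>Ch n\<^esub>"
  using hom_one[OF tensor_lin_hom A.is_group chain.is_group] .

lemma tensor_vertices:
  assumes "s \<in> tuples G n" "g \<in> carrier G"
  shows "tensor n a (G.vertices g s) = single n s (\<phi> (inv g) a)"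
  using G.vertices_bar[OF assms(2,1)] assms
  by (simp add: tensor_def G.increments_vertices tuples_def in_lists_conv_set subset_iff)

lemma tensor_lin_tr:
  assumes "a \<in> carrier A" "g \<in> carrier G" "cells x \<subseteq> G.bar (Suc n)"
  shows "tensor_lin n a (tr ((\<otimes>) g) x) = tensor_lin n (\<phi> (inv g) a) x"
proof (rule chain.multiplicative_eqI)
  fix l assume "l \<in> cells x"
  then have l: "l \<in> G.bar (Suc n)" using assms(3) by auto
  then obtain h s where hs: "h \<in> carrier G" "s \<in> tuples G n" "l = G.vertices h s"
    by (rule bar_tuples)
  have "map ((\<otimes>) g) l = G.vertices (g \<otimes> h) s"
    using hs assms by (simp add: G.map_vertices tuples_def in_lists_conv_set subset_iff)
  then show "tensor_lin n a (tr ((\<otimes>) g) (frag_of l)) = tensor_lin n (\<phi> (inv g) a) (frag_of l)"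
    using hs assms by (simp add: chain.lin_of tensor_closed tensor_vertices G.inv_mult_group \<phi>_compose)
qed (use assms in \<open>simp_all add: chain.lin_diff tensor_closed\<close>, simp_all add: tensor_lin_closed)

text \<open>
  The map of chain groups induced by the equivariant linear map that sends the based cell with entries
  \<open>s\<close> to \<open>Y s\<close>. Boundary operators and homotopies both have this form (\<open>boundary_eq_push\<close>), and
  composition of such maps is composition of the underlying maps of simplices (\<open>push_push\<close>).
\<close>

definition push :: "nat \<Rightarrow> nat \<Rightarrow> ('g list \<Rightarrow> ('g list \<Rightarrow>\<^sub>0 int)) \<Rightarrow> ('g list \<Rightarrow> 'm) \<Rightarrow> ('g list \<Rightarrow> 'm)" where
  "push m n Y c = gfinprod (Ch n) (\<lambda>s. tensor_lin n (c s) (Y s)) (tuples G m)"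

lemma chain_value: "c \<in> carrier (Ch n) \<Longrightarrow> s \<in> tuples G n \<Longrightarrow> c s \<in> carrier A"
  by (auto simp: chain_carrier)

lemma push_hom: "push m n Y \<in> hom (Ch m) (Ch n)"
  unfolding push_def chain_group_def[of G A m]
  by (rule chain.hom_group_sum[of "tuples G m" "\<lambda>s a. tensor_lin n a (Y s)" "\<lambda>_. A"])
    (simp_all add: tensor_lin_hom)

lemma push_support:
  assumes "c \<in> carrier (Ch m)"
  shows "finite {s \<in> tuples G m. tensor_lin n (c s) (Y s) \<noteq> \<one>\<^bsub>Ch n\<^esub>}"
    "(\<lambda>s. tensor_lin n (c s) (Y s)) \<in> tuples G m \<rightarrow> carrier (Ch n)"
proof -
  have "{s \<in> tuples G m. tensor_lin n (c s) (Y s) \<noteq> \<one>\<^bsub>Ch n\<^esub>} \<subseteq> {s \<in> tuples G m. c s \<noteq> \<one>\<^bsub>A\<^esub>}"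
    by (auto simp: tensor_lin_one)
  then show "finite {s \<in> tuples G m. tensor_lin n (c s) (Y s) \<noteq> \<one>\<^bsub>Ch n\<^esub>}"
    using assms by (auto simp: chain_carrier intro: finite_subset)
  show "(\<lambda>s. tensor_lin n (c s) (Y s)) \<in> tuples G m \<rightarrow> carrier (Ch n)"
    by (rule Pi_I) (rule tensor_lin_closed[OF chain_value[OF assms]])
qed

lemma push_single:
  assumes "s \<in> tuples G m" "a \<in> carrier A"
  shows "push m n Y (single m s a) = tensor_lin n a (Y s)"
proof -
  have "push m n Y (single m s a) = gfinprod (Ch n) (\<lambda>t. tensor_lin n a (Y t)) {s}"
    unfolding push_def
    by (rule chain.gfinprod_mono_neutral_cong_right)
      (use assms push_support(2)[OF single_closed[OF assms(2)]] in \<open>auto simp: single_def tensor_lin_one\<close>)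
  also have "\<dots> = tensor_lin n a (Y s)"
    using tensor_lin_closed[OF assms(2)] by (subst chain.gfinprod_eq_finprod) auto
  finally show ?thesis .
qed

text \<open>
  The equivariant map of simplices that underlies \<open>push\<close>.
\<close>

definition equivariant_ext :: "('g list \<Rightarrow> ('g list \<Rightarrow>\<^sub>0 int)) \<Rightarrow> 'g list \<Rightarrow> ('g list \<Rightarrow>\<^sub>0 int)" where
  "equivariant_ext Y l = tr ((\<otimes>) (hd l)) (Y (G.increments l))"

lemma push_tensor:
  assumes Y: "\<And>s. s \<in> tuples G m \<Longrightarrow> cells (Y s) \<subseteq> G.bar (Suc n)"
    and a: "a \<in> carrier A" and x: "cells x \<subseteq> G.bar (Suc m)"
  shows "push m n Y (tensor_lin m a x) = tensor_lin n a (frag_extend (equivariant_ext Y) x)"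
proof -
  have "push m n Y (tensor_lin m a x) = lin (Ch n) (\<lambda>l. push m n Y (tensor m a l)) x"
    by (rule chain.lin_hom_compose[OF comm_group_chain push_hom]) (rule tensor_closed[OF a])
  also have "\<dots> = lin (Ch n) (\<lambda>l. tensor_lin n a (equivariant_ext Y l)) x"
  proof (rule chain.lin_cong)
    fix l assume "l \<in> cells x"
    then have l: "l \<in> G.bar (Suc m)" using x by auto
    note s = G.increments_tuples[OF l] and g = G.hd_bar[OF l]
    show "push m n Y (tensor m a l) = tensor_lin n a (equivariant_ext Y l)"
      using a l s g by (simp add: tensor_def push_single equivariant_ext_def tensor_lin_tr Y)
  qed (use a hom_in_carrier[OF push_hom] in \<open>auto simp: tensor_closed\<close>)
  also have "\<dots> = tensor_lin n a (frag_extend (equivariant_ext Y) x)"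
    using a by (simp add: chain.lin_frag_extend tensor_closed)
  finally show ?thesis .
qed

lemma push_push:
  assumes Z: "\<And>s. s \<in> tuples G n \<Longrightarrow> cells (Z s) \<subseteq> G.bar (Suc k)"
    and Y: "\<And>s. s \<in> tuples G m \<Longrightarrow> cells (Y s) \<subseteq> G.bar (Suc n)"
    and c: "c \<in> carrier (Ch m)"
  shows "push n k Z (push m n Y c) = push m k (\<lambda>s. frag_extend (equivariant_ext Z) (Y s)) c"
proof -
  have "push n k Z (push m n Y c) =
      gfinprod (Ch k) (\<lambda>s. push n k Z (tensor_lin n (c s) (Y s))) (tuples G m)"
    unfolding push_def[of m n]
    by (rule chain.gfinprod_hom[OF comm_group_chain push_hom push_support(2,1)[OF c]])
  also have "\<dots> = push m k (\<lambda>s. frag_extend (equivariant_ext Z) (Y s)) c"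
      unfolding push_def[of m k]
  proof (rule chain.gfinprod_cong_mem)
    fix s assume "s \<in> tuples G m"
    then show "push n k Z (tensor_lin n (c s) (Y s)) = tensor_lin k (c s) (frag_extend (equivariant_ext Z) (Y s))"
      using push_tensor[OF Z] Y c by (simp add: chain_value)
  qed (use push_support(2)[OF c] in auto)
  finally show ?thesis .
qed

lemma push_add:
  assumes "c \<in> carrier (Ch m)"
  shows "push m n (\<lambda>s. Y s + Z s) c = push m n Y c \<otimes>\<^bsub>Ch n\<^esub> push m n Z c"
proof -
  have "push m n (\<lambda>s. Y s + Z s) c = gfinprod (Ch n)
      (\<lambda>s. tensor_lin n (c s) (Y s) \<otimes>\<^bsub>Ch n\<^esub> tensor_lin n (c s) (Z s)) (tuples G m)"
    unfolding push_def
    by (rule chain.gfinprod_cong) (use assms chain_value tensor_lin_closed in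
      \<open>auto simp: simp_implies_def chain.lin_add tensor_closed intro!: chain.m_closed\<close>)
  also have "\<dots> = push m n Y c \<otimes>\<^bsub>Ch n\<^esub> push m n Z c"
    unfolding push_def using push_support[OF assms] by (intro chain.gfinprod_distrib)
  finally show ?thesis .
qed

lemma eval_hom: "t \<in> tuples G n \<Longrightarrow> (\<lambda>c. c t) \<in> hom (Ch n) A"
  by (rule homI) (auto simp: chain_value chain_mult)

lemma push_eval:
  assumes "c \<in> carrier (Ch m)" "t \<in> tuples G n"
  shows "push m n Y c t = gfinprod A (\<lambda>s. tensor_lin n (c s) (Y s) t) (tuples G m)"
  unfolding push_def
  by (rule chain.gfinprod_hom[OF A.comm_group_axioms eval_hom[OF assms(2)] push_support(2,1)[OF assms(1)]])

lemma chain_eqI: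
  assumes "c \<in> carrier (Ch n)" "c' \<in> carrier (Ch n)"
    "\<And>t. t \<in> tuples G n \<Longrightarrow> c t = c' t"
  shows "c = c'"
  using assms unfolding chain_carrier by (auto intro: PiE_ext)

lemma push_id:
  assumes c: "c \<in> carrier (Ch n)"
  shows "push n n (\<lambda>s. frag_of (G.vertices \<one> s)) c = c"
proof (rule chain_eqI)
  show "push n n (\<lambda>s. frag_of (G.vertices \<one> s)) c \<in> carrier (Ch n)"
    using hom_in_carrier[OF push_hom c] .
  fix t assume t: "t \<in> tuples G n"
  have "push n n (\<lambda>s. frag_of (G.vertices \<one> s)) c t =
      gfinprod A (\<lambda>s. single n s (c s) t) (tuples G n)"
    unfolding push_eval[OF c t]
    by (rule A.gfinprod_cong)
      (use c t in \<open>auto simp: simp_implies_def chain.lin_of tensor_closed chain_value tensor_vertices \<phi>_one single_def\<close>)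
  also have "\<dots> = gfinprod A c {t}"
    by (rule A.gfinprod_mono_neutral_cong_right) (use c t in \<open>auto simp: single_def chain_value\<close>)
  also have "\<dots> = c t"
    using c t by (subst A.gfinprod_eq_finprod) (auto simp: chain_value)
  finally show "push n n (\<lambda>s. frag_of (G.vertices \<one> s)) c t = c t" .
qed fact

text \<open>
  Evaluated at a cell \<open>t\<close>, both sides are products over all pairs of a cell \<open>s\<close> of the support and an
  index \<open>i\<close> for which the \<open>i\<close>-th face of \<open>s\<close> is \<open>t\<close>.
\<close>

lemma boundary_eq_push:
  assumes c: "c \<in> carrier (Ch (Suc n))"
  shows "boundary G A \<phi> n c = push (Suc n) n (\<lambda>s. face_sum (G.vertices \<one> s)) c"
proof -
  have "boundary G A \<phi> n c t = push (Suc n) n (\<lambda>s. face_sum (G.vertices \<one> s)) c t"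
    if t: "t \<in> tuples G n" for t
  proof -
    let ?term = "\<lambda>s i. (if i = 0 then \<phi> (inv (hd s)) (c s) else c s) [^]\<^bsub>A\<^esub> ((- 1) ^ i :: int)"
    let ?p = "\<lambda>s. finprod A (?term s) {i \<in> {..Suc n}. bar_face G i s = t}"
    have cl: "?term s i \<in> carrier A" if "s \<in> tuples G (Suc n)" for s i
    proof -
      have "hd s \<in> carrier G" using that by (cases s) (auto simp: tuples_def)
      then show ?thesis using chain_value[OF c that] by auto
    qed
    have eq: "tensor_lin n (c s) (face_sum (G.vertices \<one> s)) t = ?p s"
      if s: "s \<in> tuples G (Suc n)" for s
    proof -
      have cs: "c s \<in> carrier A" and hs: "hd s \<in> carrier G"
        using c s chain_value by (blast, cases s) (auto simp: tuples_def)
      have T: "tensor n (c s) l t \<in> carrier A" for l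
        using chain_value[OF tensor_closed[OF cs] t] .
      have "tensor_lin n (c s) (face_sum (G.vertices \<one> s)) t =
          lin A (\<lambda>l. tensor n (c s) l t) (face_sum (G.vertices \<one> s))"
        using chain.lin_hom_compose[OF A.comm_group_axioms eval_hom[OF t] tensor_closed[OF cs]] .
      also have "\<dots> = finprod A (\<lambda>i. if bar_face G i s = t then ?term s i else \<one>\<^bsub>A\<^esub>) {..Suc n}"
        unfolding G.face_sum_vertices[OF s G.one_closed]
        using s hs t T cl[OF s]
        by (auto simp: A.lin_sum A.lin_cmul A.lin_of tensor_vertices G.bar_face_tuples \<phi>_one cs single_def
            simp del: sum.atMost_Suc A.finprod_Suc intro!: A.finprod_cong')
      also have "\<dots> = ?p s"
        by (rule A.finprod_mono_neutral_cong_right) (use cl[OF s] in auto)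
      finally show ?thesis .
    qed
    have pc: "?p s \<in> carrier A" if "s \<in> tuples G (Suc n)" for s
      using cl[OF that] by (intro A.finprod_closed) auto
    have "push (Suc n) n (\<lambda>s. face_sum (G.vertices \<one> s)) c t = gfinprod A ?p (tuples G (Suc n))"
      unfolding push_eval[OF c t]
      by (rule A.gfinprod_cong) (use eq pc in \<open>auto simp: simp_implies_def\<close>)
    also have "\<dots> = gfinprod A ?p {s \<in> tuples G (Suc n). c s \<noteq> \<one>\<^bsub>A\<^esub>}"
    proof (rule A.gfinprod_mono_neutral_cong_right)
      fix s assume s: "s \<in> tuples G (Suc n) - {s \<in> tuples G (Suc n). c s \<noteq> \<one>\<^bsub>A\<^esub>}"
      then have "hd s \<in> carrier G" by (cases s) (auto simp: tuples_def)
      then show "?p s = \<one>\<^bsub>A\<^esub>"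
        using s by (intro A.finprod_one_eqI) (auto simp: \<phi>_unit)
    qed (use pc in auto)
    also have "\<dots> = finprod A ?p {s \<in> tuples G (Suc n). c s \<noteq> \<one>\<^bsub>A\<^esub>}"
      using c pc by (intro A.gfinprod_eq_finprod) (auto simp: chain_carrier)
    finally show ?thesis using t by (simp add: boundary_def)
  qed
  moreover have "push (Suc n) n (\<lambda>s. face_sum (G.vertices \<one> s)) c \<in> extensional (tuples G n)"
    using hom_in_carrier[OF push_hom c] by (auto simp: chain_carrier PiE_def)
  ultimately show ?thesis
    by (intro extensionalityI[where A = "tuples G n"]) (auto simp: boundary_def)
qed

lemma boundary_hom: "boundary G A \<phi> n \<in> hom (Ch (Suc n)) (Ch n)"
  using push_hom[of "Suc n" n] boundary_eq_push chain.m_closed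
  by (auto simp: hom_def Pi_iff)

lemma equivariant_ext_eq:
  assumes "\<And>l g. l \<in> G.bar (Suc n) \<Longrightarrow> g \<in> carrier G \<Longrightarrow> f (map ((\<otimes>) g) l) = tr ((\<otimes>) g) (f l)"
    and "l \<in> G.bar (Suc n)"
  shows "equivariant_ext (\<lambda>s. f (G.vertices \<one> s)) l = f l"
proof -
  obtain g s where gs: "g \<in> carrier G" "s \<in> tuples G n" "l = G.vertices g s"
    using assms(2) by (rule bar_tuples)
  have "equivariant_ext (\<lambda>s. f (G.vertices \<one> s)) l = f (map ((\<otimes>) g) (G.vertices \<one> s))"
    using gs assms(1)[OF G.vertices_bar[OF G.one_closed gs(2)] gs(1)]
    by (simp add: equivariant_ext_def G.increments_vertices tuples_def in_lists_conv_set subset_iff)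
  also have "map ((\<otimes>) g) (G.vertices \<one> s) = l"
    using gs by (simp add: G.map_vertices tuples_def in_lists_conv_set subset_iff)
  finally show ?thesis .
qed

lemma vertices_one_bar: "s \<in> tuples G k \<Longrightarrow> G.vertices \<one> s \<in> G.bar (Suc k)"
  using G.vertices_bar by simp

lemma cells_face_vertices: "s \<in> tuples G (Suc k) \<Longrightarrow> cells (face_sum (G.vertices \<one> s)) \<subseteq> G.bar (Suc k)"
  using G.cells_face_sum_bar vertices_one_bar by blast

lemma equivariant_ext_face: "l \<in> G.bar (Suc k) \<Longrightarrow> equivariant_ext (\<lambda>s. face_sum (G.vertices \<one> s)) l = face_sum l"
  using equivariant_ext_eq[of k face_sum] by (simp add: tr_face_sum)

lemma group_homology_trivial_iff:
  "trivial_homology G A \<phi> n \<longleftrightarrow>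
     cycles G A \<phi> n \<subseteq> boundaries G A \<phi> n"
  unfolding group_homology_def
proof (rule quotient_trivial_iff[OF chain.is_group])
  interpret d: group_hom "Ch (Suc n)" "Ch n" "boundary G A \<phi> n"
    using boundary_hom by (simp add: group_hom_def group_hom_axioms_def chain.is_group)
  show "subgroup (boundaries G A \<phi> n) (Ch n)"
    using d.img_is_subgroup by (simp add: boundaries_def)
  show "cycles G A \<phi> n \<subseteq> carrier (Ch n)"
    by (auto simp: cycles_def kernel_def split: nat.split)
  show "\<one>\<^bsub>Ch n\<^esub> \<in> cycles G A \<phi> n"
    using hom_one[OF boundary_hom chain.is_group chain.is_group]
    by (auto simp: cycles_def kernel_def split: nat.split)
qed

text \<open>
  Applying \<open>c \<mapsto> a \<otimes> _\<close> to the contraction gives \<open>c = \<partial>(H' c) + H (\<partial> c)\<close>, so a cycle is the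
  boundary of its image under \<open>H'\<close>.
\<close>

lemma homology_vanishes:
  assumes K: "G.contraction (Suc m) H H'"
  shows "trivial_homology G A \<phi> (Suc m)"
  unfolding group_homology_trivial_iff
proof
  fix c assume "c \<in> cycles G A \<phi> (Suc m)"
  then have c: "c \<in> carrier (Ch (Suc m))" "boundary G A \<phi> m c = \<one>\<^bsub>Ch m\<^esub>"
    by (auto simp: cycles_def kernel_def)
  let ?h = "G.vertices \<one>"
  define b where "b = push (Suc m) (Suc (Suc m)) (\<lambda>s. H' (?h s)) c"
  have b: "b \<in> carrier (Ch (Suc (Suc m)))"
    unfolding b_def by (rule hom_in_carrier[OF push_hom c(1)])
  have cH: "cells (H (?h s)) \<subseteq> G.bar (Suc (Suc m))" if "s \<in> tuples G m" for s
    using K vertices_one_bar[OF that] by (auto simp: G.contraction_def)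
  have cH': "cells (H' (?h s)) \<subseteq> G.bar (Suc (Suc (Suc m)))" if "s \<in> tuples G (Suc m)" for s
    using K vertices_one_bar[OF that] by (auto simp: G.contraction_def)
  have eH: "equivariant_ext (\<lambda>s. H (?h s)) l = H l" if "l \<in> G.bar (Suc m)" for l
    using equivariant_ext_eq[of m H] that K by (simp add: G.contraction_def)
  have "boundary G A \<phi> (Suc m) b =
      push (Suc m) (Suc m) (\<lambda>s. frag_extend (equivariant_ext (\<lambda>s. face_sum (?h s))) (H' (?h s))) c"
    unfolding boundary_eq_push[OF b] unfolding b_def using cells_face_vertices cH' c(1) by (rule push_push)
  also have "\<dots> = push (Suc m) (Suc m) (\<lambda>s. bd (H' (?h s))) c"
  proof -
    have "frag_extend (equivariant_ext (\<lambda>s. face_sum (?h s))) (H' (?h s)) = bd (H' (?h s))"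
      if "s \<in> tuples G (Suc m)" for s
      unfolding bd_def by (rule frag_extend_eq) (use cH'[OF that] equivariant_ext_face in blast)
    then show ?thesis unfolding push_def using push_support(2)[OF c(1)]
      by (intro chain.gfinprod_cong) (auto simp: simp_implies_def)
  qed
  finally have 1: "boundary G A \<phi> (Suc m) b = push (Suc m) (Suc m) (\<lambda>s. bd (H' (?h s))) c" .
  have "\<one>\<^bsub>Ch (Suc m)\<^esub> = push m (Suc m) (\<lambda>s. H (?h s)) (boundary G A \<phi> m c)"
    using hom_one[OF push_hom chain.is_group chain.is_group] c(2) by simp
  also have "\<dots> = push (Suc m) (Suc m) (\<lambda>s. frag_extend (equivariant_ext (\<lambda>s. H (?h s))) (face_sum (?h s))) c"
    unfolding boundary_eq_push[OF c(1)] using cH cells_face_vertices c(1) by (rule push_push)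
  also have "\<dots> = push (Suc m) (Suc m) (\<lambda>s. frag_extend H (face_sum (?h s))) c"
  proof -
    have "frag_extend (equivariant_ext (\<lambda>s. H (?h s))) (face_sum (?h s)) = frag_extend H (face_sum (?h s))"
      if "s \<in> tuples G (Suc m)" for s
      by (rule frag_extend_eq) (use cells_face_vertices[OF that] eH in blast)
    then show ?thesis unfolding push_def using push_support(2)[OF c(1)]
      by (intro chain.gfinprod_cong) (auto simp: simp_implies_def)
  qed
  finally have 2: "push (Suc m) (Suc m) (\<lambda>s. frag_extend H (face_sum (?h s))) c = \<one>\<^bsub>Ch (Suc m)\<^esub>"
    by simp
  have "c = push (Suc m) (Suc m) (\<lambda>s. frag_of (?h s)) c"
    using push_id[OF c(1)] by simp
  also have "\<dots> = push (Suc m) (Suc m) (\<lambda>s. bd (H' (?h s)) + frag_extend H (face_sum (?h s))) c"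
    unfolding push_def using K vertices_one_bar push_support(2)[OF c(1)]
    by (intro chain.gfinprod_cong) (auto simp: simp_implies_def G.contraction_def)
  also have "\<dots> = boundary G A \<phi> (Suc m) b"
    unfolding push_add[OF c(1)] 1 2
    by (rule chain.r_one) (rule hom_in_carrier[OF push_hom c(1)])
  finally show "c \<in> boundaries G A \<phi> (Suc m)"
    using b by (auto simp: boundaries_def)
qed

end

section \<open>The torus cycle and the cup product\<close>

abbreviation int_lin :: "('c \<Rightarrow> int) \<Rightarrow> ('c \<Rightarrow>\<^sub>0 int) \<Rightarrow> int" where
  "int_lin \<equiv> lin integer_group"

interpretation Z: comm_group integer_group
  by (rule abelian_integer_group)

lemma int_lin_simps [simp]:
  "int_lin f (frag_of c) = f c" "int_lin f (x - y) = int_lin f x - int_lin f y" "int_lin f 0 = 0"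
  by (simp_all add: Z.lin_of Z.lin_diff Z.lin_zero)

lemma int_lin_eq_0: "(\<And>c. c \<in> cells x \<Longrightarrow> f c = 0) \<Longrightarrow> int_lin f x = 0"
  using Z.lin_cong[of f "\<lambda>_. 0" x] Z.lin_one[of x] by simp

lemma int_lin_cons: "int_lin f (cons a y) = int_lin (\<lambda>l. f (a # l)) y"
  by (simp add: cons_def Z.lin_frag_extend)

context group
begin

text \<open>
  The kernel of the passage to coinvariants under \<open>K\<close>. A chain whose boundary lies in it is a
  cycle for every coefficient module on which \<open>K\<close> acts trivially.
\<close>

inductive_set null :: "'a set \<Rightarrow> nat \<Rightarrow> ('a list \<Rightarrow>\<^sub>0 int) set" for K :: "'a set" and n :: nat where
  zero: "0 \<in> null K n"
| diff: "x \<in> null K n \<Longrightarrow> y \<in> null K n \<Longrightarrow> x - y \<in> null K n"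
| move: "k \<in> K \<Longrightarrow> l \<in> bar n \<Longrightarrow> frag_of (map ((\<otimes>) k) l) - frag_of l \<in> null K n"

lemma tr_diff_null:
  assumes "k \<in> K" "cells x \<subseteq> bar n"
  shows "tr ((\<otimes>) k) x - x \<in> null K n"
  using assms(2)
proof (induction x rule: frag_induction)
  case (diff a b)
  have "tr ((\<otimes>) k) (a - b) - (a - b) = (tr ((\<otimes>) k) a - a) - (tr ((\<otimes>) k) b - b)" by simp
  then show ?case using diff null.diff by metis
qed (use assms(1) in \<open>auto intro: null.zero null.move\<close>)

end

context group_module
begin

text \<open>
  A coboundary evaluates trivially on a chain whose boundary is null, since an equivariant cochain
  cannot distinguish \<open>k l\<close> from \<open>l\<close> when \<open>k\<close> acts trivially on the coefficients.
\<close>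

lemma cohomology_nonzero:
  assumes f: "f \<in> cocycles G A \<phi> (Suc m)"
    and K: "K \<subseteq> carrier G" "\<And>k a. k \<in> K \<Longrightarrow> a \<in> carrier A \<Longrightarrow> \<phi> k a = a"
    and z: "cells z \<subseteq> G.bar (Suc (Suc m))" "bd z \<in> G.null K (Suc m)"
    and nz: "lin A (homog f (Suc m)) z \<noteq> \<one>\<^bsub>A\<^esub>"
  shows "\<not> trivial_cohomology G A \<phi> (Suc m)"
proof
  assume "trivial_cohomology G A \<phi> (Suc m)"
  then obtain b where b: "b \<in> carrier (Co m)" "f = coboundary G A \<phi> m b"
    using f unfolding group_cohomology_trivial_iff by (auto simp: coboundaries_def)
  have fc: "f \<in> carrier (Co (Suc m))" using b coboundary_closed by simp
  have "homog f (Suc m) l = lin A (homog b m) (face_sum l)" if l: "l \<in> G.bar (Suc (Suc m))" for l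
  proof -
    obtain g s where gs: "g \<in> carrier G" "s \<in> tuples G (Suc m)" "l = G.vertices g s"
      using l by (rule bar_tuples)
    then show ?thesis using lin_homog_vertices[OF b(1) gs(1,2)] b(2) by (simp add: homog_vertices)
  qed
  then have "lin A (homog f (Suc m)) z = lin A (\<lambda>l. lin A (homog b m) (face_sum l)) z"
    using z(1) b(1) fc by (intro A.lin_cong) (auto simp: subset_iff)
  also have "\<dots> = lin A (homog b m) (bd z)"
    using b(1) by (simp add: bd_def A.lin_frag_extend)
  also have "\<dots> = \<one>\<^bsub>A\<^esub>"
    using z(2)
  proof (induction rule: G.null.induct)
    case (move k l)
    then show ?case using b(1) K by (auto simp: A.lin_diff A.lin_of homog_map)
  qed (use b(1) in \<open>auto simp: A.lin_diff A.lin_zero\<close>)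
  finally show False using nz by simp
qed

text \<open>
  The dual criterion: a homomorphism \<open>\<Phi>\<close> on chains that kills boundaries and does not kill the cycle
  \<open>a \<otimes> z\<close>.
\<close>

lemma homology_nonzero:
  assumes a: "a \<in> carrier A"
    and K: "K \<subseteq> carrier G" "\<And>k b. k \<in> K \<Longrightarrow> b \<in> carrier A \<Longrightarrow> \<phi> k b = b"
    and z: "cells z \<subseteq> G.bar (Suc (Suc m))" "bd z \<in> G.null K (Suc m)"
    and L: "comm_group L" "\<Phi> \<in> hom (Ch (Suc m)) L"
    and \<Phi>: "\<And>b l. b \<in> carrier A \<Longrightarrow> l \<in> G.bar (Suc (Suc (Suc m))) \<Longrightarrow>
      \<Phi> (tensor_lin (Suc m) b (face_sum l)) = \<one>\<^bsub>L\<^esub>"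
    and nz: "\<Phi> (tensor_lin (Suc m) a z) \<noteq> \<one>\<^bsub>L\<^esub>"
  shows "\<not> trivial_homology G A \<phi> (Suc m)"
proof
  assume triv: "trivial_homology G A \<phi> (Suc m)"
  interpret L: comm_group L by fact
  let ?h = "G.vertices \<one>"
  have \<phi>_inv: "\<phi> (inv k) a = a" if "k \<in> K" for k
  proof -
    have "\<phi> (inv k) a = \<phi> (inv k) (\<phi> k a)" using K(2)[OF that a] by simp
    also have "\<dots> = a" using that K(1) a by (subst \<phi>_compose[symmetric]) (auto simp: \<phi>_one)
    finally show ?thesis .
  qed
  let ?c = "tensor_lin (Suc m) a z"
  have c: "?c \<in> carrier (Ch (Suc m))" by (rule tensor_lin_closed[OF a])
  have "boundary G A \<phi> m ?c = tensor_lin m a (frag_extend (equivariant_ext (\<lambda>s. face_sum (?h s))) z)"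
    unfolding boundary_eq_push[OF c] using cells_face_vertices a z(1) by (rule push_tensor)
  also have "frag_extend (equivariant_ext (\<lambda>s. face_sum (?h s))) z = bd z"
    unfolding bd_def by (rule frag_extend_eq) (use z(1) equivariant_ext_face in blast)
  also have "tensor_lin m a (bd z) = \<one>\<^bsub>Ch m\<^esub>"
    using z(2)
  proof (induction rule: G.null.induct)
    case (move k l)
    then have "tensor_lin m a (tr ((\<otimes>) k) (frag_of l)) = tensor_lin m a (frag_of l)"
      using tensor_lin_tr[OF a, of k "frag_of l" m] \<phi>_inv K by (auto simp: keys_frag_of)
    then show ?case using tensor_lin_closed[OF a] by (simp add: chain.lin_diff tensor_closed a)
  qed (use a in \<open>auto simp: chain.lin_diff chain.lin_zero tensor_closed\<close>)
  finally have "?c \<in> cycles G A \<phi> (Suc m)"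
    using c by (simp add: cycles_def kernel_def)
  then obtain w where w: "w \<in> carrier (Ch (Suc (Suc m)))" "?c = boundary G A \<phi> (Suc m) w"
    using triv unfolding group_homology_trivial_iff by (auto simp: boundaries_def)
  have "\<Phi> ?c = \<Phi> (push (Suc (Suc m)) (Suc m) (\<lambda>s. face_sum (?h s)) w)"
    using w boundary_eq_push by simp
  also have "\<dots> = gfinprod L (\<lambda>s. \<Phi> (tensor_lin (Suc m) (w s) (face_sum (?h s)))) (tuples G (Suc (Suc m)))"
    unfolding push_def by (rule chain.gfinprod_hom[OF L push_support(2,1)[OF w(1)]])
  also have "\<dots> = gfinprod L (\<lambda>s. \<one>\<^bsub>L\<^esub>) (tuples G (Suc (Suc m)))"
    by (rule L.gfinprod_cong_mem) (use \<Phi> w(1) chain_value vertices_one_bar in auto)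
  also have "\<dots> = \<one>\<^bsub>L\<^esub>" by (simp add: gfinprod_def)
  finally show False using nz by simp
qed

end

context lattice_cocycle
begin

text \<open>
  The elements that act on the lattice as pure translations. They commute with each other and form the
  kernel of the action on \<open>X\<close>.
\<close>

definition shifts :: "'a set" where
  "shifts = {k \<in> carrier G. \<tau> k = id}"

lemma \<tau>_one: "\<tau> \<one> = id"
proof -
  have "\<tau> \<one> = \<tau> \<one> \<circ> \<tau> \<one>" using \<tau>_mult[of \<one> \<one>] by simp
  moreover have "inj (\<tau> \<one>)" using \<tau>_permutes permutes_inj by blast
  ultimately show ?thesis by (metis comp_apply eq_id_iff injD)
qed

lemma v_one: "v \<one> = (\<lambda>x. 0)"
  using v_mult[of \<one> \<one>] by (auto simp: \<tau>_one fun_eq_iff)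

lemma v_inv: "g \<in> carrier G \<Longrightarrow> v (inv g) (\<tau> g x) = - v g x"
  using fun_cong[OF v_mult[of g "inv g"], of x] by (simp add: v_one)

lemma \<tau>_inv: "g \<in> carrier G \<Longrightarrow> \<tau> (inv g) \<circ> \<tau> g = id"
  using \<tau>_mult[of g "inv g"] by (simp add: \<tau>_one)

lemma v_translation: "k \<in> shifts \<Longrightarrow> g \<in> carrier G \<Longrightarrow> v (k \<otimes> g) x = v k x + v g x"
  by (auto simp: shifts_def v_mult)

lemma translation_mult: "k \<in> shifts \<Longrightarrow> g \<in> shifts \<Longrightarrow> k \<otimes> g \<in> shifts"
  by (auto simp: shifts_def \<tau>_mult)

lemma translation_commute: "k \<in> shifts \<Longrightarrow> t \<in> shifts \<Longrightarrow> k \<otimes> t = t \<otimes> k"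
  by (rule v_inj) (auto simp: shifts_def v_mult)

text \<open>
  Among the elements with vectors \<open>m e\<^sub>x\<close>, two have the same permutation, because there are finitely many
  permutations of \<open>X\<close>; their quotient is a translation.
\<close>

lemma translation_exists:
  assumes "x \<in> X"
  obtains t N where "t \<in> shifts" "N \<noteq> 0" "v t = (\<lambda>y. if y = x then N else 0)"
proof -
  have "\<exists>h\<in>carrier G. v h = (\<lambda>y. if y = x then int m else 0)" for m
    by (rule v_surj[of "\<lambda>y. if y = x then int m else 0"]) (use assms in auto)
  then obtain h where h: "\<And>m. h m \<in> carrier G" "\<And>m. v (h m) = (\<lambda>y. if y = x then int m else 0)"
    by metis
  have "finite (range (\<lambda>m. \<tau> (h m)))"
    by (rule finite_subset[OF _ finite_permutations[OF finite_X]]) (use h \<tau>_permutes in auto)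
  then obtain m m' where mm: "m \<noteq> m'" "\<tau> (h m) = \<tau> (h m')"
    using finite_imageD[of "\<lambda>m. \<tau> (h m)" "UNIV :: nat set"] by (auto simp: inj_on_def)
  \<comment> \<open>the common permutation cancels, and the vectors subtract\<close>
  define t where "t = h m' \<otimes> inv (h m)"
  have "v t = (\<lambda>y. if y = x then int m' - int m else 0)"
    using v_inv[OF h(1)[of m]] h mm by (auto simp: t_def v_mult fun_eq_iff)
  moreover have "t \<in> shifts"
    using h mm \<tau>_inv[OF h(1)[of m]] by (auto simp: shifts_def t_def \<tau>_mult)
  ultimately show ?thesis using that[of t "int m' - int m"] mm by auto
qed

text \<open>
  The cup product of the coordinates \<open>i\<^sub>1, \<dots>, i\<^sub>n\<close> of the 1-cocycle \<open>v\<close>, in homogeneous coordinates: the product of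
  the \<open>i\<^sub>k\<close>-th coordinates of the \<open>k\<close>-th edge vectors.
\<close>

fun cup :: "'a list \<Rightarrow> 'x list \<Rightarrow> int" where
  "cup [a] [] = 1"
| "cup (a # b # l) (x # i) = (v b x - v a x) * cup (b # l) i"
| "cup _ _ = 0"

lemma cup_map:
  "g \<in> carrier G \<Longrightarrow> set l \<subseteq> carrier G \<Longrightarrow> cup (map ((\<otimes>) g) l) i = cup l (map (\<tau> g) i)"
  by (induction l i rule: cup.induct) (auto simp: v_mult)

text \<open>
  The product rule. Splitting off the first two vertices, the faces that omit one of them contribute the first edge
  vectors from \<open>b\<close> and from \<open>a\<close>; their difference cancels against the remaining faces by the induction hypothesis.
\<close>

lemma cup_cocycle: "length l = Suc (Suc (length i)) \<Longrightarrow> int_lin (\<lambda>l. cup l i) (face_sum l) = 0"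
proof (induction i arbitrary: l)
  case Nil
  then obtain a b where "l = [a, b]" by (auto simp: length_Suc_conv)
  then show ?case by simp
next
  case (Cons x i)
  then obtain a b c l' where l: "l = a # b # c # l'" "length l' = length i" by (auto simp: length_Suc_conv)
  have 1: "int_lin (\<lambda>l. cup l (x # i)) (cons a (cons b y)) = (v b x - v a x) * int_lin (\<lambda>l. cup l i) (cons b y)" for y
    by (rule additive_eqI) (auto simp: right_diff_distrib)
  have "int_lin (\<lambda>l. cup l i) (face_sum (b # c # l')) = 0"
    by (rule Cons.IH) (simp add: l(2))
  then have "int_lin (\<lambda>l. cup l i) (cons b (face_sum (c # l'))) = cup (c # l') i"
    unfolding face_sum.simps(2)[of b "c # l'"] by (simp del: face_sum.simps)
  then have "int_lin (\<lambda>l. cup l (x # i)) (cons a (cons b (face_sum (c # l')))) = (v b x - v a x) * cup (c # l') i"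
    unfolding 1 by simp
  then show ?case
    unfolding l(1) face_sum.simps(2)[of a] face_sum.simps(2)[of b]
    by (simp del: face_sum.simps add: left_diff_distrib)
qed

text \<open>
  The fundamental cycle of the torus spanned by the translations \<open>T x\<close>, as an iterated product
  with circles.
\<close>

primrec torus :: "('x \<Rightarrow> 'a) \<Rightarrow> 'x list \<Rightarrow> ('a list \<Rightarrow>\<^sub>0 int)" where
  "torus T [] = frag_of [\<one>]"
| "torus T (x # xs) = prism ((\<otimes>) (T x)) (torus T xs)"

lemma cells_prism_list_hd: "l' \<in> cells (prism_list t l) \<Longrightarrow> \<exists>r. l' = hd l # r"
proof (cases l)
  case (Cons a m)
  assume "l' \<in> cells (prism_list t l)"
  then have "l' \<in> cells (frag_of (a # map t (a # m))) \<union> cells (cons a (prism_list t m))"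
    unfolding Cons prism_list.simps
    using keys_diff[of "frag_of (a # map t (a # m))" "cons a (prism_list t m)"] by (rule rev_subsetD)
  then show ?thesis using keys_cons[of a "prism_list t m"] by (auto simp: Cons keys_frag_of)
qed simp

text \<open>
  If \<open>y\<close> lies in the hyperplane \<open>v x = 0\<close>, the coordinate \<open>x\<close> is nonzero only on the
  edge along \<open>t\<close>. Since \<open>x\<close> is the first index, only the term of the prism in which this edge comes first contributes.
\<close>

lemma cup_prism:
  assumes t: "t \<in> shifts" "v t = (\<lambda>y. if y = x then N else 0)"
    and y: "\<And>l g. l \<in> cells y \<Longrightarrow> g \<in> set l \<Longrightarrow> g \<in> carrier G \<and> v g x = 0"
  shows "int_lin (\<lambda>l. cup l (x # i)) (prism ((\<otimes>) t) y) = N * int_lin (\<lambda>l. cup l i) y"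
proof (rule additive_eqI)
  fix l assume l: "l \<in> cells y"
  have tG: "t \<in> carrier G" and idt: "\<tau> t = id" using t by (auto simp: shifts_def)
  show "int_lin (\<lambda>l. cup l (x # i)) (prism ((\<otimes>) t) (frag_of l)) = N * int_lin (\<lambda>l. cup l i) (frag_of l)"
  proof (cases l)
    case (Cons a m)
    have lG: "set l \<subseteq> carrier G" using y[OF l] by blast
    have "cup (a # l') (x # i) = 0" if l': "l' \<in> cells (prism_list ((\<otimes>) t) m)" for l'
    proof -
      have "m \<noteq> []" using l' by auto
      then have "v (hd m) x = 0" "v a x = 0" using y[OF l] Cons by auto
      then show ?thesis using cells_prism_list_hd[OF l'] by auto
    qed
    then have "int_lin (\<lambda>l. cup l (x # i)) (cons a (prism_list ((\<otimes>) t) m)) = 0"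
      unfolding int_lin_cons by (rule int_lin_eq_0)
    moreover have "cup (a # map ((\<otimes>) t) (a # m)) (x # i) = N * cup (a # m) i"
    proof -
      have "a \<in> carrier G" "v a x = 0" using y[OF l, of a] Cons by simp_all
      then have "v (t \<otimes> a) x - v a x = N" using t by (simp add: v_translation)
      then show ?thesis using cup_map[OF tG lG, of i] by (simp add: Cons idt)
    qed
    ultimately show ?thesis by (simp add: Cons)
  qed simp
qed (auto simp: right_diff_distrib)

lemma cells_torus:
  assumes "\<And>x. x \<in> set xs \<Longrightarrow> T x \<in> shifts \<and> (\<forall>y. y \<noteq> x \<longrightarrow> v (T x) y = 0)"
  shows "cells (torus T xs) \<subseteq>
    {l. length l = Suc (length xs) \<and> (\<forall>g\<in>set l. g \<in> shifts \<and> (\<forall>y. y \<notin> set xs \<longrightarrow> v g y = 0))}"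
  using assms
proof (induction xs)
  case Nil
  show ?case by (simp add: keys_frag_of v_one shifts_def \<tau>_one)
next
  case (Cons x xs)
  have Tx: "T x \<in> shifts" "\<And>y. y \<noteq> x \<Longrightarrow> v (T x) y = 0" using Cons.prems by auto
  show ?case
    unfolding torus.simps prism_def
  proof (rule keys_frag_extendI)
    fix l assume "l \<in> cells (torus T xs)"
    then have l: "length l = Suc (length xs)"
      "\<And>g. g \<in> set l \<Longrightarrow> g \<in> shifts \<and> (\<forall>y. y \<notin> set xs \<longrightarrow> v g y = 0)"
      using Cons by auto
    have "T x \<otimes> g \<in> shifts \<and> (\<forall>y. y \<notin> set (x # xs) \<longrightarrow> v (T x \<otimes> g) y = 0)" if "g \<in> set l" for g
      using l(2)[OF that] Tx v_translation[OF Tx(1), of g] translation_mult[OF Tx(1), of g]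
      by (auto simp: shifts_def)
    then show "cells (prism_list ((\<otimes>) (T x)) l) \<subseteq> {l. length l = Suc (length (x # xs)) \<and>
        (\<forall>g\<in>set l. g \<in> shifts \<and> (\<forall>y. y \<notin> set (x # xs) \<longrightarrow> v g y = 0))}"
      using keys_prism_list[of "(\<otimes>) (T x)" l] l by fastforce
  qed
qed

lemma cells_prism_bar:
  assumes "t \<in> carrier G" "cells x \<subseteq> bar n"
  shows "cells (prism ((\<otimes>) t) x) \<subseteq> bar (Suc n)"
  unfolding prism_def
proof (rule keys_frag_extendI)
  fix l assume "l \<in> cells x"
  then have "l \<in> bar n" using assms by auto
  then have "set l \<union> (\<otimes>) t ` set l \<subseteq> carrier G" "length l = n" using assms by (auto simp: bar_def)
  then show "cells (prism_list ((\<otimes>) t) l) \<subseteq> bar (Suc n)"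
    using keys_prism_list[of "(\<otimes>) t" l] unfolding bar_def by blast
qed

lemma prism_null:
  assumes "t \<in> shifts" "y \<in> null shifts n"
  shows "prism ((\<otimes>) t) y \<in> null shifts (Suc n)"
  using assms(2)
proof (induction rule: null.induct)
  case (move k l)
  have tG: "t \<in> carrier G" using assms(1) by (simp add: shifts_def)
  have kG: "k \<in> carrier G" using move by (simp add: shifts_def)
  have "k \<otimes> (t \<otimes> a) = t \<otimes> (k \<otimes> a)" if "a \<in> set l" for a
  proof -
    have "a \<in> carrier G" using that move by (auto simp: bar_def)
    then show ?thesis using tG kG translation_commute[OF move(1) assms(1)] by (metis m_assoc)
  qed
  then have "prism ((\<otimes>) t) (frag_of (map ((\<otimes>) k) l) - frag_of l) =
      tr ((\<otimes>) k) (prism_list ((\<otimes>) t) l) - prism_list ((\<otimes>) t) l"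
    by (simp add: tr_prism_list)
  also have "\<dots> \<in> null shifts (Suc n)"
    using cells_prism_bar[OF tG, of "frag_of l" n] move by (intro tr_diff_null) (auto simp: keys_frag_of)
  finally show ?case .
qed (auto intro: null.zero null.diff)

text \<open>
  By the prism homotopy, the boundary of the product with a circle consists of the difference of the two
  ends, which is null, and the product of the boundary with the circle.
\<close>

lemma bd_torus:
  assumes "\<And>x. x \<in> set xs \<Longrightarrow> T x \<in> shifts \<and> (\<forall>y. y \<noteq> x \<longrightarrow> v (T x) y = 0)" "xs \<noteq> []"
  shows "bd (torus T xs) \<in> null shifts (length xs)"
  using assms
proof (induction xs)
  case (Cons x xs)
  have c: "cells (torus T xs) \<subseteq> bar (length (x # xs))"
    using cells_torus[of xs T] Cons.prems by (fastforce simp: bar_def shifts_def)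
  have tx: "T x \<in> shifts" using Cons.prems by simp
  have "prism ((\<otimes>) (T x)) (bd (torus T xs)) \<in> null shifts (length (x # xs))"
  proof (cases xs)
    case Nil
    then show ?thesis by (simp add: null.zero)
  next
    case (Cons y ys)
    then show ?thesis using Cons.IH Cons.prems prism_null[OF tx] by simp
  qed
  moreover have "bd (torus T (x # xs)) =
      (tr ((\<otimes>) (T x)) (torus T xs) - torus T xs) - prism ((\<otimes>) (T x)) (bd (torus T xs))"
    using prism_homotopy[of "(\<otimes>) (T x)" "torus T xs"] by (simp add: algebra_simps)
  ultimately show ?case using tr_diff_null[OF tx c] null.diff by metis
qed simp

lemma cup_torus:
  assumes "\<And>x. x \<in> set xs \<Longrightarrow> T x \<in> shifts \<and> v (T x) = (\<lambda>y. if y = x then N x else 0)" "distinct xs"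
  shows "int_lin (\<lambda>l. cup l xs) (torus T xs) = (\<Prod>x\<leftarrow>xs. N x)"
  using assms
proof (induction xs)
  case (Cons x xs)
  have "int_lin (\<lambda>l. cup l (x # xs)) (prism ((\<otimes>) (T x)) (torus T xs)) = N x * int_lin (\<lambda>l. cup l xs) (torus T xs)"
  proof (rule cup_prism)
    show "g \<in> carrier G \<and> v g x = 0" if "l \<in> cells (torus T xs)" "g \<in> set l" for l g
      using cells_torus[of xs T] that Cons.prems by (fastforce simp: shifts_def)
  qed (use Cons.prems in auto)
  then show ?case using Cons by simp
qed simp

end

section \<open>The dimension of a lattice group\<close>

context lattice_cocycle
begin

definition multi_indices :: "'x list set" where
  "multi_indices = {i. set i \<subseteq> X \<and> length i = card X}"

text \<open>
  The \<open>|X|\<close>-th tensor power of the permutation module of integer functions on \<open>X\<close>. All coordinates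
  of the cup product together form an equivariant cochain with values in it, without a sign character.
\<close>

definition tensors :: "('x list \<Rightarrow> int) set" where
  "tensors = multi_indices \<rightarrow>\<^sub>E UNIV"

text \<open>
  A copy of the group of tensors on the range of an injection \<open>j\<close>, with elements of the type over which the
  coefficients range.
\<close>

definition tensor_module :: "(('x list \<Rightarrow> int) \<Rightarrow> 'm) \<Rightarrow> 'm monoid" where
  "tensor_module j = \<lparr>carrier = j ` tensors,
     monoid.mult = (\<lambda>a b. j (\<lambda>i\<in>multi_indices. inv_into tensors j a i + inv_into tensors j b i)),
     one = j (\<lambda>i\<in>multi_indices. 0)\<rparr>"

definition tensor_action :: "(('x list \<Rightarrow> int) \<Rightarrow> 'm) \<Rightarrow> 'a \<Rightarrow> 'm \<Rightarrow> 'm" where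
  "tensor_action j g = (\<lambda>a\<in>j ` tensors. j (\<lambda>i\<in>multi_indices. inv_into tensors j a (map (\<tau> g) i)))"

lemma restrict_tensors [simp]: "restrict p multi_indices \<in> tensors"
  by (simp add: tensors_def)

lemma map_multi: "g \<in> carrier G \<Longrightarrow> i \<in> multi_indices \<Longrightarrow> map (\<tau> g) i \<in> multi_indices"
  using permutes_in_image[OF \<tau>_permutes] by (fastforce simp: multi_indices_def)

lemma bij_map_multi:
  assumes "g \<in> carrier G"
  shows "bij_betw (map (\<tau> g)) multi_indices multi_indices"
proof -
  have "finite multi_indices"
    using finite_lists_length_eq[OF finite_X] by (simp add: multi_indices_def)
  moreover have "inj_on (map (\<tau> g)) multi_indices"
    using permutes_inj[OF \<tau>_permutes[OF assms]] by (auto intro: inj_onI simp: inj_map_eq_map)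
  moreover have "map (\<tau> g) ` multi_indices \<subseteq> multi_indices"
    using map_multi[OF assms] by blast
  ultimately show ?thesis unfolding bij_betw_def using endo_inj_surj by blast
qed

lemma countable_tensors: "countable tensors"
proof -
  have "finite multi_indices"
    using finite_lists_length_eq[OF finite_X] by (simp add: multi_indices_def)
  then obtain idx where "set idx = multi_indices" using finite_list by blast
  then have "inj_on (\<lambda>p. map p idx) tensors"
    by (auto simp: inj_on_def tensors_def intro: PiE_ext)
  then show ?thesis by (rule countableI')
qed

context
  fixes j :: "('x list \<Rightarrow> int) \<Rightarrow> 'm"
  assumes j: "inj_on j tensors"
begin

lemma inv_j [simp]: "p \<in> tensors \<Longrightarrow> inv_into tensors j (j p) = p"
  using j by simp

lemma tensor_mult: "p \<in> tensors \<Longrightarrow> q \<in> tensors \<Longrightarrow>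
    j p \<otimes>\<^bsub>tensor_module j\<^esub> j q = j (\<lambda>i\<in>multi_indices. p i + q i)"
  by (simp add: tensor_module_def)

lemma tensor_action: "p \<in> tensors \<Longrightarrow>
    tensor_action j g (j p) = j (\<lambda>i\<in>multi_indices. p (map (\<tau> g) i))"
  by (simp add: tensor_action_def)

lemma tensor_carrier: "carrier (tensor_module j) = j ` tensors"
  by (simp add: tensor_module_def)

lemma tensors_ext: "p \<in> tensors \<Longrightarrow> q \<in> tensors \<Longrightarrow> (\<And>i. i \<in> multi_indices \<Longrightarrow> p i = q i) \<Longrightarrow> p = q"
  unfolding tensors_def by (rule PiE_ext)

lemma tensor_one: "\<one>\<^bsub>tensor_module j\<^esub> = j (\<lambda>i\<in>multi_indices. 0)"
  by (simp add: tensor_module_def)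

lemma tensor_comm_group: "comm_group (tensor_module j)"
proof (rule comm_groupI)
  show "\<one>\<^bsub>tensor_module j\<^esub> \<otimes>\<^bsub>tensor_module j\<^esub> a = a" if "a \<in> carrier (tensor_module j)" for a
    using that by (auto simp: tensor_carrier tensor_one tensor_mult intro!: arg_cong[of _ _ j] tensors_ext)
  show "\<exists>b\<in>carrier (tensor_module j). b \<otimes>\<^bsub>tensor_module j\<^esub> a = \<one>\<^bsub>tensor_module j\<^esub>"
    if a: "a \<in> carrier (tensor_module j)" for a
  proof -
    obtain p where p: "p \<in> tensors" "a = j p" using a by (auto simp: tensor_carrier)
    show ?thesis
      by (rule bexI[of _ "j (\<lambda>i\<in>multi_indices. - p i)"])
        (use p in \<open>auto simp: tensor_carrier tensor_one tensor_mult intro!: arg_cong[of _ _ j]\<close>)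
  qed
qed (auto simp: tensor_carrier tensor_one tensor_mult add_ac cong: restrict_cong
    intro!: arg_cong[of _ _ j] restrict_ext)

lemma tensor_action_closed: "g \<in> carrier G \<Longrightarrow> a \<in> j ` tensors \<Longrightarrow> tensor_action j g a \<in> j ` tensors"
  by (auto simp: tensor_action)

lemma tensor_action_mult:
  assumes "g \<in> carrier G" "h \<in> carrier G" "a \<in> j ` tensors"
  shows "tensor_action j (g \<otimes> h) a = tensor_action j g (tensor_action j h a)"
  using assms by (auto simp: tensor_action \<tau>_mult map_multi intro!: arg_cong[of _ _ j] restrict_ext)

lemma tensor_action_one: "a \<in> j ` tensors \<Longrightarrow> tensor_action j \<one> a = a"
  by (auto simp: tensor_action \<tau>_one intro!: arg_cong[of _ _ j] tensors_ext)

lemma tensor_G_module: "G_module G (tensor_module j) (tensor_action j)"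
  unfolding G_module_def
proof (intro conjI homI)
  show "group G" by (rule is_group)
  show "comm_group (tensor_module j)" by (rule tensor_comm_group)
  have hom: "tensor_action j g \<in> hom (tensor_module j) (tensor_module j)" if "g \<in> carrier G" for g
    using that by (intro homI)
      (auto simp: tensor_carrier tensor_mult tensor_action map_multi intro!: arg_cong[of _ _ j] restrict_ext)
  have bij: "tensor_action j g \<in> Bij (j ` tensors)" if g: "g \<in> carrier G" for g
  proof -
    have "bij_betw (tensor_action j g) (j ` tensors) (j ` tensors)"
    proof (rule bij_betwI[where g = "tensor_action j (inv g)"])
      show "tensor_action j (inv g) (tensor_action j g a) = a" if "a \<in> j ` tensors" for a
        using that g tensor_action_one by (simp add: tensor_action_mult[symmetric])
      show "tensor_action j g (tensor_action j (inv g) a) = a" if "a \<in> j ` tensors" for a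
        using that g tensor_action_one by (simp add: tensor_action_mult[symmetric])
    qed (use g tensor_action_closed in auto)
    then show ?thesis by (simp add: Bij_def tensor_action_def)
  qed
  show "tensor_action j g \<in> carrier (AutoGroup (tensor_module j))" if "g \<in> carrier G" for g
    using hom[OF that] bij[OF that] by (simp add: AutoGroup_def auto_def tensor_carrier)
  show "tensor_action j (g \<otimes> h) = tensor_action j g \<otimes>\<^bsub>AutoGroup (tensor_module j)\<^esub> tensor_action j h"
    if gh: "g \<in> carrier G" "h \<in> carrier G" for g h
  proof
    fix a
    show "tensor_action j (g \<otimes> h) a = (tensor_action j g \<otimes>\<^bsub>AutoGroup (tensor_module j)\<^esub> tensor_action j h) a"
      using tensor_action_mult[OF gh, of a] bij[OF gh(1)] bij[OF gh(2)]
      by (cases "a \<in> j ` tensors")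
        (simp_all add: AutoGroup_def BijGroup_def compose_def tensor_carrier, simp add: tensor_action_def)
  qed
qed

interpretation M: group_module G "tensor_module j" "tensor_action j"
  using tensor_G_module unfolding G_module_def group_module_def group_module_axioms_def by auto

definition top_cochain :: "'a list \<Rightarrow> 'm" where
  "top_cochain = (\<lambda>s\<in>tuples G (card X). j (\<lambda>i\<in>multi_indices. cup (vertices \<one> s) i))"

lemma top_cochain_closed: "top_cochain \<in> carrier (cochain_group G (tensor_module j) (card X))"
  by (auto simp: top_cochain_def M.cochain_carrier tensor_carrier)

lemma cup_vertices:
  assumes "g \<in> carrier G" "s \<in> tuples G n"
  shows "cup (vertices g s) i = cup (vertices \<one> s) (map (\<tau> g) i)"
proof -
  have "set s \<subseteq> carrier G" using assms(2) by (auto simp: tuples_def)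
  then have "map ((\<otimes>) g) (vertices \<one> s) = vertices g s"
    using assms by (simp add: map_vertices)
  moreover have "set (vertices \<one> s) \<subseteq> carrier G"
    using vertices_bar[OF one_closed assms(2)] by (simp add: bar_def)
  ultimately show ?thesis using cup_map[OF assms(1), of "vertices \<one> s" i] by simp
qed

lemma homog_top_cochain:
  assumes "l \<in> bar (Suc (card X))"
  shows "M.homog top_cochain (card X) l = j (\<lambda>i\<in>multi_indices. cup l i)"
proof -
  obtain g s where gs: "g \<in> carrier G" "s \<in> tuples G (card X)" "l = vertices g s"
    using assms by (rule M.bar_tuples)
  then show ?thesis
    by (auto simp: M.homog_vertices top_cochain_def tensor_action map_multi cup_vertices[of g] intro!: arg_cong[of _ _ j])
qed

lemma lin_top_cochain:
  assumes "cells x \<subseteq> bar (Suc (card X))"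
  shows "lin (tensor_module j) (M.homog top_cochain (card X)) x =
    j (\<lambda>i\<in>multi_indices. int_lin (\<lambda>l. cup l i) x)"
proof (rule M.A.multiplicative_eqI)
  note top_cochain_closed [simp]
  show "lin (tensor_module j) (M.homog top_cochain (card X)) (x - y) =
      lin (tensor_module j) (M.homog top_cochain (card X)) x \<otimes>\<^bsub>tensor_module j\<^esub>
      inv\<^bsub>tensor_module j\<^esub> lin (tensor_module j) (M.homog top_cochain (card X)) y" for x y
    by (simp add: M.A.lin_diff)
  fix x y
  let ?F = "\<lambda>x. j (\<lambda>i\<in>multi_indices. int_lin (\<lambda>l. cup l i) x)"
  have F: "?F x \<in> carrier (tensor_module j)" for x by (simp add: tensor_carrier)
  have "?F (x - y) \<otimes>\<^bsub>tensor_module j\<^esub> ?F y = ?F x"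
    by (auto simp: tensor_mult intro!: arg_cong[of _ _ j])
  then show "?F (x - y) = ?F x \<otimes>\<^bsub>tensor_module j\<^esub> inv\<^bsub>tensor_module j\<^esub> ?F y"
    using M.A.inv_solve_right[OF F F F] by metis
next
  fix l assume "l \<in> cells x"
  then show "lin (tensor_module j) (M.homog top_cochain (card X)) (frag_of l) =
      j (\<lambda>i\<in>multi_indices. int_lin (\<lambda>l. cup l i) (frag_of l))"
    using assms homog_top_cochain[of l] top_cochain_closed by (auto simp: M.A.lin_of)
qed (rule M.A.lin_closed, rule M.homog_closed[OF top_cochain_closed],
    unfold tensor_carrier, rule imageI, rule restrict_tensors)

lemma top_cochain_cocycle: "top_cochain \<in> cocycles G (tensor_module j) (tensor_action j) (card X)"
proof -
  have "coboundary G (tensor_module j) (tensor_action j) (card X) top_cochain s = \<one>\<^bsub>tensor_module j\<^esub>"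
    if s: "s \<in> tuples G (Suc (card X))" for s
  proof -
    have b: "vertices \<one> s \<in> bar (Suc (Suc (card X)))" using s vertices_bar by simp
    have "coboundary G (tensor_module j) (tensor_action j) (card X) top_cochain s \<in> carrier (tensor_module j)"
      using M.coboundary_closed[OF top_cochain_closed] s unfolding M.cochain_carrier by (rule PiE_mem)
    then have "coboundary G (tensor_module j) (tensor_action j) (card X) top_cochain s =
        lin (tensor_module j) (M.homog top_cochain (card X)) (face_sum (vertices \<one> s))"
      using M.lin_homog_vertices[OF top_cochain_closed one_closed s] by (simp add: M.\<phi>_one)
    also have "\<dots> = j (\<lambda>i\<in>multi_indices. int_lin (\<lambda>l. cup l i) (face_sum (vertices \<one> s)))"
      by (rule lin_top_cochain[OF cells_face_sum_bar[OF b]])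
    also have "\<dots> = \<one>\<^bsub>tensor_module j\<^esub>"
      using b by (auto simp: tensor_one cup_cocycle bar_def multi_indices_def intro!: arg_cong[of _ _ j])
    finally show ?thesis .
  qed
  then show ?thesis
    using top_cochain_closed
    by (auto simp: cocycles_def kernel_def cochain_group_def coboundary_def fun_eq_iff)
qed

text \<open>
  The evaluation of chains on the top cochain, followed by the invariant inner product of
  tensors.
\<close>

definition pairing :: "('a list \<Rightarrow> 'm) \<Rightarrow> int" where
  "pairing c = gfinprod integer_group
     (\<lambda>s. \<Sum>i\<in>multi_indices. cup (vertices \<one> s) i * inv_into tensors j (c s) i) (tuples G (card X))"

lemma pairing_hom: "pairing \<in> hom (chain_group G (tensor_module j) (card X)) integer_group"
  unfolding pairing_def chain_group_def
  by (rule Z.hom_group_sum[of "tuples G (card X)"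
        "\<lambda>s a. \<Sum>i\<in>multi_indices. cup (vertices \<one> s) i * inv_into tensors j a i" "\<lambda>_. tensor_module j"])
    (auto intro!: homI simp: tensor_carrier tensor_mult sum.distrib distrib_left M.A.is_group)

lemma pairing_single:
  assumes "s \<in> tuples G (card X)" "p \<in> tensors"
  shows "pairing (M.single (card X) s (j p)) = (\<Sum>i\<in>multi_indices. cup (vertices \<one> s) i * p i)"
proof -
  let ?f = "\<lambda>t. \<Sum>i\<in>multi_indices. cup (vertices \<one> t) i * inv_into tensors j (M.single (card X) s (j p) t) i"
  have "gfinprod integer_group ?f (tuples G (card X)) = gfinprod integer_group ?f {s}"
    by (rule Z.gfinprod_mono_neutral_cong_right) (use assms in \<open>auto simp: M.single_def tensor_one\<close>)
  also have "\<dots> = ?f s" by (subst Z.gfinprod_eq_finprod) auto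
  finally show ?thesis using assms by (simp add: pairing_def M.single_def)
qed

lemma pairing_tensor:
  assumes "p \<in> tensors" "cells x \<subseteq> bar (Suc (card X))"
  shows "pairing (M.tensor_lin (card X) (j p) x) = (\<Sum>i\<in>multi_indices. int_lin (\<lambda>l. cup l i) x * p i)"
proof -
  have jp: "j p \<in> carrier (tensor_module j)" using assms(1) by (simp add: tensor_carrier)
  have "pairing (M.tensor_lin (card X) (j p) x) = int_lin (\<lambda>l. pairing (M.tensor (card X) (j p) l)) x"
    by (rule M.chain.lin_hom_compose[OF Z.comm_group_axioms pairing_hom M.tensor_closed[OF jp]])
  also have "\<dots> = (\<Sum>i\<in>multi_indices. int_lin (\<lambda>l. cup l i) x * p i)"
  proof (rule additive_eqI)
    fix l assume "l \<in> cells x"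
    then have "l \<in> bar (Suc (card X))" using assms(2) by auto
    then obtain g s where gs: "g \<in> carrier G" "s \<in> tuples G (card X)" "l = vertices g s"
      by (rule M.bar_tuples)
    have "pairing (M.tensor (card X) (j p) l) = (\<Sum>i\<in>multi_indices. cup (vertices \<one> s) i * p (map (\<tau> (inv g)) i))"
      using gs assms(1) by (simp add: M.tensor_vertices tensor_action pairing_single)
    also have "\<dots> = (\<Sum>i\<in>multi_indices. cup (vertices \<one> s) (map (\<tau> g) i) * p (map (\<tau> (inv g)) (map (\<tau> g) i)))"
      by (rule sum.reindex_bij_betw[OF bij_map_multi[OF gs(1)], symmetric])
    also have "\<dots> = (\<Sum>i\<in>multi_indices. cup l i * p i)"
      using \<tau>_inv[OF gs(1)] gs by (simp add: cup_vertices[OF gs(1,2)])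
    finally show "int_lin (\<lambda>l. pairing (M.tensor (card X) (j p) l)) (frag_of l) =
        (\<Sum>i\<in>multi_indices. int_lin (\<lambda>l. cup l i) (frag_of l) * p i)" by simp
  qed (auto simp: left_diff_distrib sum_subtractf)
  finally show ?thesis .
qed

text \<open>
  Among the coordinates of the cup product, the one whose indices are the elements of
  \<open>X\<close> in the order used for the torus detects it. For homology, the coefficient of the torus is the basis tensor with this index.
\<close>

lemma top_degree_nonzero:
  assumes "X \<noteq> {}"
  shows "\<not> trivial_cohomology G (tensor_module j) (tensor_action j) (card X)"
    and "\<not> trivial_homology G (tensor_module j) (tensor_action j) (card X)"
proof -
  obtain xs where xs: "set xs = X" "distinct xs" using finite_distinct_list[OF finite_X] by blast
  then have len: "length xs = card X" using distinct_card by fastforce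
  obtain m where m: "card X = Suc m" using assms finite_X by (metis card_eq_0_iff not0_implies_Suc)
  have "\<exists>t N. t \<in> shifts \<and> N \<noteq> 0 \<and> v t = (\<lambda>y. if y = x then N else 0)" if "x \<in> X" for x
    using translation_exists[OF that] by metis
  then obtain T N where T: "\<And>x. x \<in> X \<Longrightarrow> T x \<in> shifts" "\<And>x. x \<in> X \<Longrightarrow> N x \<noteq> 0"
      "\<And>x. x \<in> X \<Longrightarrow> v (T x) = (\<lambda>y. if y = x then N x else 0)"
    by metis
  define z where "z = torus T xs"
  have z: "cells z \<subseteq> bar (Suc (card X))"
    unfolding z_def using cells_torus[of xs T] T xs(1) len by (fastforce simp: bar_def shifts_def)
  have "bd z \<in> null shifts (length xs)"
    unfolding z_def by (rule bd_torus) (use T xs assms in auto)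
  then have bdz: "bd z \<in> null shifts (card X)" by (simp add: len)
  have "int_lin (\<lambda>l. cup l xs) z = (\<Prod>x\<leftarrow>xs. N x)"
    unfolding z_def by (rule cup_torus) (use T xs in auto)
  moreover have "(\<Prod>x\<leftarrow>xs. N x) \<noteq> 0" using T(2) xs(1) by (auto simp: prod_list_zero_iff)
  ultimately have nz: "int_lin (\<lambda>l. cup l xs) z \<noteq> 0" by simp
  have xsI: "xs \<in> multi_indices" using xs len by (simp add: multi_indices_def)
  have fin: "finite multi_indices"
    using finite_lists_length_eq[OF finite_X] by (simp add: multi_indices_def)
  have K: "shifts \<subseteq> carrier G" by (auto simp: shifts_def)
  have act: "tensor_action j k a = a" if "k \<in> shifts" "a \<in> carrier (tensor_module j)" for k a
    using that by (auto simp: shifts_def tensor_carrier tensor_action intro!: arg_cong[of _ _ j] tensors_ext)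
  show "\<not> trivial_cohomology G (tensor_module j) (tensor_action j) (card X)"
    unfolding m
  proof (rule M.cohomology_nonzero[OF top_cochain_cocycle[unfolded m] K act z[unfolded m] bdz[unfolded m]])
    have "j (\<lambda>i\<in>multi_indices. int_lin (\<lambda>l. cup l i) z) \<noteq> j (\<lambda>i\<in>multi_indices. 0)"
    proof
      assume "j (\<lambda>i\<in>multi_indices. int_lin (\<lambda>l. cup l i) z) = j (\<lambda>i\<in>multi_indices. 0)"
      then have "(\<lambda>i\<in>multi_indices. int_lin (\<lambda>l. cup l i) z) = (\<lambda>i\<in>multi_indices. 0)"
        by (rule inj_onD[OF j]) simp_all
      from fun_cong[OF this, of xs] show False using nz xsI by simp
    qed
    then show "lin (tensor_module j) (M.homog top_cochain (Suc m)) z \<noteq> \<one>\<^bsub>tensor_module j\<^esub>"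
      using lin_top_cochain[OF z] by (simp add: tensor_one m)
  qed
  define p where "p = (\<lambda>i\<in>multi_indices. if i = xs then 1 else 0 :: int)"
  have p: "p \<in> tensors" by (simp add: p_def)
  show "\<not> trivial_homology G (tensor_module j) (tensor_action j) (card X)"
    unfolding m
  proof (rule M.homology_nonzero[OF _ K act z[unfolded m] bdz[unfolded m] Z.comm_group_axioms pairing_hom[unfolded m]])
    show "j p \<in> carrier (tensor_module j)" using p by (simp add: tensor_carrier)
    show "pairing (M.tensor_lin (Suc m) b (face_sum l)) = \<one>\<^bsub>integer_group\<^esub>"
      if b: "b \<in> carrier (tensor_module j)" and l: "l \<in> bar (Suc (Suc (Suc m)))" for b l
    proof -
      obtain q where q: "q \<in> tensors" "b = j q" using b by (auto simp: tensor_carrier)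
      have "cells (face_sum l) \<subseteq> bar (Suc (card X))" using cells_face_sum_bar l m by simp
      then show ?thesis
        using pairing_tensor[OF q(1)] l q(2) by (auto simp: m cup_cocycle bar_def multi_indices_def)
    qed
    have "pairing (M.tensor_lin (card X) (j p) z) = (\<Sum>i\<in>multi_indices. if i = xs then int_lin (\<lambda>l. cup l xs) z else 0)"
      unfolding pairing_tensor[OF p z] by (rule sum.cong) (auto simp: p_def)
    then show "pairing (M.tensor_lin (Suc m) (j p) z) \<noteq> \<one>\<^bsub>integer_group\<^esub>"
      using nz xsI fin by (simp add: m)
  qed
qed

end

lemma embed_tensors: "\<exists>j :: ('x list \<Rightarrow> int) \<Rightarrow> 'm::infinite. inj_on j tensors"
proof -
  obtain f :: "nat \<Rightarrow> 'm" where "inj f"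
    using infinite_countable_subset[OF infinite_UNIV] by blast
  then have "inj_on (f \<circ> to_nat_on tensors) tensors"
    using inj_on_to_nat_on[OF countable_tensors] by (auto intro: comp_inj_on inj_on_subset)
  then show ?thesis by blast
qed

theorem dimension:
  assumes "X \<noteq> {}"
  shows "cohomological_dimension TYPE('m::infinite) G = enat (card X)"
    and "homological_dimension TYPE('m::infinite) G = enat (card X)"
proof -
  have vanish: "trivial_cohomology G A \<phi> n"
    "trivial_homology G A \<phi> n"
    if "n > card X" "G_module G A \<phi>" for n \<phi> and A :: "'m monoid"
  proof -
    interpret M: group_module G A \<phi>
      using that(2) unfolding G_module_def group_module_def group_module_axioms_def by auto
    obtain m where m: "n = Suc m" using \<open>n > card X\<close> by (metis Suc_pred gr_zeroI not_less0)
    show "trivial_cohomology G A \<phi> n"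
      "trivial_homology G A \<phi> n"
      using contraction_homotopy[OF that(1)] unfolding m
      by (rule M.cohomology_vanishes, rule M.homology_vanishes)
  qed
  obtain j :: "('x list \<Rightarrow> int) \<Rightarrow> 'm" where j: "inj_on j tensors" using embed_tensors by blast
  show "cohomological_dimension TYPE('m) G = enat (card X)"
    unfolding cohomological_dimension_def
  proof (rule antisym)
    show "Sup {enat n |n. \<exists>(A :: 'm monoid) \<phi>. G_module G A \<phi> \<and>
       \<not> trivial_cohomology G A \<phi> n} \<le> enat (card X)"
      using vanish(1) by (intro Sup_least) (auto simp: not_less[symmetric])
    show "enat (card X) \<le> Sup {enat n |n. \<exists>(A :: 'm monoid) \<phi>. G_module G A \<phi> \<and>
       \<not> trivial_cohomology G A \<phi> n}"
      using tensor_G_module[OF j] top_degree_nonzero(1)[OF j assms] by (intro Sup_upper) blast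
  qed
  show "homological_dimension TYPE('m) G = enat (card X)"
    unfolding homological_dimension_def
  proof (rule antisym)
    show "Sup {enat n |n. \<exists>(A :: 'm monoid) \<phi>. G_module G A \<phi> \<and>
       \<not> trivial_homology G A \<phi> n} \<le> enat (card X)"
      using vanish(2) by (intro Sup_least) (auto simp: not_less[symmetric])
    show "enat (card X) \<le> Sup {enat n |n. \<exists>(A :: 'm monoid) \<phi>. G_module G A \<phi> \<and>
       \<not> trivial_homology G A \<phi> n}"
      using tensor_G_module[OF j] top_degree_nonzero(2)[OF j assms] by (intro Sup_upper) blast
  qed
qed

end

section \<open>Monoids that are positive orthants\<close>

text \<open>
  The abstract form of the structure monoid, with the same conventions as for \<open>lattice_cocycle\<close>.
\<close>

locale lattice_monoid = monoid M for M (structure) +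
  fixes X :: "'x set" and v :: "'a \<Rightarrow> 'x \<Rightarrow> int" and \<tau> :: "'a \<Rightarrow> 'x \<Rightarrow> 'x"
  assumes finite_X: "finite X"
    and v_bij: "bij_betw v (carrier M) {u. (\<forall>x. 0 \<le> u x) \<and> (\<forall>x. x \<notin> X \<longrightarrow> u x = 0)}"
    and \<tau>_permutes: "a \<in> carrier M \<Longrightarrow> \<tau> a permutes X"
    and v_mult: "a \<in> carrier M \<Longrightarrow> b \<in> carrier M \<Longrightarrow> v (a \<otimes> b) = (\<lambda>x. v a x + v b (\<tau> a x))"
    and \<tau>_mult: "a \<in> carrier M \<Longrightarrow> b \<in> carrier M \<Longrightarrow> \<tau> (a \<otimes> b) = \<tau> b \<circ> \<tau> a"
begin

lemma v_nonneg: "a \<in> carrier M \<Longrightarrow> 0 \<le> v a x"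
  using v_bij by (auto simp: bij_betw_def)

lemma v_outside: "a \<in> carrier M \<Longrightarrow> x \<notin> X \<Longrightarrow> v a x = 0"
  using v_bij by (auto simp: bij_betw_def)

lemma v_inj: "a \<in> carrier M \<Longrightarrow> b \<in> carrier M \<Longrightarrow> (\<And>x. v a x = v b x) \<Longrightarrow> a = b"
  using v_bij by (auto simp: bij_betw_def inj_on_def fun_eq_iff)

lemma v_surj:
  assumes "\<And>x. 0 \<le> u x" "\<And>x. x \<notin> X \<Longrightarrow> u x = 0"
  obtains a where "a \<in> carrier M" "v a = u"
proof -
  have "u \<in> v ` carrier M" using assms v_bij by (simp add: bij_betw_def)
  then show ?thesis using that by blast
qed

text \<open>
  The quotient of \<open>b\<close> by \<open>a\<close> has the vector \<open>v b - v a\<close>, moved back by the permutation of \<open>a\<close>. Consequently left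
  gcds and right lcms are pointwise minima and maxima.
\<close>

lemma divides_iff:
  assumes "a \<in> carrier M" "b \<in> carrier M"
  shows "a divides b \<longleftrightarrow> (\<forall>x. v a x \<le> v b x)"
proof
  assume "a divides b"
  then show "\<forall>x. v a x \<le> v b x" using assms v_nonneg by (auto simp: factor_def v_mult)
next
  assume le: "\<forall>x. v a x \<le> v b x"
  have p: "\<tau> a permutes X" using assms(1) by (rule \<tau>_permutes)
  obtain c where c: "c \<in> carrier M" "v c = (\<lambda>x. v b (inv_into UNIV (\<tau> a) x) - v a (inv_into UNIV (\<tau> a) x))"
  proof (rule v_surj)
    show "0 \<le> v b (inv_into UNIV (\<tau> a) x) - v a (inv_into UNIV (\<tau> a) x)" for x using le by simp
    show "v b (inv_into UNIV (\<tau> a) x) - v a (inv_into UNIV (\<tau> a) x) = 0" if "x \<notin> X" for x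
      using that p assms v_outside permutes_not_in[OF permutes_inv[OF p]] by simp
  qed
  have "b = a \<otimes> c"
    by (rule v_inj) (use assms c p in \<open>auto simp: v_mult permutes_inverses\<close>)
  then show "a divides b" using c by (auto simp: factor_def)
qed

lemma left_cancel:
  assumes "c \<otimes> a = c \<otimes> b" "a \<in> carrier M" "b \<in> carrier M" "c \<in> carrier M"
  shows "a = b"
proof (rule v_inj)
  fix x
  obtain y where "x = \<tau> c y" using permutes_surj[OF \<tau>_permutes[OF assms(4)]] by (metis surjD)
  moreover have "v (c \<otimes> a) y = v (c \<otimes> b) y" by (simp only: assms(1))
  ultimately show "v a x = v b x" using assms(2-) by (simp add: v_mult)
qed fact+

lemma v_one: "v \<one> = (\<lambda>x. 0)" and \<tau>_one: "\<tau> \<one> = id"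
proof -
  have "\<tau> \<one> = \<tau> \<one> \<circ> \<tau> \<one>" using \<tau>_mult[of \<one> \<one>] by simp
  moreover have "inj (\<tau> \<one>)" using \<tau>_permutes permutes_inj by blast
  ultimately show t: "\<tau> \<one> = id" by (metis comp_apply eq_id_iff injD)
  show "v \<one> = (\<lambda>x. 0)"
    using v_mult[of \<one> \<one>] by (auto simp: t fun_eq_iff)
qed

lemma isgcd_exists:
  assumes "a \<in> carrier M" "b \<in> carrier M"
  shows "\<exists>d\<in>carrier M. d gcdof a b"
proof -
  obtain d where d: "d \<in> carrier M" "v d = (\<lambda>x. min (v a x) (v b x))"
    by (rule v_surj[of "\<lambda>x. min (v a x) (v b x)"]) (use assms v_nonneg v_outside in auto)
  show ?thesis using d assms by (intro bexI[of _ d]) (auto simp: isgcd_def divides_iff)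
qed

lemma islcm_exists:
  assumes "a \<in> carrier M" "b \<in> carrier M"
  shows "\<exists>m\<in>carrier M. m lcmof a b"
proof -
  obtain m where m: "m \<in> carrier M" "v m = (\<lambda>x. max (v a x) (v b x))"
    by (rule v_surj[of "\<lambda>x. max (v a x) (v b x)"]) (use assms v_nonneg v_outside in \<open>auto simp: le_max_iff_disj\<close>)
  show ?thesis using m assms by (intro bexI[of _ m]) (auto simp: islcm_def divides_iff)
qed

lemma is_right_lcm_unique:
  assumes "A \<subseteq> carrier M" "is_right_lcm M A m" "is_right_lcm M A m'"
  shows "m = m'"
proof (rule v_inj)
  show m: "m \<in> carrier M" "m' \<in> carrier M" using assms by (auto simp: is_right_lcm_def)
  have "m divides m'" "m' divides m" using assms by (auto simp: is_right_lcm_def)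
  then show "v m x = v m' x" for x using m by (auto simp: divides_iff intro: antisym)
qed

lemma right_lcm_eq: "A \<subseteq> carrier M \<Longrightarrow> is_right_lcm M A m \<Longrightarrow> right_lcm M A = m"
  unfolding right_lcm_def using is_right_lcm_unique by blast

definition gen :: "'x \<Rightarrow> 'a" where
  "gen x = inv_into (carrier M) v (\<lambda>y. if y = x then 1 else 0)"

lemma gen:
  assumes "x \<in> X"
  shows "gen x \<in> carrier M" "v (gen x) = (\<lambda>y. if y = x then 1 else 0)"
proof -
  have "(\<lambda>y. if y = x then 1 else 0) \<in> v ` carrier M"
    using assms v_bij by (auto simp: bij_betw_def)
  then show "gen x \<in> carrier M" "v (gen x) = (\<lambda>y. if y = x then 1 else 0)"
    unfolding gen_def by (rule inv_into_into, rule f_inv_into_f)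
qed

lemma gen_eq: "a \<in> carrier M \<Longrightarrow> x \<in> X \<Longrightarrow> v a = (\<lambda>y. if y = x then 1 else 0) \<Longrightarrow> a = gen x"
  by (rule v_inj) (auto simp: gen)

definition deg :: "'a \<Rightarrow> int" where
  "deg a = (\<Sum>x\<in>X. v a x)"

lemma deg_mult:
  assumes "a \<in> carrier M" "b \<in> carrier M"
  shows "deg (a \<otimes> b) = deg a + deg b"
proof -
  have "(\<Sum>x\<in>X. v b (\<tau> a x)) = (\<Sum>x\<in>X. v b x)"
    using sum.permute[OF \<tau>_permutes[OF assms(1)], of "v b"] by (simp add: comp_def)
  then show ?thesis using assms by (simp add: deg_def v_mult sum.distrib)
qed

lemma deg_nonneg: "a \<in> carrier M \<Longrightarrow> 0 \<le> deg a"
  by (simp add: deg_def v_nonneg sum_nonneg)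

lemma deg_eq_0: "a \<in> carrier M \<Longrightarrow> deg a = 0 \<longleftrightarrow> a = \<one>"
proof
  assume a: "a \<in> carrier M" and "deg a = 0"
  then have "\<forall>x\<in>X. v a x = 0"
    using sum_nonneg_eq_0_iff[OF finite_X, of "v a"] by (simp add: deg_def v_nonneg)
  then show "a = \<one>" using a v_outside by (intro v_inj) (auto simp: v_one)
qed (simp add: deg_def v_one)

lemma deg_gen: "x \<in> X \<Longrightarrow> deg (gen x) = 1"
  using finite_X by (simp add: deg_def gen)

lemma factor_gen:
  assumes "a \<in> carrier M" "a \<noteq> \<one>"
  obtains x b where "x \<in> X" "b \<in> carrier M" "a = gen x \<otimes> b"
proof -
  obtain x where x: "v a x \<noteq> 0" using assms v_inj[of a \<one>] by (auto simp: v_one)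
  then have xX: "x \<in> X" using v_outside assms(1) by blast
  have "1 \<le> v a x" using v_nonneg[OF assms(1), of x] x by linarith
  then have "gen x divides a"
    using assms(1) xX by (simp add: divides_iff gen v_nonneg)
  then show ?thesis using that xX by (auto simp: factor_def)
qed

lemma gen_induct [consumes 1, case_names one gen]:
  assumes "a \<in> carrier M"
    and "P \<one>" "\<And>x b. x \<in> X \<Longrightarrow> b \<in> carrier M \<Longrightarrow> P b \<Longrightarrow> P (gen x \<otimes> b)"
  shows "P a"
  using assms(1)
proof (induction "nat (deg a)" arbitrary: a rule: less_induct)
  case less
  show ?case
  proof (cases "a = \<one>")
    case False
    then obtain x b where xb: "x \<in> X" "b \<in> carrier M" "a = gen x \<otimes> b"
      using factor_gen less.prems by blast
    then have "nat (deg b) < nat (deg a)"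
      using deg_mult[of "gen x" b] deg_gen[of x] gen(1)[of x] deg_nonneg[of b] by simp
    then show ?thesis using less.hyps xb assms(3) by simp
  qed (use assms(2) in simp)
qed

lemma word_product_closed: "set w \<subseteq> carrier M \<Longrightarrow> word_product M w \<in> carrier M"
  by (induction w) (auto simp: word_product_def)

lemma generates_monoidI:
  assumes "gen ` X \<subseteq> A" "A \<subseteq> carrier M"
  shows "generates_monoid M A"
proof -
  have "\<exists>w\<in>lists A. word_product M w = a" if "a \<in> carrier M" for a
    using that
  proof (induction a rule: gen_induct)
    case one
    show ?case by (rule bexI[of _ "[]"]) (auto simp: word_product_def)
  next
    case (gen x b)
    then obtain w where "w \<in> lists A" "word_product M w = b" by blast
    then show ?case using gen(1) assms(1)
      by (intro bexI[of _ "gen x # w"]) (auto simp: word_product_def)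
  qed
  moreover have "word_product M w \<in> carrier M" if "w \<in> lists A" for w
    using that assms(2) by (intro word_product_closed) auto
  ultimately show ?thesis unfolding generates_monoid_def using assms(2) by blast
qed

lemma gen_atom: "x \<in> X \<Longrightarrow> gen x \<in> atoms M"
proof -
  assume x: "x \<in> X"
  have "b = \<one> \<or> c = \<one>" if "b \<in> carrier M" "c \<in> carrier M" "gen x = b \<otimes> c" for b c
  proof -
    have "deg b + deg c = 1" using deg_mult that deg_gen[OF x] by metis
    then have "deg b = 0 \<or> deg c = 0" using deg_nonneg that by (smt (verit))
    then show ?thesis using that deg_eq_0 by blast
  qed
  moreover have "gen x \<noteq> \<one>" using deg_gen[OF x] deg_eq_0[of \<one>] by auto
  ultimately show ?thesis using gen(1)[OF x] by (auto simp: atoms_def)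
qed

lemma atomic_monoid: "atomic_monoid M"
proof -
  have at: "atoms M \<subseteq> carrier M" by (auto simp: atoms_def)
  have len: "int (length w) \<le> deg (word_product M w)" if "w \<in> lists (atoms M)" for w
    using that
  proof (induction w)
    case (Cons a w)
    then have aw: "a \<in> carrier M" "a \<noteq> \<one>" "word_product M w \<in> carrier M"
      using at by (auto simp: atoms_def intro!: word_product_closed)
    then have "deg a \<ge> 1" using deg_nonneg[of a] deg_eq_0[of a] by linarith
    then show ?case using Cons deg_mult[OF aw(1,3)] by (simp add: word_product_def)
  qed (simp add: word_product_def deg_nonneg)
  have "\<exists>N. \<forall>w\<in>lists (atoms M). word_product M w = a \<longrightarrow> length w \<le> N" for a
    using len by (intro exI[of _ "nat (deg a)"]) fastforce
  then show ?thesis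
    unfolding atomic_monoid_def using generates_monoidI[of "atoms M"] gen_atom at monoid_axioms by blast
qed

lemma complement_gen:
  assumes "b \<in> carrier M" "x \<in> X"
  shows "right_complement M b (gen x) = (if v b x = 0 then gen (\<tau> b x) else \<one>)"
proof -
  define c where "c = (if v b x = 0 then gen (\<tau> b x) else \<one>)"
  have t: "\<tau> b x \<in> X" using assms permutes_in_image[OF \<tau>_permutes] by blast
  have c: "c \<in> carrier M" using t by (simp add: c_def gen)
  have inj: "\<tau> b y = \<tau> b x \<longleftrightarrow> y = x" for y
    using permutes_inj[OF \<tau>_permutes[OF assms(1)]] by (auto dest: injD)
  have vbc: "v (b \<otimes> c) y = max (v b y) (v (gen x) y)" for y
    using assms c t v_nonneg[OF assms(1), of y] inj[of y]
    by (auto simp: v_mult c_def gen v_one)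
  have "is_right_lcm M {b, gen x} (b \<otimes> c)"
    unfolding is_right_lcm_def using assms c gen(1)[OF assms(2)]
    by (auto simp: divides_iff vbc)
  then have lcm: "right_lcm M {b, gen x} = b \<otimes> c"
    using assms gen(1) by (intro right_lcm_eq) auto
  show ?thesis
    unfolding right_complement_def lcm c_def[symmetric]
    using c assms left_cancel by (intro the_equality) blast+
qed

text \<open>
  The generators that occur as right complements of \<open>x\<close>; see \<open>complements_gen\<close>.
\<close>

definition complement_gens :: "'x \<Rightarrow> 'x set" where
  "complement_gens x = {\<tau> b x |b. b \<in> carrier M \<and> v b x = 0}"

lemma complement_gens_subset: "x \<in> X \<Longrightarrow> complement_gens x \<subseteq> X"
  using permutes_in_image[OF \<tau>_permutes] by (auto simp: complement_gens_def)

lemma complements_gen: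
  assumes "x \<in> X"
  shows "complements M (gen x) = insert \<one> (gen ` complement_gens x)"
proof -
  have "right_complement M (gen x) (gen x) = \<one>"
    using complement_gen[OF gen(1)[OF assms] assms] by (simp add: gen assms)
  then have "\<one> \<in> complements M (gen x)"
    unfolding complements_def using gen(1)[OF assms] by force
  moreover have "complements M (gen x) = (\<lambda>b. if v b x = 0 then gen (\<tau> b x) else \<one>) ` carrier M"
    unfolding complements_def Setcompr_eq_image
    by (rule image_cong) (use complement_gen[OF _ assms] in auto)
  moreover have "(\<lambda>b. if v b x = 0 then gen (\<tau> b x) else \<one>) ` carrier M - {\<one>} \<subseteq> gen ` complement_gens x"
    "gen ` complement_gens x \<subseteq> (\<lambda>b. if v b x = 0 then gen (\<tau> b x) else \<one>) ` carrier M"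
    by (auto simp: complement_gens_def split: if_splits)
  ultimately show ?thesis by blast
qed

lemma lcm_complements:
  assumes "x \<in> X" "m \<in> carrier M"
  shows "is_right_lcm M (complements M (gen x)) m \<longleftrightarrow>
    (\<forall>y. v m y = (if y \<in> complement_gens x then 1 else 0))"
proof -
  let ?C = "complement_gens x"
  have C: "?C \<subseteq> X" by (rule complement_gens_subset[OF assms(1)])
  have dv: "(\<forall>a\<in>complements M (gen x). a divides w) \<longleftrightarrow> (\<forall>y. (if y \<in> ?C then 1 else 0) \<le> v w y)"
    if w: "w \<in> carrier M" for w
  proof -
    have "gen y divides w \<longleftrightarrow> 1 \<le> v w y" if "y \<in> ?C" for y
    proof -
      have "y \<in> X" using that C by blast
      then show ?thesis using w v_nonneg[OF w] by (auto simp: divides_iff gen)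
    qed
    moreover have "\<one> divides w" using w v_nonneg[OF w] by (simp add: divides_iff v_one)
    ultimately show ?thesis
      using v_nonneg[OF w] by (auto simp: complements_gen[OF assms(1)])
  qed
  obtain m0 where m0: "m0 \<in> carrier M" "v m0 = (\<lambda>y. if y \<in> ?C then 1 else 0)"
    by (rule v_surj[of "\<lambda>y. if y \<in> ?C then 1 else 0"]) (use C in auto)
  have "is_right_lcm M (complements M (gen x)) m \<longleftrightarrow>
      (\<forall>y. (if y \<in> ?C then 1 else 0) \<le> v m y) \<and>
      (\<forall>w\<in>carrier M. (\<forall>y. (if y \<in> ?C then 1 else 0) \<le> v w y) \<longrightarrow> (\<forall>y. v m y \<le> v w y))"
    using assms(2) dv unfolding is_right_lcm_def by (simp add: divides_iff)
  also have "\<dots> \<longleftrightarrow> (\<forall>y. v m y = (if y \<in> ?C then 1 else 0))"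
  proof (intro iffI conjI ballI impI)
    assume "(\<forall>y. (if y \<in> ?C then 1 else 0) \<le> v m y) \<and>
      (\<forall>w\<in>carrier M. (\<forall>y. (if y \<in> ?C then 1 else 0) \<le> v w y) \<longrightarrow> (\<forall>y. v m y \<le> v w y))"
    then have 1: "\<forall>y. (if y \<in> ?C then 1 else 0) \<le> v m y"
      and "(\<forall>y. (if y \<in> ?C then 1 else 0) \<le> v m0 y) \<longrightarrow> (\<forall>y. v m y \<le> v m0 y)" using m0(1) by auto
    then have "\<forall>y. v m y \<le> v m0 y" using m0(2) by simp
    with 1 show "\<forall>y. v m y = (if y \<in> ?C then 1 else 0)"
      using m0(2) by (metis antisym)
  qed auto
  finally show ?thesis .
qed

lemma Delta_of_gen:
  assumes "x \<in> X"
  shows "\<exists>!m. is_right_lcm M (complements M (gen x)) m"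
    and "Delta_of M (gen x) \<in> carrier M"
    and "v (Delta_of M (gen x)) = (\<lambda>y. if y \<in> complement_gens x then 1 else 0)"
proof -
  have C: "complements M (gen x) \<subseteq> carrier M"
    using complement_gens_subset[OF assms] gen(1) by (auto simp: complements_gen[OF assms])
  obtain m where m: "m \<in> carrier M" "v m = (\<lambda>y. if y \<in> complement_gens x then 1 else 0)"
    by (rule v_surj[of "\<lambda>y. if y \<in> complement_gens x then 1 else 0"])
      (use complement_gens_subset[OF assms] in auto)
  then have lcm: "is_right_lcm M (complements M (gen x)) m" by (simp add: lcm_complements assms)
  then show "\<exists>!m. is_right_lcm M (complements M (gen x)) m"
    using is_right_lcm_unique[OF C] by blast
  have "Delta_of M (gen x) = m" unfolding Delta_of_def by (rule right_lcm_eq[OF C lcm])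
  then show "Delta_of M (gen x) \<in> carrier M"
    "v (Delta_of M (gen x)) = (\<lambda>y. if y \<in> complement_gens x then 1 else 0)"
    using m by auto
qed

lemma Delta_pure_iff:
  "Delta_pure M (gen ` X) \<longleftrightarrow> (\<forall>x\<in>X. \<forall>y\<in>X. complement_gens x = complement_gens y)"
proof -
  have "Delta_of M (gen x) = Delta_of M (gen y) \<longleftrightarrow> complement_gens x = complement_gens y"
    if xy: "x \<in> X" "y \<in> X" for x y
  proof
    assume "Delta_of M (gen x) = Delta_of M (gen y)"
    then have "v (Delta_of M (gen x)) z = v (Delta_of M (gen y)) z" for z by simp
    then have "z \<in> complement_gens x \<longleftrightarrow> z \<in> complement_gens y" for z
      unfolding Delta_of_gen(3)[OF xy(1)] Delta_of_gen(3)[OF xy(2)] by (metis zero_neq_one)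
    then show "complement_gens x = complement_gens y" by blast
  next
    assume "complement_gens x = complement_gens y"
    then show "Delta_of M (gen x) = Delta_of M (gen y)"
      using Delta_of_gen(2,3) xy by (intro v_inj) auto
  qed
  then show ?thesis unfolding Delta_pure_def using Delta_of_gen(1) by auto
qed

lemma complement_gens_self: "x \<in> complement_gens x"
  unfolding complement_gens_def by (rule CollectI, rule exI[of _ \<one>]) (simp add: v_one \<tau>_one)

text \<open>
  From a generator \<open>y\<close> obtained by means of \<open>b\<close>, all generators \<open>z \<noteq> y\<close> may be appended to
  \<open>b\<close> without making \<open>x\<close> a divisor. The excluded case \<open>z = y\<close> is why the set is not obviously an orbit.
\<close>

lemma complement_gens_step:
  assumes "y \<in> complement_gens x" "z \<in> X" "z \<noteq> y"
  shows "\<tau> (gen z) y \<in> complement_gens x"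
proof -
  obtain b where b: "b \<in> carrier M" "v b x = 0" "y = \<tau> b x"
    using assms(1) by (auto simp: complement_gens_def)
  have "v (b \<otimes> gen z) x = 0" "\<tau> (b \<otimes> gen z) x = \<tau> (gen z) y"
    using b assms by (auto simp: v_mult \<tau>_mult gen)
  then show ?thesis
    unfolding complement_gens_def using b(1) gen(1)[OF assms(2)]
    by (intro CollectI exI[of _ "b \<otimes> gen z"]) auto
qed

lemma complement_gens_invariant:
  assumes "x \<in> Y" "\<And>z y. z \<in> X \<Longrightarrow> y \<in> Y \<Longrightarrow> \<tau> (gen z) y \<in> Y"
  shows "complement_gens x \<subseteq> Y"
proof -
  have "\<forall>y\<in>Y. \<tau> b y \<in> Y" if "b \<in> carrier M" for b
    using that by (induction b rule: gen_induct) (use assms(2) in \<open>auto simp: \<tau>_one \<tau>_mult gen\<close>)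
  then show ?thesis using assms(1) by (auto simp: complement_gens_def)
qed

end

text \<open>
  Right divisibility in \<open>M\<close> is left divisibility in the opposite monoid, so a second cocycle there transfers
  all statements to the right side; in particular right cancellation is left cancellation of the opposite.
\<close>

locale bilattice_monoid = lattice_monoid M X v \<tau> + right: lattice_monoid "opposite M" X v' \<tau>'
  for M :: "('a, 'b) monoid_scheme" (structure) and X :: "'x set" and v \<tau> v' \<tau>'
begin

lemma opposite_simps [simp]: "carrier (opposite M) = carrier M" "a \<otimes>\<^bsub>opposite M\<^esub> b = b \<otimes> a"
  by (simp_all add: opposite_def)

lemma cancel: "monoid_cancel M"
proof
  show "a = b" if "c \<otimes> a = c \<otimes> b" "a \<in> carrier M" "b \<in> carrier M" "c \<in> carrier M" for a b c
    using left_cancel that by blast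
  show "a = b" if "a \<otimes> c = b \<otimes> c" "a \<in> carrier M" "b \<in> carrier M" "c \<in> carrier M" for a b c
    using right.left_cancel[of c a b] that by simp
qed

lemma gaussian: "gaussian_monoid M"
  unfolding gaussian_monoid_def
  using atomic_monoid cancel isgcd_exists islcm_exists right.isgcd_exists right.islcm_exists by simp

text \<open>
  Write \<open>\<Delta>\<close> for the element with vector constantly \<open>1\<close>. If \<open>\<Delta> = a b\<close>, the vector of \<open>b\<close> is a permuted part of that of \<open>\<Delta>\<close>, so
  right divisors are left divisors; and \<open>a \<mapsto> b\<close> injects the finite set of left divisors into the set of right divisors.
\<close>

lemma garside_element_lcm:
  shows "\<exists>!\<Delta>. is_right_lcm M (gen ` X) \<Delta>" "garside_element M (right_lcm M (gen ` X))"
proof -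
  have gX: "gen ` X \<subseteq> carrier M" using gen(1) by auto
  obtain \<Delta> where \<Delta>: "\<Delta> \<in> carrier M" "v \<Delta> = (\<lambda>x. if x \<in> X then 1 else 0)"
    by (rule v_surj[of "\<lambda>x. if x \<in> X then 1 else 0"]) auto
  have gd: "gen x divides w \<longleftrightarrow> 1 \<le> v w x" if "x \<in> X" "w \<in> carrier M" for x w
    using that v_nonneg[OF that(2)] by (auto simp: divides_iff gen)
  have lcm: "is_right_lcm M (gen ` X) \<Delta>"
    unfolding is_right_lcm_def using \<Delta> gd v_nonneg by (auto simp: divides_iff)
  then show "\<exists>!\<Delta>. is_right_lcm M (gen ` X) \<Delta>" using is_right_lcm_unique[OF gX] by blast
  have ld: "left_divisors M \<Delta> = {a \<in> carrier M. \<forall>x. v a x \<le> 1}"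
  proof -
    have "a divides \<Delta> \<longleftrightarrow> (\<forall>x. v a x \<le> 1)" if a: "a \<in> carrier M" for a
      unfolding divides_iff[OF a \<Delta>(1)] \<Delta>(2) using v_outside[OF a]
      by (metis order_refl zero_le_one)
    then show ?thesis by (auto simp: left_divisors_def)
  qed
  have fin: "finite (left_divisors M \<Delta>)"
  proof (rule inj_on_finite)
    show "inj_on (\<lambda>a. {x. v a x = 1}) (left_divisors M \<Delta>)"
    proof (rule inj_onI)
      fix a b assume ab: "a \<in> left_divisors M \<Delta>" "b \<in> left_divisors M \<Delta>" "{x. v a x = 1} = {x. v b x = 1}"
      have bit: "v c x = (if v c x = 1 then 1 else 0)" if "c \<in> left_divisors M \<Delta>" for c x
      proof -
        have "0 \<le> v c x" "v c x \<le> 1" using that v_nonneg unfolding ld by auto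
        then show ?thesis by simp
      qed
      show "a = b"
      proof (rule v_inj)
        fix x
        have "v a x = 1 \<longleftrightarrow> v b x = 1" using ab(3) by blast
        then show "v a x = v b x"
          by (subst bit[OF ab(1), of x], subst bit[OF ab(2), of x]) simp
      qed (use ab in \<open>auto simp: ld\<close>)
    qed
    show "(\<lambda>a. {x. v a x = 1}) ` left_divisors M \<Delta> \<subseteq> Pow X"
      using v_outside unfolding ld by fastforce
  qed (use finite_X in simp)
  have rl: "right_divisors M \<Delta> \<subseteq> left_divisors M \<Delta>"
  proof
    fix b assume "b \<in> right_divisors M \<Delta>"
    then obtain a where ab: "b \<in> carrier M" "a \<in> carrier M" "\<Delta> = a \<otimes> b"
      by (auto simp: right_divisors_def factor_def)
    have "v b y \<le> 1" for y
    proof -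
      obtain x where x: "y = \<tau> a x" using permutes_surj[OF \<tau>_permutes[OF ab(2)]] by (metis surjD)
      have "v a x + v b y \<le> 1"
        using fun_cong[OF v_mult[OF ab(2,1)], of x] \<Delta>(2) ab(3) x by (simp split: if_splits)
      then show ?thesis using v_nonneg[OF ab(2), of x] by simp
    qed
    then show "b \<in> left_divisors M \<Delta>" unfolding ld using ab(1) by simp
  qed
  \<comment> \<open>counting: complements inject left divisors into right divisors\<close>
  have "\<exists>c\<in>carrier M. \<Delta> = a \<otimes> c" if "a \<in> left_divisors M \<Delta>" for a
    using that by (auto simp: left_divisors_def factor_def)
  then obtain comp where comp: "\<And>a. a \<in> left_divisors M \<Delta> \<Longrightarrow> comp a \<in> carrier M \<and> \<Delta> = a \<otimes> comp a"
    by metis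
  have "comp ` left_divisors M \<Delta> \<subseteq> right_divisors M \<Delta>"
    using comp by (force simp: right_divisors_def factor_def left_divisors_def)
  moreover have "inj_on comp (left_divisors M \<Delta>)"
  proof (rule inj_onI)
    fix a b assume ab: "a \<in> left_divisors M \<Delta>" "b \<in> left_divisors M \<Delta>" "comp a = comp b"
    then have "a \<otimes> comp a = b \<otimes> comp a" using comp by metis
    then show "a = b"
      using monoid_cancel.r_cancel[OF cancel] ab comp by (auto simp: left_divisors_def)
  qed
  ultimately have "card (left_divisors M \<Delta>) \<le> card (right_divisors M \<Delta>)"
    using card_inj_on_le finite_subset[OF rl fin] by blast
  then have eq: "left_divisors M \<Delta> = right_divisors M \<Delta>"
    using card_seteq[OF fin rl] by simp
  have "generates_monoid M (left_divisors M \<Delta>)"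
    by (rule generates_monoidI) (auto simp: ld gen)
  then have "garside_element M \<Delta>"
    unfolding garside_element_def using \<Delta>(1) eq fin by simp
  then show "garside_element M (right_lcm M (gen ` X))"
    using right_lcm_eq[OF gX lcm] by simp
qed

lemma garside: "garside_monoid M"
  unfolding garside_monoid_def using gaussian garside_element_lcm(2) by blast

end

section \<open>Words of a solution and their vectors\<close>

locale yb_solution =
  fixes X :: "'x set" and S :: "'x \<times> 'x \<Rightarrow> 'x \<times> 'x"
  assumes finite_X: "finite X" and solution: "set_solution X S" and nondeg: "nondegenerate X S"
    and invol: "involutive X S" and braid: "braided X S"
begin

lemma S_closed: "x \<in> X \<Longrightarrow> y \<in> X \<Longrightarrow> fst (S (x, y)) \<in> X \<and> snd (S (x, y)) \<in> X"
proof -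
  assume "x \<in> X" "y \<in> X"
  then have "S (x, y) \<in> X \<times> X" using solution by (auto simp: set_solution_def bij_betw_def)
  then show ?thesis by (auto simp: mem_Times_iff)
qed

definition \<gamma> :: "'x \<Rightarrow> 'x \<Rightarrow> 'x" where
  "\<gamma> x y = (if y \<in> X then fst (S (x, y)) else y)"

lemma \<gamma>_permutes: "x \<in> X \<Longrightarrow> \<gamma> x permutes X"
proof (rule bij_imp_permutes)
  assume "x \<in> X"
  then have "bij_betw (\<lambda>y. fst (S (x, y))) X X" using nondeg by (simp add: nondegenerate_def)
  then show "bij_betw (\<gamma> x) X X" by (rule bij_betw_cong[THEN iffD1, rotated]) (simp add: \<gamma>_def)
qed (simp add: \<gamma>_def)

lemma \<gamma>_in [simp]: "x \<in> X \<Longrightarrow> \<gamma> x y \<in> X \<longleftrightarrow> y \<in> X"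
  using permutes_in_image[OF \<gamma>_permutes] by blast

lemma inv_\<gamma>_in [simp]: "x \<in> X \<Longrightarrow> inv_into UNIV (\<gamma> x) y \<in> X \<longleftrightarrow> y \<in> X"
  using permutes_in_image[OF permutes_inv[OF \<gamma>_permutes]] by blast

lemma \<gamma>_inv [simp]: "x \<in> X \<Longrightarrow> \<gamma> x (inv_into UNIV (\<gamma> x) y) = y"
    "x \<in> X \<Longrightarrow> inv_into UNIV (\<gamma> x) (\<gamma> x y) = y"
  using permutes_inverses[OF \<gamma>_permutes] by auto

lemma \<gamma>_inj: "x \<in> X \<Longrightarrow> \<gamma> x y = \<gamma> x z \<longleftrightarrow> y = z"
  by (metis \<gamma>_inv(2))

lemma inv_\<gamma>_eq: "x \<in> X \<Longrightarrow> inv_into UNIV (\<gamma> x) y = z \<longleftrightarrow> y = \<gamma> x z"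
  by (metis \<gamma>_inv)

text \<open>
  Involutivity determines the second component of \<open>S\<close> from the first one.
\<close>

lemma \<gamma>_S: "x \<in> X \<Longrightarrow> y \<in> X \<Longrightarrow> \<gamma> (fst (S (x, y))) (snd (S (x, y))) = x"
    "x \<in> X \<Longrightarrow> y \<in> X \<Longrightarrow> snd (S (S (x, y))) = y"
  using invol S_closed[of x y] by (auto simp: involutive_def \<gamma>_def)

text \<open>
  The first component of the braid relation.
\<close>

lemma \<gamma>_compose:
  assumes "x \<in> X" "y \<in> X"
  shows "\<gamma> x \<circ> \<gamma> y = \<gamma> (fst (S (x, y))) \<circ> \<gamma> (snd (S (x, y)))"
proof
  fix w
  show "(\<gamma> x \<circ> \<gamma> y) w = (\<gamma> (fst (S (x, y))) \<circ> \<gamma> (snd (S (x, y)))) w"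
  proof (cases "w \<in> X")
    case True
    then have "act12 S (act23 S (act12 S (x, y, w))) = act23 S (act12 S (act23 S (x, y, w)))"
      using braid assms unfolding braided_def by blast
    then have "fst (S (fst (S (x, y)), fst (S (snd (S (x, y)), w)))) = fst (S (x, fst (S (y, w))))"
      by (simp add: act12_def act23_def split: prod.splits)
    then show ?thesis using True assms S_closed[of x y] S_closed[of y w] S_closed[of "snd (S (x, y))" w]
      by (simp add: \<gamma>_def)
  qed (use assms S_closed[of x y] in \<open>simp add: \<gamma>_def\<close>)
qed

text \<open>
  The vector of the inverse of a letter follows from the cocycle identity applied to \<open>x\<^sup>-\<^sup>1 x = 1\<close>.
\<close>

fun letter_v :: "'x \<times> bool \<Rightarrow> 'x \<Rightarrow> int" where
  "letter_v (x, True) y = (if y = x then 1 else 0)"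
| "letter_v (x, False) y = (if \<gamma> x y = x then - 1 else 0)"

fun letter_\<tau> :: "'x \<times> bool \<Rightarrow> 'x \<Rightarrow> 'x" where
  "letter_\<tau> (x, True) = inv_into UNIV (\<gamma> x)"
| "letter_\<tau> (x, False) = \<gamma> x"

primrec word_v :: "('x \<times> bool) list \<Rightarrow> 'x \<Rightarrow> int" where
  "word_v [] = (\<lambda>y. 0)"
| "word_v (a # w) = (\<lambda>y. letter_v a y + word_v w (letter_\<tau> a y))"

primrec word_\<tau> :: "('x \<times> bool) list \<Rightarrow> 'x \<Rightarrow> 'x" where
  "word_\<tau> [] = id"
| "word_\<tau> (a # w) = word_\<tau> w \<circ> letter_\<tau> a"

lemma word_append:
  "word_\<tau> (u @ w) = word_\<tau> w \<circ> word_\<tau> u"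
  "word_v (u @ w) = (\<lambda>y. word_v u y + word_v w (word_\<tau> u y))"
  by (induction u) (auto simp: fun_eq_iff)

lemma word_\<tau>_permutes: "w \<in> lists (X \<times> UNIV) \<Longrightarrow> word_\<tau> w permutes X"
proof (induction w)
  case (Cons a w)
  obtain x b where a: "a = (x, b)" "x \<in> X" using Cons.prems by auto
  have "letter_\<tau> a permutes X" using a by (cases b) (auto simp: \<gamma>_permutes permutes_inv)
  then show ?case using Cons unfolding word_\<tau>.simps by (intro permutes_compose) auto
qed (simp add: permutes_id)

lemma word_v_outside: "w \<in> lists (X \<times> UNIV) \<Longrightarrow> y \<notin> X \<Longrightarrow> word_v w y = 0"
proof (induction w arbitrary: y)
  case (Cons a w)
  obtain x b where a: "a = (x, b)" "x \<in> X" using Cons.prems by auto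
  have "letter_v a y = 0" "letter_\<tau> a y \<notin> X" using a Cons.prems \<gamma>_in[of x y] by (cases b; auto)+
  then show ?case using Cons by simp
qed simp

abbreviation pos :: "'x list \<Rightarrow> ('x \<times> bool) list" where
  "pos w \<equiv> map (\<lambda>x. (x, True)) w"

abbreviation R where "R \<equiv> structure_relations X S"
abbreviation cong where "cong \<equiv> word_cong X R"
abbreviation gcong where "gcong \<equiv> word_cong (X \<times> UNIV) (group_relations X R)"

text \<open>
  For \<open>xy = tz\<close> both sides have the vector \<open>e\<^sub>x + e\<^sub>t\<close>, because \<open>\<gamma> x y = t\<close> and \<open>\<gamma> t z = x\<close>; the
  permutations agree by the braid relation.
\<close>

lemma relation_invariant:
  assumes "(u, w) \<in> group_relations X R"
  shows "word_v u = word_v w \<and> word_\<tau> u = word_\<tau> w"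
proof -
  consider x y where "x \<in> X" "y \<in> X" "u = pos [x, y]" "w = pos [fst (S (x, y)), snd (S (x, y))]"
    | x b where "x \<in> X" "u = [(x, b), (x, \<not> b)]" "w = []"
    using assms by (fastforce simp: group_relations_def structure_relations_def)
  then show ?thesis
  proof cases
    case 1
    define t z where "t = fst (S (x, y))" and "z = snd (S (x, y))"
    have tz: "t \<in> X" "z \<in> X" "\<gamma> x y = t" "\<gamma> t z = x"
      using 1 S_closed \<gamma>_S by (auto simp: t_def z_def \<gamma>_def)
    have "word_v u = word_v w"
      using 1 tz by (auto simp: fun_eq_iff inv_\<gamma>_eq simp flip: t_def z_def)
    moreover have "inv_into UNIV (\<gamma> x \<circ> \<gamma> y) = inv_into UNIV (\<gamma> t \<circ> \<gamma> z)"
      using \<gamma>_compose 1 by (simp add: t_def z_def)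
    then have "word_\<tau> u = word_\<tau> w"
      using 1 o_inv_distrib[of "\<gamma> x" "\<gamma> y"] o_inv_distrib[of "\<gamma> t" "\<gamma> z"]
        permutes_bij[OF \<gamma>_permutes] tz by (simp flip: t_def z_def)
    ultimately show ?thesis ..
  next
    case (2 x b)
    then show ?thesis by (cases b) (auto simp: fun_eq_iff inv_\<gamma>_eq)
  qed
qed

lemma gcong_invariant: "gcong u w \<Longrightarrow> word_v u = word_v w \<and> word_\<tau> u = word_\<tau> w"
proof (induction rule: word_cong.induct)
  case (rel u v p q)
  then show ?case using relation_invariant[OF rel(1)] by (simp add: word_append)
qed auto

lemma cong_gcong: "cong u w \<Longrightarrow> gcong (pos u) (pos w)"
proof (induction rule: word_cong.induct)
  case (rel u v p q)
  have "(pos u, pos v) \<in> group_relations X R" using rel(1) unfolding group_relations_def by blast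
  then have "gcong (pos p @ pos u @ pos q) (pos p @ pos v @ pos q)"
    using rel by (intro word_cong.rel) auto
  then show ?case by simp
next
  case (refl u)
  then show ?case by (intro word_cong.refl) auto
qed (auto intro: word_cong.intros)

lemma cong_invariant: "cong u w \<Longrightarrow> word_v (pos u) = word_v (pos w) \<and> word_\<tau> (pos u) = word_\<tau> (pos w)"
  using gcong_invariant cong_gcong by blast

lemma word_v_nonneg: "0 \<le> word_v (pos w) y"
  by (induction w arbitrary: y) auto

lemma cong_Cons: "cong u w \<Longrightarrow> x \<in> X \<Longrightarrow> cong (x # u) (x # w)"
  using word_cong_context[of X R u w "[x]" "[]"] by simp

text \<open>
  If \<open>y\<close> is not the first letter \<open>x\<close>, bring the preimage of \<open>y\<close> under \<open>\<gamma> x\<close> to the front of the rest of the word; the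
  defining relation then replaces these two letters by a pair that starts with \<open>y\<close>.
\<close>

lemma pull_letter:
  assumes "w \<in> lists X" "0 < word_v (pos w) y"
  shows "\<exists>w'\<in>lists X. cong w (y # w')"
  using assms
proof (induction w arbitrary: y)
  case (Cons x w)
  show ?case
  proof (cases "y = x")
    case True
    show ?thesis unfolding True using Cons by (intro bexI[of _ w] word_cong.refl) auto
  next
    case False
    define y' where "y' = inv_into UNIV (\<gamma> x) y"
    have "0 < word_v (pos w) y'" using Cons.prems False by (simp add: y'_def)
    then obtain w' where w': "w' \<in> lists X" "cong w (y' # w')" using Cons.IH by blast
    then have y': "y' \<in> X" using word_cong_lists by fastforce
    have x: "x \<in> X" using Cons.hyps(1) .
    define z where "z = snd (S (x, y'))"
    have S: "S (x, y') = (y, z)"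
      using x y' \<gamma>_inv(1)[OF x, of y] by (simp add: y'_def z_def \<gamma>_def prod_eq_iff)
    have yz: "y \<in> X" "z \<in> X" using S_closed[OF x y'] S by auto
    have "([x, y'], [y, z]) \<in> R" using x y' S by (auto simp: structure_relations_def)
    then have "cong ([] @ [x, y'] @ w') ([] @ [y, z] @ w')"
      using x y' yz w' by (intro word_cong.rel) auto
    moreover have "cong (x # w) (x # y' # w')" using w'(2) x by (rule cong_Cons)
    ultimately have "cong (x # w) (y # z # w')" by (auto intro: word_cong.trans)
    then show ?thesis using yz w' by (intro bexI[of _ "z # w'"]) auto
  qed
qed simp

text \<open>
  Pull the first letter of one word to the front of the other and cancel it in both vectors.
\<close>

lemma cong_if_word_v_eq:
  assumes "u \<in> lists X" "w \<in> lists X" "word_v (pos u) = word_v (pos w)"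
  shows "cong u w"
  using assms
proof (induction u arbitrary: w)
  case Nil
  have "w = []"
  proof (cases w)
    case (Cons x w')
    then show ?thesis using fun_cong[OF Nil.prems(2), of x] word_v_nonneg[of w' "inv_into UNIV (\<gamma> x) x"] by simp
  qed simp
  then show ?case by (auto intro: word_cong.refl)
next
  case (Cons x u)
  have "0 < word_v (pos (x # u)) x" using word_v_nonneg[of u "inv_into UNIV (\<gamma> x) x"] by simp
  then obtain w' where w': "w' \<in> lists X" "cong w (x # w')"
    using pull_letter[OF Cons.prems(1)] Cons.prems(2) by metis
  have x: "x \<in> X" using Cons.hyps(1) .
  have eq: "word_v (pos (x # u)) = word_v (pos (x # w'))"
    using Cons.prems(2) cong_invariant[OF w'(2)] by simp
  have "word_v (pos u) = word_v (pos w')"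
  proof
    fix y
    show "word_v (pos u) y = word_v (pos w') y"
      using fun_cong[OF eq, of "\<gamma> x y"] x by simp
  qed
  then have "cong u w'" using Cons.IH w' by blast
  then have "cong (x # u) (x # w')" using x by (rule cong_Cons)
  then show ?case using w'(2) word_cong.trans word_cong.sym by metis
qed

text \<open>
  Build the word from the left: split off a letter of the support and move the rest of the vector
  back by its permutation.
\<close>

lemma word_exists:
  assumes "\<And>x. 0 \<le> u x" "\<And>x. x \<notin> X \<Longrightarrow> u x = 0"
  shows "\<exists>w\<in>lists X. word_v (pos w) = u"
  using assms
proof (induction "nat (\<Sum>x\<in>X. u x)" arbitrary: u rule: less_induct)
  case less
  show ?case
  proof (cases "\<forall>x. u x = 0")
    case True
    then show ?thesis by (intro bexI[of _ "[]"]) auto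
  next
    case False
    then obtain x where x: "u x \<noteq> 0" by blast
    then have xX: "x \<in> X" using less.prems(2) by blast
    define u' where "u' y = u (\<gamma> x y) - (if \<gamma> x y = x then 1 else 0)" for y
    have ux: "1 \<le> u x" using less.prems(1)[of x] x by linarith
    have "(\<Sum>y\<in>X. u' y) = (\<Sum>y\<in>X. u y - (if y = x then 1 else 0))"
      unfolding u'_def using sum.permute[OF \<gamma>_permutes[OF xX], of "\<lambda>y. u y - (if y = x then 1 else 0)"]
      by (simp add: comp_def)
    also have "\<dots> = (\<Sum>y\<in>X. u y) - 1" using finite_X xX by (simp add: sum_subtractf)
    finally have s: "(\<Sum>y\<in>X. u' y) = (\<Sum>y\<in>X. u y) - 1" .
    have "u x \<le> (\<Sum>y\<in>X. u y)" using finite_X xX less.prems(1) by (intro member_le_sum) auto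
    then have "nat (\<Sum>y\<in>X. u' y) < nat (\<Sum>y\<in>X. u y)" using s ux by simp
    moreover have "0 \<le> u' y" for y using less.prems(1)[of "\<gamma> x y"] ux by (simp add: u'_def)
    moreover have "u' y = 0" if "y \<notin> X" for y
    proof -
      have "\<gamma> x y \<notin> X" using that xX by simp
      then have "\<gamma> x y \<noteq> x" "u (\<gamma> x y) = 0" using less.prems(2) xX by metis+
      then show ?thesis by (simp add: u'_def)
    qed
    ultimately obtain w where w: "w \<in> lists X" "word_v (pos w) = u'"
      using less.hyps by blast
    have "word_v (pos (x # w)) = u"
      using w(2) xX by (auto simp: u'_def fun_eq_iff)
    then show ?thesis using w xX by (intro bexI[of _ "x # w"]) auto
  qed
qed

lemma pos_lists: "w \<in> lists X \<Longrightarrow> pos w \<in> lists (X \<times> UNIV)"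
  by auto

text \<open>
  Stated for any labelling \<open>q\<close> of a monoid by words rather than for classes of words, so that it also
  covers the opposite monoid, whose elements are labelled by reversed words.
\<close>

lemma lattice_monoid_of_presentation:
  assumes "monoid N" and q: "q ` lists X = carrier N"
    and q_eq: "\<And>u w. u \<in> lists X \<Longrightarrow> w \<in> lists X \<Longrightarrow> q u = q w \<longleftrightarrow> cong u w"
    and q_mult: "\<And>u w. u \<in> lists X \<Longrightarrow> w \<in> lists X \<Longrightarrow> q (u @ w) = q u \<otimes>\<^bsub>N\<^esub> q w"
  shows "lattice_monoid N X (\<lambda>a. word_v (pos (inv_into (lists X) q a))) (\<lambda>a. word_\<tau> (pos (inv_into (lists X) q a)))"
    and "w \<in> lists X \<Longrightarrow> word_v (pos (inv_into (lists X) q (q w))) = word_v (pos w)"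
    and "w \<in> lists X \<Longrightarrow> word_\<tau> (pos (inv_into (lists X) q (q w))) = word_\<tau> (pos w)"
proof -
  let ?r = "inv_into (lists X) q"
  let ?v = "\<lambda>a. word_v (pos (?r a))" and ?t = "\<lambda>a. word_\<tau> (pos (?r a))"
  have rep: "cong (?r (q w)) w" "?r (q w) \<in> lists X" if "w \<in> lists X" for w
  proof -
    have "q (?r (q w)) = q w" using that by (intro f_inv_into_f) blast
    moreover show "?r (q w) \<in> lists X" using that by (intro inv_into_into) blast
    ultimately show "cong (?r (q w)) w" using q_eq that by blast
  qed
  show v: "word_v (pos (?r (q w))) = word_v (pos w)"
    and t: "word_\<tau> (pos (?r (q w))) = word_\<tau> (pos w)" if "w \<in> lists X" for w
    using cong_invariant[OF rep(1)[OF that]] by auto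
  have ex: "\<exists>w\<in>lists X. a = q w" if "a \<in> carrier N" for a using that q by blast
  have bij: "bij_betw ?v (carrier N)
      {u. (\<forall>x. 0 \<le> u x) \<and> (\<forall>x. x \<notin> X \<longrightarrow> u x = 0)}"
  proof (rule bij_betw_imageI)
    show "inj_on ?v (carrier N)"
    proof (rule inj_onI)
      fix a b assume "a \<in> carrier N" "b \<in> carrier N"
        and eq: "word_v (pos (?r a)) = word_v (pos (?r b))"
      then obtain u w where uw: "u \<in> lists X" "w \<in> lists X" "a = q u" "b = q w" using ex by meson
      then have "cong u w" using eq v by (intro cong_if_word_v_eq) auto
      then show "a = b" using uw q_eq by blast
    qed
    show "?v ` carrier N = {u. (\<forall>x. 0 \<le> u x) \<and> (\<forall>x. x \<notin> X \<longrightarrow> u x = 0)}"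
    proof (intro equalityI subsetI)
      fix u assume "u \<in> ?v ` carrier N"
      then obtain w where "w \<in> lists X" "u = word_v (pos w)" using ex v by force
      then show "u \<in> {u. (\<forall>x. 0 \<le> u x) \<and> (\<forall>x. x \<notin> X \<longrightarrow> u x = 0)}"
        using word_v_nonneg word_v_outside[OF pos_lists] by auto
    next
      fix u :: "'x \<Rightarrow> int" assume "u \<in> {u. (\<forall>x. 0 \<le> u x) \<and> (\<forall>x. x \<notin> X \<longrightarrow> u x = 0)}"
      then obtain w where w: "w \<in> lists X" "word_v (pos w) = u" using word_exists[of u] by blast
      then have "u = word_v (pos (?r (q w)))" using v by simp
      then show "u \<in> ?v ` carrier N" using w(1) q by blast
    qed
  qed
  have perm: "word_\<tau> (pos (?r a)) permutes X" if "a \<in> carrier N" for a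
  proof -
    obtain w where w: "w \<in> lists X" "a = q w" using ex[OF \<open>a \<in> carrier N\<close>] by blast
    show ?thesis unfolding w(2) t[OF w(1)] by (rule word_\<tau>_permutes[OF pos_lists[OF w(1)]])
  qed
  have vm: "word_v (pos (?r (a \<otimes>\<^bsub>N\<^esub> b))) = (\<lambda>x. word_v (pos (?r a)) x +
        word_v (pos (?r b)) (word_\<tau> (pos (?r a)) x))"
    "word_\<tau> (pos (?r (a \<otimes>\<^bsub>N\<^esub> b))) =
        word_\<tau> (pos (?r b)) \<circ> word_\<tau> (pos (?r a))"
    if ab: "a \<in> carrier N" "b \<in> carrier N" for a b
  proof -
    obtain u w where uw: "u \<in> lists X" "w \<in> lists X" "a = q u" "b = q w" using ex ab by meson
    have "a \<otimes>\<^bsub>N\<^esub> b = q (u @ w)" "u @ w \<in> lists X" using uw q_mult by auto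
    then show "word_v (pos (?r (a \<otimes>\<^bsub>N\<^esub> b))) = (\<lambda>x. word_v (pos (?r a)) x +
        word_v (pos (?r b)) (word_\<tau> (pos (?r a)) x))"
      "word_\<tau> (pos (?r (a \<otimes>\<^bsub>N\<^esub> b))) =
        word_\<tau> (pos (?r b)) \<circ> word_\<tau> (pos (?r a))"
      using uw v t word_append[of "pos u" "pos w"] by simp_all
  qed
  show "lattice_monoid N X ?v ?t"
    unfolding lattice_monoid_def lattice_monoid_axioms_def
    using assms(1) finite_X bij perm vm by blast
qed

end

section \<open>The structure monoid and its opposite\<close>

text \<open>
  Reading words backwards replaces a solution by its mirror image.
\<close>

definition mirror :: "('x \<times> 'x \<Rightarrow> 'x \<times> 'x) \<Rightarrow> 'x \<times> 'x \<Rightarrow> 'x \<times> 'x" where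
  "mirror S = prod.swap \<circ> S \<circ> prod.swap"

lemma mirror_mirror: "mirror (mirror S) = S"
  by (simp add: mirror_def fun_eq_iff)

lemma word_cong_rev:
  assumes "word_cong X (structure_relations X S) u w"
  shows "word_cong X (structure_relations X (mirror S)) (rev u) (rev w)"
  using assms
proof (induction rule: word_cong.induct)
  case (rel u v p q)
  then have "(rev u, rev v) \<in> structure_relations X (mirror S)"
    by (auto simp: structure_relations_def mirror_def)
  then have "word_cong X (structure_relations X (mirror S)) (rev q @ rev u @ rev p) (rev q @ rev v @ rev p)"
    using rel by (intro word_cong.rel) auto
  then show ?case by simp
next
  case (refl u)
  then show ?case by (intro word_cong.refl) auto
qed (auto intro: word_cong.intros)

context yb_solution
begin

lemma mirror_solution: "yb_solution X (mirror S)"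
proof
  show "finite X" by (rule finite_X)
  have sw: "bij_betw prod.swap (X \<times> X) (X \<times> X)"
    by (rule bij_betwI[where g = prod.swap]) auto
  then show "set_solution X (mirror S)"
    using solution unfolding set_solution_def mirror_def by (blast intro: bij_betw_trans)
  show "nondegenerate X (mirror S)"
    using nondeg by (simp add: nondegenerate_def mirror_def)
  show "involutive X (mirror S)"
    using invol by (auto simp: involutive_def mirror_def)
  show "braided X (mirror S)"
    unfolding braided_def
  proof
    fix p assume "p \<in> X \<times> X \<times> X"
    then obtain x y z where p: "p = (x, y, z)" "x \<in> X" "y \<in> X" "z \<in> X" by auto
    let ?r = "\<lambda>(x, y, z). (z, y, x)"
    have a: "act12 (mirror S) q = ?r (act23 S (?r q))" "act23 (mirror S) q = ?r (act12 S (?r q))" for q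
      by (auto simp: act12_def act23_def mirror_def prod_eq_iff split: prod.splits)
    have rr: "?r (?r q) = q" for q :: "'x \<times> 'x \<times> 'x" by (auto split: prod.splits)
    have "act12 S (act23 S (act12 S (z, y, x))) = act23 S (act12 S (act23 S (z, y, x)))"
      using braid p by (simp add: braided_def)
    then show "act12 (mirror S) (act23 (mirror S) (act12 (mirror S) p)) =
        act23 (mirror S) (act12 (mirror S) (act23 (mirror S) p))"
      unfolding a rr p(1) by simp
  qed
qed

definition monoid_v where
  "monoid_v a = word_v (pos (inv_into (lists X) (word_class X R) a))"

definition monoid_\<tau> where
  "monoid_\<tau> a = word_\<tau> (pos (inv_into (lists X) (word_class X R) a))"

lemma lattice_structure_monoid: "lattice_monoid (structure_monoid X S) X monoid_v monoid_\<tau>"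
  and monoid_v: "w \<in> lists X \<Longrightarrow> monoid_v (word_class X R w) = word_v (pos w)"
  and monoid_\<tau>: "w \<in> lists X \<Longrightarrow> monoid_\<tau> (word_class X R w) = word_\<tau> (pos w)"
proof -
  have 1: "monoid (structure_monoid X S)"
    unfolding structure_monoid_def by (rule monoid_presented_monoid)
  have 2: "word_class X R ` lists X = carrier (structure_monoid X S)"
    by (simp add: structure_monoid_def presented_monoid_def)
  have 3: "word_class X R u = word_class X R w \<longleftrightarrow> cong u w" if "u \<in> lists X" "w \<in> lists X" for u w
    using word_class_eq_iff[OF that] .
  have 4: "word_class X R (u @ w) = word_class X R u \<otimes>\<^bsub>structure_monoid X S\<^esub> word_class X R w"
    if "u \<in> lists X" "w \<in> lists X" for u w
    unfolding structure_monoid_def using presented_monoid_mult[OF that] by simp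
  show "lattice_monoid (structure_monoid X S) X monoid_v monoid_\<tau>"
    "w \<in> lists X \<Longrightarrow> monoid_v (word_class X R w) = word_v (pos w)"
    "w \<in> lists X \<Longrightarrow> monoid_\<tau> (word_class X R w) = word_\<tau> (pos w)"
    using lattice_monoid_of_presentation[of "structure_monoid X S" "word_class X R", OF 1 2 3 4]
    unfolding monoid_v_def[abs_def] monoid_\<tau>_def[abs_def] by blast+
qed

lemma bilattice_structure_monoid:
  "\<exists>v' \<tau>'. bilattice_monoid (structure_monoid X S) X monoid_v monoid_\<tau> v' \<tau>'"
proof -
  interpret m: yb_solution X "mirror S" by (rule mirror_solution)
  let ?N = "opposite (structure_monoid X S)" and ?q = "\<lambda>w. word_class X R (rev w)"
  interpret P: monoid "structure_monoid X S"
    unfolding structure_monoid_def by (rule monoid_presented_monoid)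
  have opp: "carrier ?N = carrier (structure_monoid X S)" "a \<otimes>\<^bsub>?N\<^esub> b = b \<otimes>\<^bsub>structure_monoid X S\<^esub> a"
    "\<one>\<^bsub>?N\<^esub> = \<one>\<^bsub>structure_monoid X S\<^esub>" for a b
    by (simp_all add: opposite_def)
  have 1: "monoid ?N"
    by (rule monoidI) (auto simp: opp P.m_assoc)
  have rl: "rev ` lists X = lists X"
  proof (intro equalityI subsetI)
    fix w assume "w \<in> lists X"
    then have "rev w \<in> lists X" "w = rev (rev w)" by auto
    then show "w \<in> rev ` lists X" by blast
  qed auto
  have 2: "?q ` lists X = carrier ?N"
  proof -
    have "?q ` lists X = word_class X R ` rev ` lists X" by (simp only: image_image)
    then show ?thesis unfolding opp rl by (simp add: structure_monoid_def presented_monoid_def)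
  qed
  have 3: "?q u = ?q w \<longleftrightarrow> m.cong u w" if uw: "u \<in> lists X" "w \<in> lists X" for u w
  proof -
    have "?q u = ?q w \<longleftrightarrow> cong (rev u) (rev w)"
      using uw by (intro word_class_eq_iff) auto
    also have "\<dots> \<longleftrightarrow> m.cong u w"
      using word_cong_rev[of X S "rev u" "rev w"] word_cong_rev[of X "mirror S" u w]
      by (auto simp: mirror_mirror)
    finally show ?thesis .
  qed
  have 4: "?q (u @ w) = ?q u \<otimes>\<^bsub>?N\<^esub> ?q w" if "u \<in> lists X" "w \<in> lists X" for u w
  proof -
    have "word_class X R (rev w @ rev u) = word_class X R (rev w) \<otimes>\<^bsub>structure_monoid X S\<^esub> word_class X R (rev u)"
      unfolding structure_monoid_def using that by (intro presented_monoid_mult[symmetric]) auto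
    then show ?thesis by (simp add: opp)
  qed
  show ?thesis
    using lattice_structure_monoid m.lattice_monoid_of_presentation(1)[OF 1 2 3 4]
    unfolding bilattice_monoid_def by blast
qed

lemma gen_word: "x \<in> X \<Longrightarrow> monoid_v (monoid_gen X S x) = (\<lambda>y. if y = x then 1 else 0)"
  "x \<in> X \<Longrightarrow> monoid_\<tau> (monoid_gen X S x) = inv_into UNIV (\<gamma> x)"
  using monoid_v[of "[x]"] monoid_\<tau>[of "[x]"] by (auto simp: monoid_gen_def)

lemma monoid_gen_closed: "x \<in> X \<Longrightarrow> monoid_gen X S x \<in> carrier (structure_monoid X S)"
  by (auto simp: monoid_gen_def structure_monoid_def presented_monoid_def)

section \<open>The structure group as a lattice\<close>

abbreviation G where "G \<equiv> structure_group X S"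
abbreviation gclass where "gclass \<equiv> word_class (X \<times> UNIV) (group_relations X R)"

lemma gclass_mult: "u \<in> lists (X \<times> UNIV) \<Longrightarrow> w \<in> lists (X \<times> UNIV) \<Longrightarrow> gclass (u @ w) = gclass u \<otimes>\<^bsub>G\<^esub> gclass w"
  unfolding structure_group_def by (rule presented_monoid_mult[symmetric])

lemma gclass_closed: "u \<in> lists (X \<times> UNIV) \<Longrightarrow> gclass u \<in> carrier G"
  by (auto simp: structure_group_def presented_monoid_def)

lemma gclass_one: "gclass [] = \<one>\<^bsub>G\<^esub>"
  by (simp add: structure_group_def presented_monoid_def)

lemma gclassE:
  assumes "g \<in> carrier G"
  obtains w where "w \<in> lists (X \<times> UNIV)" "g = gclass w"
  using assms unfolding structure_group_def by (rule presented_monoidE)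

definition group_v where
  "group_v g = word_v (inv_into (lists (X \<times> UNIV)) gclass g)"

definition group_\<tau> where
  "group_\<tau> g = word_\<tau> (inv_into (lists (X \<times> UNIV)) gclass g)"

lemma group_v_gclass:
  assumes "w \<in> lists (X \<times> UNIV)"
  shows "group_v (gclass w) = word_v w" "group_\<tau> (gclass w) = word_\<tau> w"
proof -
  let ?w = "inv_into (lists (X \<times> UNIV)) gclass (gclass w)"
  have w: "gclass ?w = gclass w" "?w \<in> lists (X \<times> UNIV)"
    using assms by (intro f_inv_into_f inv_into_into imageI; assumption)+
  have "gcong ?w w" using word_class_eq_iff[OF w(2) assms] w(1) by simp
  then show "group_v (gclass w) = word_v w" "group_\<tau> (gclass w) = word_\<tau> w"
    using gcong_invariant unfolding group_v_def group_\<tau>_def by auto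
qed

lemma group_v_mult:
  assumes "g \<in> carrier G" "h \<in> carrier G"
  shows "group_v (g \<otimes>\<^bsub>G\<^esub> h) = (\<lambda>x. group_v g x + group_v h (group_\<tau> g x))"
    "group_\<tau> (g \<otimes>\<^bsub>G\<^esub> h) = group_\<tau> h \<circ> group_\<tau> g"
proof -
  obtain u w where uw: "u \<in> lists (X \<times> UNIV)" "w \<in> lists (X \<times> UNIV)" "g = gclass u" "h = gclass w"
    using gclassE[OF assms(1)] gclassE[OF assms(2)] by metis
  then have "g \<otimes>\<^bsub>G\<^esub> h = gclass (u @ w)" "u @ w \<in> lists (X \<times> UNIV)" using gclass_mult by auto
  then show "group_v (g \<otimes>\<^bsub>G\<^esub> h) = (\<lambda>x. group_v g x + group_v h (group_\<tau> g x))"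
    "group_\<tau> (g \<otimes>\<^bsub>G\<^esub> h) = group_\<tau> h \<circ> group_\<tau> g"
    using uw group_v_gclass word_append[of u w] by simp_all
qed

definition const_vec :: "int \<Rightarrow> 'x \<Rightarrow> int" where
  "const_vec n = (\<lambda>x. if x \<in> X then n else 0)"

text \<open>
  The permutation of the element with vector constantly \<open>1\<close> has finite order, and the constant vectors are fixed by all
  permutations. So the corresponding power acts trivially on \<open>X\<close> and has a constant vector.
\<close>

lemma central_word:
  obtains z n where "z \<in> lists X" "0 < n" "word_v (pos z) = const_vec n" "word_\<tau> (pos z) = id"
proof -
  obtain d where d: "d \<in> lists X" "word_v (pos d) = const_vec 1"
  proof -
    have "\<exists>w\<in>lists X. word_v (pos w) = const_vec 1"
      by (rule word_exists) (auto simp: const_vec_def)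
    then show ?thesis using that by blast
  qed
  have p: "word_\<tau> (pos d) permutes X" by (rule word_\<tau>_permutes[OF pos_lists[OF d(1)]])
  obtain k where k: "word_\<tau> (pos d) ^^ k = id" "k > 0"
    using p finite_X permutation_is_nilpotent permutation_permutes by metis
  define z where "z = concat (replicate k d)"
  have "word_v (pos (concat (replicate m d))) = const_vec (int m) \<and>
      word_\<tau> (pos (concat (replicate m d))) = word_\<tau> (pos d) ^^ m" for m
  proof (induction m)
    case (Suc m)
    then show ?case
      using d(2) permutes_in_image[OF p] by (auto simp: word_append const_vec_def funpow_Suc_right fun_eq_iff simp del: funpow.simps)
  qed (auto simp: const_vec_def)
  then show ?thesis using k d(1) by (intro that[of z "int k"]) (auto simp: z_def)
qed

abbreviation lift :: "'x list \<Rightarrow> ('x \<times> bool) list set" where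
  "lift w \<equiv> gclass (pos w)"

lemma lift_eq: "u \<in> lists X \<Longrightarrow> w \<in> lists X \<Longrightarrow> word_v (pos u) = word_v (pos w) \<Longrightarrow> lift u = lift w"
  using cong_if_word_v_eq[of u w] cong_gcong[of u w] word_class_eq_iff[of "pos u" "X \<times> UNIV" "pos w"] pos_lists
  by blast

lemma lift_mult: "u \<in> lists X \<Longrightarrow> w \<in> lists X \<Longrightarrow> lift (u @ w) = lift u \<otimes>\<^bsub>G\<^esub> lift w"
  using gclass_mult[OF pos_lists pos_lists, of u w] by simp

lemma lift_closed: "w \<in> lists X \<Longrightarrow> lift w \<in> carrier G"
  using gclass_closed pos_lists by blast

text \<open>
  Both products have the same vector, and vectors determine elements of \<open>M\<close>.
\<close>

lemma central_commute:
  assumes "z \<in> lists X" "word_v (pos z) = const_vec n" "word_\<tau> (pos z) = id" "w \<in> lists X"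
  shows "lift z \<otimes>\<^bsub>G\<^esub> lift w = lift w \<otimes>\<^bsub>G\<^esub> lift z"
proof -
  have "word_v (pos (z @ w)) = word_v (pos (w @ z))"
    using assms permutes_in_image[OF word_\<tau>_permutes[OF pos_lists[OF assms(4)]]]
    by (auto simp: word_append const_vec_def fun_eq_iff)
  then have "lift (z @ w) = lift (w @ z)" using assms by (intro lift_eq) auto
  then show ?thesis using lift_mult[OF assms(1,4)] lift_mult[OF assms(4,1)] by simp
qed

text \<open>
  Every letter \<open>x\<close> divides a central element, \<open>c = x p\<close>, so that \<open>c x\<^sup>-\<^sup>1 = p\<close>: inverse letters can be removed one
  by one at the cost of central factors.
\<close>

lemma fraction_exists:
  assumes "w \<in> lists (X \<times> UNIV)"
  obtains z n m where "z \<in> lists X" "m \<in> lists X" "word_v (pos z) = const_vec n" "word_\<tau> (pos z) = id"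
    "lift z \<otimes>\<^bsub>G\<^esub> gclass w = lift m"
proof -
  interpret G: group G by (rule group_structure_group)
  obtain c n0 where c: "c \<in> lists X" "0 < n0" "word_v (pos c) = const_vec n0" "word_\<tau> (pos c) = id"
    by (rule central_word)
  have "\<exists>z n m. z \<in> lists X \<and> m \<in> lists X \<and> word_v (pos z) = const_vec n \<and> word_\<tau> (pos z) = id \<and>
      lift z \<otimes>\<^bsub>G\<^esub> gclass w = lift m"
    using assms
  proof (induction w)
    case Nil
    show ?case
      by (rule exI[of _ "[]"], rule exI[of _ 0], rule exI[of _ "[]"]) (auto simp: gclass_one const_vec_def)
  next
    case (Cons a w)
    then obtain z n m where z: "z \<in> lists X" "m \<in> lists X" "word_v (pos z) = const_vec n"
      "word_\<tau> (pos z) = id" "lift z \<otimes>\<^bsub>G\<^esub> gclass w = lift m" by blast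
    obtain x b where a: "a = (x, b)" "x \<in> X" using Cons.hyps(1) by auto
    have aw: "gclass (a # w) = gclass [a] \<otimes>\<^bsub>G\<^esub> gclass w"
      using gclass_mult[of "[a]" w] Cons.hyps by simp
    have cl: "gclass [a] \<in> carrier G" "gclass w \<in> carrier G" "lift z \<in> carrier G" "lift [x] \<in> carrier G"
      "lift c \<in> carrier G"
      using gclass_closed[of "[a]"] gclass_closed[OF Cons.hyps(2)] lift_closed[OF z(1)]
        lift_closed[of "[x]"] lift_closed[OF c(1)] Cons.hyps(1) a by auto
    show ?case
    proof (cases b)
      case True
      then have la: "gclass [a] = lift [x]" by (simp add: a)
      have "lift z \<otimes>\<^bsub>G\<^esub> gclass (a # w) = lift [x] \<otimes>\<^bsub>G\<^esub> (lift z \<otimes>\<^bsub>G\<^esub> gclass w)"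
        unfolding aw la using central_commute[OF z(1,3,4), of "[x]"] a(2) cl
        by (simp add: G.m_assoc[symmetric])
      also have "\<dots> = lift (x # m)"
        unfolding z(5) using lift_mult[of "[x]" m] a(2) z(2) by simp
      finally show ?thesis using z a(2) by (intro exI[of _ z] exI[of _ n] exI[of _ "x # m"]) auto
    next
      case False
      obtain p where p: "p \<in> lists X" "word_v (pos (x # p)) = word_v (pos c)"
      proof -
        have "\<exists>p\<in>lists X. word_v (pos p) = (\<lambda>y. const_vec n0 (\<gamma> x y) - (if \<gamma> x y = x then 1 else 0))"
        proof (rule word_exists)
          have x: "\<gamma> x y = x \<Longrightarrow> y \<in> X" for y using a(2) \<gamma>_in[of x y] by simp
          show "0 \<le> const_vec n0 (\<gamma> x y) - (if \<gamma> x y = x then 1 else 0)" for y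
            using a(2) c(2) x[of y] by (simp add: const_vec_def)
          show "const_vec n0 (\<gamma> x y) - (if \<gamma> x y = x then 1 else 0) = 0" if "y \<notin> X" for y
            using a(2) x[of y] that by (auto simp: const_vec_def)
        qed
        then obtain p where "p \<in> lists X" "word_v (pos p) = (\<lambda>y. const_vec n0 (\<gamma> x y) - (if \<gamma> x y = x then 1 else 0))"
          by blast
        then show ?thesis using a(2) c(3) by (intro that[of p]) (auto simp: fun_eq_iff)
      qed
      have pl: "lift p \<in> carrier G" using p(1) lift_closed by blast
      have xp: "lift [x] \<otimes>\<^bsub>G\<^esub> lift p = lift c"
        using lift_mult[of "[x]" p] lift_eq[of "x # p" c] p a(2) c(1) by simp
      have "gcong ([] @ [(x, True), (x, False)] @ []) ([] @ [] @ [])"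
        using a(2) by (intro word_cong.rel) (auto simp: group_relations_def)
      then have "gclass [(x, True), (x, False)] = gclass []"
        using a(2) by (subst word_class_eq_iff) auto
      then have xa: "lift [x] \<otimes>\<^bsub>G\<^esub> gclass [a] = \<one>\<^bsub>G\<^esub>"
        using gclass_mult[of "[(x, True)]" "[(x, False)]"] a False by (simp add: gclass_one)
      have "lift [x] \<otimes>\<^bsub>G\<^esub> (lift c \<otimes>\<^bsub>G\<^esub> gclass [a]) = lift c \<otimes>\<^bsub>G\<^esub> (lift [x] \<otimes>\<^bsub>G\<^esub> gclass [a])"
        using central_commute[OF c(1,3,4), of "[x]"] a(2) cl by (simp add: G.m_assoc[symmetric])
      also have "\<dots> = lift [x] \<otimes>\<^bsub>G\<^esub> lift p" using xa xp cl by simp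
      finally have cp: "lift c \<otimes>\<^bsub>G\<^esub> gclass [a] = lift p"
        using cl pl by simp
      have "lift (z @ c) \<otimes>\<^bsub>G\<^esub> gclass (a # w) = lift z \<otimes>\<^bsub>G\<^esub> (lift c \<otimes>\<^bsub>G\<^esub> gclass [a]) \<otimes>\<^bsub>G\<^esub> gclass w"
        unfolding aw using cl lift_mult[OF z(1) c(1)] by (simp add: G.m_assoc)
      also have "\<dots> = lift p \<otimes>\<^bsub>G\<^esub> (lift z \<otimes>\<^bsub>G\<^esub> gclass w)"
        unfolding cp using central_commute[OF z(1,3,4) p(1)] cl pl by (simp add: G.m_assoc[symmetric])
      also have "\<dots> = lift (p @ m)" unfolding z(5) using lift_mult[OF p(1) z(2)] by simp
      finally have "lift (z @ c) \<otimes>\<^bsub>G\<^esub> gclass (a # w) = lift (p @ m)" .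
      moreover have "word_v (pos (z @ c)) = const_vec (n + n0)" "word_\<tau> (pos (z @ c)) = id"
        using z c by (auto simp: word_append const_vec_def)
      ultimately show ?thesis
        using z c p by (intro exI[of _ "z @ c"] exI[of _ "n + n0"] exI[of _ "p @ m"]) auto
    qed
  qed
  then show ?thesis using that by blast
qed

text \<open>
  Multiplication by a central positive element with constant vector moves elements of \<open>G\<close>
  and their vectors into \<open>M\<close> and its orthant, where the bijectivity is already known.
\<close>

lemma lattice_structure_group: "lattice_cocycle G X group_v group_\<tau>"
proof -
  interpret G: group G by (rule group_structure_group)
  have inj: "gclass u = gclass w"
    if uw: "u \<in> lists (X \<times> UNIV)" "w \<in> lists (X \<times> UNIV)" "word_v u = word_v w" for u w
  proof -
    obtain z n m where z: "z \<in> lists X" "m \<in> lists X" "word_v (pos z) = const_vec n" "word_\<tau> (pos z) = id"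
      "lift z \<otimes>\<^bsub>G\<^esub> gclass u = lift m" using uw(1) by (rule fraction_exists)
    obtain z' n' m' where z': "z' \<in> lists X" "m' \<in> lists X" "word_v (pos z') = const_vec n'" "word_\<tau> (pos z') = id"
      "lift z' \<otimes>\<^bsub>G\<^esub> gclass w = lift m'" using uw(2) by (rule fraction_exists)
    have zz: "pos z \<in> lists (X \<times> UNIV)" "pos z' \<in> lists (X \<times> UNIV)" using z z' by auto
    have cl: "lift z \<in> carrier G" "lift z' \<in> carrier G" "gclass u \<in> carrier G" "gclass w \<in> carrier G"
      using gclass_closed zz uw by auto
    have "word_v (pos m) = (\<lambda>y. const_vec n y + word_v u y)"
      using group_v_gclass(1)[OF pos_lists[OF z(2)]] group_v_gclass(1)[of "pos z @ u"] z zz uw gclass_mult[OF zz(1) uw(1)]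
      by (simp add: word_append)
    moreover have "word_v (pos m') = (\<lambda>y. const_vec n' y + word_v w y)"
      using group_v_gclass(1)[OF pos_lists[OF z'(2)]] group_v_gclass(1)[of "pos z' @ w"] z' zz uw gclass_mult[OF zz(2) uw(2)]
      by (simp add: word_append)
    ultimately have "word_v (pos (z' @ m)) = word_v (pos (z @ m'))"
      using z z' uw(3) by (auto simp: word_append)
    then have eq: "lift z' \<otimes>\<^bsub>G\<^esub> lift m = lift z \<otimes>\<^bsub>G\<^esub> lift m'"
      using lift_eq[of "z' @ m" "z @ m'"] z z' lift_mult[OF z'(1) z(2)] lift_mult[OF z(1) z'(2)] by simp
    have "lift z' \<otimes>\<^bsub>G\<^esub> (lift z \<otimes>\<^bsub>G\<^esub> gclass u) = lift z \<otimes>\<^bsub>G\<^esub> (lift z' \<otimes>\<^bsub>G\<^esub> gclass w)"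
      using eq by (simp only: z(5) z'(5))
    also have "\<dots> = lift z' \<otimes>\<^bsub>G\<^esub> (lift z \<otimes>\<^bsub>G\<^esub> gclass w)"
      using central_commute[OF z(1,3,4) z'(1)] cl by (simp add: G.m_assoc[symmetric])
    finally show ?thesis using cl by simp
  qed
  have surj: "\<exists>g\<in>carrier G. group_v g = u" if u: "\<And>x. x \<notin> X \<Longrightarrow> u x = 0" for u
  proof -
    obtain c n0 where c: "c \<in> lists X" "0 < n0" "word_v (pos c) = const_vec n0" "word_\<tau> (pos c) = id"
      by (rule central_word)
    have "word_v (pos (concat (replicate k c))) = const_vec (int k * n0) \<and>
        word_\<tau> (pos (concat (replicate k c))) = id" for k
      by (induction k) (use c in \<open>auto simp: word_append const_vec_def fun_eq_iff distrib_right\<close>)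
    moreover have "concat (replicate k c) \<in> lists X" for k
      using c(1) by (induction k) auto
    moreover define k where "k = nat (\<Sum>x\<in>X. \<bar>u x\<bar>)"
    ultimately obtain z where z: "z \<in> lists X" "word_v (pos z) = const_vec (int k * n0)" "word_\<tau> (pos z) = id"
      by blast
    have "0 \<le> u x + const_vec (int k * n0) x" for x
    proof (cases "x \<in> X")
      case True
      have "\<bar>u x\<bar> \<le> (\<Sum>x\<in>X. \<bar>u x\<bar>)" using True finite_X by (intro member_le_sum) auto
      also have "\<dots> = int k" by (simp add: k_def sum_nonneg)
      also have "\<dots> \<le> int k * n0" using c(2) by (simp add: mult_le_cancel_left1)
      finally show ?thesis using True by (simp add: const_vec_def)
    qed (simp add: u const_vec_def)
    then obtain m where m: "m \<in> lists X" "word_v (pos m) = (\<lambda>x. u x + const_vec (int k * n0) x)"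
      using word_exists[of "\<lambda>x. u x + const_vec (int k * n0) x"] u by (auto simp: const_vec_def)
    define g where "g = inv\<^bsub>G\<^esub> (lift z) \<otimes>\<^bsub>G\<^esub> lift m"
    have cl: "lift z \<in> carrier G" "lift m \<in> carrier G" "g \<in> carrier G"
      using lift_closed z m by (auto simp: g_def)
    have "lift z \<otimes>\<^bsub>G\<^esub> g = lift m" using cl by (simp add: g_def G.m_assoc[symmetric])
    then have "group_v (lift m) = (\<lambda>x. group_v (lift z) x + group_v g (group_\<tau> (lift z) x))"
      using group_v_mult(1)[OF cl(1,3)] by simp
    then have "group_v g = u"
      using z m pos_lists group_v_gclass by (auto simp: fun_eq_iff)
    then show ?thesis using cl by blast
  qed
  have "bij_betw group_v (carrier G) {u. \<forall>x. x \<notin> X \<longrightarrow> u x = 0}"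
  proof (rule bij_betw_imageI)
    show "inj_on group_v (carrier G)"
    proof (rule inj_onI)
      fix g h assume "g \<in> carrier G" "h \<in> carrier G" and eq: "group_v g = group_v h"
      then obtain u w where uw: "u \<in> lists (X \<times> UNIV)" "g = gclass u" "w \<in> lists (X \<times> UNIV)" "h = gclass w"
        using gclassE by metis
      then show "g = h" using inj[OF uw(1,3)] eq group_v_gclass(1) by simp
    qed
    show "group_v ` carrier G = {u. \<forall>x. x \<notin> X \<longrightarrow> u x = 0}"
    proof (intro equalityI subsetI)
      fix u assume "u \<in> group_v ` carrier G"
      then obtain g where g: "g \<in> carrier G" "u = group_v g" by blast
      obtain w where "w \<in> lists (X \<times> UNIV)" "g = gclass w" using g(1) by (rule gclassE)
      then have "w \<in> lists (X \<times> UNIV)" "u = word_v w" using group_v_gclass(1) g(2) by simp_all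
      then show "u \<in> {u. \<forall>x. x \<notin> X \<longrightarrow> u x = 0}" using word_v_outside by blast
    next
      fix u :: "'x \<Rightarrow> int" assume "u \<in> {u. \<forall>x. x \<notin> X \<longrightarrow> u x = 0}"
      then show "u \<in> group_v ` carrier G" using surj[of u] by blast
    qed
  qed
  moreover have "group_\<tau> g permutes X" if "g \<in> carrier G" for g
    using that gclassE group_v_gclass(2) word_\<tau>_permutes by metis
  ultimately show ?thesis
    unfolding lattice_cocycle_def lattice_cocycle_axioms_def
    using group_structure_group finite_X group_v_mult by blast
qed

section \<open>Decomposability and purity\<close>

lemma \<gamma>_image_eq: "x \<in> X \<Longrightarrow> Y \<subseteq> X \<Longrightarrow> \<gamma> x ` Y \<subseteq> Y \<Longrightarrow> \<gamma> x ` Y = Y"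
  using finite_X finite_subset \<gamma>_inj by (intro endo_inj_surj) (auto simp: inj_on_def)

lemma snd_S: "x \<in> X \<Longrightarrow> y \<in> X \<Longrightarrow> snd (S (x, y)) = inv_into UNIV (\<gamma> (\<gamma> x y)) x"
proof -
  assume xy: "x \<in> X" "y \<in> X"
  have "inv_into UNIV (\<gamma> (fst (S (x, y)))) x = snd (S (x, y))"
    using \<gamma>_S(1)[OF xy] S_closed[OF xy] inv_\<gamma>_eq by metis
  then show ?thesis using xy by (simp add: \<gamma>_def)
qed

text \<open>
  If \<open>Y\<close> and \<open>Z\<close> decompose \<open>X\<close>, then \<open>\<gamma> z\<close> for \<open>z \<in> Z\<close> permutes \<open>Z\<close>, hence also its complement \<open>Y\<close>.
  Conversely a stable set and its complement are invariant since the second component of \<open>S\<close> is a value of some \<open>\<gamma> t\<^sup>-\<^sup>1\<close>.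
\<close>

lemma decomposable_iff:
  "decomposable X S \<longleftrightarrow> (\<exists>Y. Y \<noteq> {} \<and> Y \<subset> X \<and> (\<forall>z\<in>X. \<gamma> z ` Y \<subseteq> Y))"
proof
  assume "decomposable X S"
  then obtain Y Z where YZ: "Y \<noteq> {}" "Z \<noteq> {}" "Y \<inter> Z = {}" "X = Y \<union> Z"
    "nondegenerate Y S" "nondegenerate Z S" unfolding decomposable_def by blast
  have YX: "Y \<subseteq> X" "Z \<subseteq> X" using YZ(4) by auto
  have bY: "\<gamma> z ` Y = Y" if "z \<in> Y" for z
  proof -
    have "\<gamma> z ` Y = (\<lambda>x. fst (S (z, x))) ` Y"
      using YX by (intro image_cong) (auto simp: \<gamma>_def)
    then show ?thesis using YZ(5) that by (simp add: nondegenerate_def bij_betw_def)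
  qed
  have bZ: "\<gamma> z ` Z = Z" if "z \<in> Z" for z
  proof -
    have "\<gamma> z ` Z = (\<lambda>x. fst (S (z, x))) ` Z"
      using YX by (intro image_cong) (auto simp: \<gamma>_def)
    then show ?thesis using YZ(6) that by (simp add: nondegenerate_def bij_betw_def)
  qed
  have "\<gamma> z ` Y \<subseteq> Y" if z: "z \<in> X" for z
  proof (cases "z \<in> Y")
    case False
    then have zZ: "z \<in> Z" using z YZ by blast
    show ?thesis
    proof
      fix w assume "w \<in> \<gamma> z ` Y"
      then obtain y where y: "y \<in> Y" "w = \<gamma> z y" by blast
      have "w \<notin> Z"
      proof
        assume "w \<in> Z"
        then obtain z' where "z' \<in> Z" "w = \<gamma> z z'" using bZ[OF zZ] by blast
        then show False using y z \<gamma>_inj YZ(3) by auto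
      qed
      moreover have "w \<in> X" unfolding y(2) using y(1) z YX(1) by auto
      ultimately show "w \<in> Y" using YZ(4) by blast
    qed
  qed (use bY in auto)
  then show "\<exists>Y. Y \<noteq> {} \<and> Y \<subset> X \<and> (\<forall>z\<in>X. \<gamma> z ` Y \<subseteq> Y)"
    using YZ by (intro exI[of _ Y]) auto
next
  assume "\<exists>Y. Y \<noteq> {} \<and> Y \<subset> X \<and> (\<forall>z\<in>X. \<gamma> z ` Y \<subseteq> Y)"
  then obtain Y where "Y \<noteq> {} \<and> Y \<subset> X \<and> (\<forall>z\<in>X. \<gamma> z ` Y \<subseteq> Y)" by (rule exE)
  then have Y: "Y \<noteq> {}" "Y \<subset> X" "\<And>z. z \<in> X \<Longrightarrow> \<gamma> z ` Y \<subseteq> Y" by auto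
  have inv: "invariant_subset X S W \<and> nondegenerate W S"
    if W: "W \<subseteq> X" "\<And>z. z \<in> X \<Longrightarrow> \<gamma> z ` W = W" for W
  proof -
    have f: "fst (S (x, y)) \<in> W" if "x \<in> X" "y \<in> W" for x y
      using that W by (auto simp: \<gamma>_def subset_iff)
    have s: "snd (S (x, y)) \<in> W" if "x \<in> W" "y \<in> X" for x y
    proof -
      have x: "x \<in> X" using that W by blast
      have "x \<in> \<gamma> (\<gamma> x y) ` W" using W(2)[of "\<gamma> x y"] x that by simp
      then obtain w where w: "w \<in> W" "x = \<gamma> (\<gamma> x y) w" by blast
      have "inv_into UNIV (\<gamma> (\<gamma> x y)) x = w" using inv_\<gamma>_eq[of "\<gamma> x y" x w] w(2) x that(2) by simp
      then show ?thesis using w(1) snd_S[OF x that(2)] by simp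
    qed
    have fin: "finite W" using W(1) finite_X finite_subset by blast
    have "bij_betw (\<lambda>x. snd (S (x, y))) W W" if y: "y \<in> W" for y
    proof -
      have "inj_on (\<lambda>x. snd (S (x, y))) W"
        using nondeg y W(1) by (auto simp: nondegenerate_def bij_betw_def intro: inj_on_subset)
      then show ?thesis using s y W(1) fin endo_inj_surj[of W "\<lambda>x. snd (S (x, y))"]
        by (auto simp: bij_betw_def)
    qed
    moreover have "bij_betw (\<lambda>x. fst (S (z, x))) W W" if z: "z \<in> W" for z
    proof -
      have "inj_on (\<lambda>x. fst (S (z, x))) W"
        using nondeg z W(1) by (auto simp: nondegenerate_def bij_betw_def intro: inj_on_subset)
      then show ?thesis using f z W(1) fin endo_inj_surj[of W "\<lambda>x. fst (S (z, x))"]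
        by (auto simp: bij_betw_def)
    qed
    moreover have "S ` (W \<times> W) \<subseteq> W \<times> W"
    proof
      fix p assume "p \<in> S ` (W \<times> W)"
      then obtain x y where "x \<in> W" "y \<in> W" "p = S (x, y)" by auto
      then show "p \<in> W \<times> W" using f[of x y] s[of x y] W(1) by (auto simp: mem_Times_iff)
    qed
    ultimately show ?thesis using W(1) by (simp add: invariant_subset_def nondegenerate_def)
  qed
  have eY: "\<gamma> z ` Y = Y" if "z \<in> X" for z using \<gamma>_image_eq[OF that] Y that by blast
  have eZ: "\<gamma> z ` (X - Y) = X - Y" if "z \<in> X" for z
  proof -
    have "\<gamma> z ` (X - Y) = \<gamma> z ` X - \<gamma> z ` Y"
      using \<gamma>_inj[OF that] by (intro image_set_diff) (auto simp: inj_on_def)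
    then show ?thesis using eY that permutes_image[OF \<gamma>_permutes[OF that]] by simp
  qed
  show "decomposable X S"
    unfolding decomposable_def
    using Y(1,2) inv[of Y] inv[of "X - Y"] eY eZ
    by (intro exI[of _ Y] exI[of _ "X - Y"]) auto
qed

text \<open>
  The main step is that the set \<open>C\<close> of complements of \<open>x\<close> is stable under every \<open>\<gamma> z\<close>. For
  \<open>z \<notin> C\<close> this is immediate. In general, \<open>a \<mapsto> snd (S (a, y))\<close> maps \<open>C\<close> into itself for \<open>y \<in> C\<close>, including the case
  \<open>\<gamma> a y = a\<close>, in which the value is \<open>y\<close>. This map is injective on \<open>X\<close>, so an element of \<open>X\<close> whose value lies in
  \<open>C\<close> lies itself in \<open>C\<close>; for \<open>y, z \<in> C\<close> apply this to \<open>\<gamma> z y\<close>, which \<open>snd (S (_, snd (S (z, y))))\<close> sends to \<open>y\<close>.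
\<close>

lemma delta_pure_iff_indecomposable:
  "Delta_pure (structure_monoid X S) (monoid_gen X S ` X) \<longleftrightarrow> indecomposable X S"
proof -
  interpret M: lattice_monoid "structure_monoid X S" X monoid_v monoid_\<tau>
    by (rule lattice_structure_monoid)
  have gen: "M.gen x = monoid_gen X S x" if "x \<in> X" for x
    using M.gen_eq[OF monoid_gen_closed[OF that] that gen_word(1)[OF that]] by simp
  have \<tau>: "monoid_\<tau> (M.gen z) = inv_into UNIV (\<gamma> z)" if "z \<in> X" for z
    using that gen gen_word(2) by simp
  have inv: "\<gamma> z ` M.complement_gens x = M.complement_gens x" if x: "x \<in> X" and z: "z \<in> X" for x z
  proof -
    let ?C = "M.complement_gens x"
    have CX: "?C \<subseteq> X" by (rule M.complement_gens_subset[OF x])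
    have fin: "finite ?C" using CX finite_X finite_subset by blast
    have step: "inv_into UNIV (\<gamma> a) y \<in> ?C" if "y \<in> ?C" "a \<in> X" "a \<noteq> y" for a y
      using M.complement_gens_step[OF that] \<tau>[OF that(2)] by simp
    \<comment> \<open>the second component of \<open>S (a, y)\<close> is the preimage of \<open>a\<close> under \<open>\<gamma> (\<gamma> a y)\<close>\<close>
    have right: "snd (S (a, y)) \<in> ?C" if ay: "a \<in> ?C" "y \<in> ?C" for a y
    proof (cases "\<gamma> a y = a")
      case True
      have aX: "a \<in> X" "y \<in> X" using ay CX by auto
      have "inv_into UNIV (\<gamma> a) a = y" using inv_\<gamma>_eq[OF aX(1), of a y] True by simp
      then have "snd (S (a, y)) = y" using snd_S[OF aX] True by simp
      then show ?thesis using ay by simp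
    next
      case False
      have aX: "a \<in> X" "y \<in> X" using ay CX by auto
      show ?thesis unfolding snd_S[OF aX] using aX ay False by (intro step) auto
    qed
    have surj: "a \<in> ?C" if a: "a \<in> X" and y: "y \<in> ?C" and sn: "snd (S (a, y)) \<in> ?C" for a y
    proof -
      have yX: "y \<in> X" using y CX by blast
      have i: "inj_on (\<lambda>x. snd (S (x, y))) X"
        using nondeg yX by (auto simp: nondegenerate_def bij_betw_def)
      have im: "(\<lambda>x. snd (S (x, y))) ` ?C = ?C"
        using fin right y inj_on_subset[OF i CX] by (intro endo_inj_surj) auto
      have "snd (S (a, y)) \<in> (\<lambda>x. snd (S (x, y))) ` ?C" unfolding im by (rule sn)
      then obtain b where b: "b \<in> ?C" "snd (S (a, y)) = snd (S (b, y))" by (rule imageE) simp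
      then have "a = b" using inj_onD[OF i b(2)] a CX by blast
      then show ?thesis using b(1) by simp
    qed
    show ?thesis
    proof (cases "z \<in> ?C")
      case True
      have "\<gamma> z y \<in> ?C" if y: "y \<in> ?C" for y
      proof (rule surj)
        have yX: "y \<in> X" using y CX by blast
        show "\<gamma> z y \<in> X" using z yX by simp
        show "snd (S (z, y)) \<in> ?C" using right True y .
        show "snd (S (\<gamma> z y, snd (S (z, y)))) \<in> ?C"
          using \<gamma>_S(2)[OF z yX] y yX by (simp add: \<gamma>_def)
      qed
      then show ?thesis using z CX by (intro \<gamma>_image_eq) auto
    next
      case False
      have "inv_into UNIV (\<gamma> z) ` ?C \<subseteq> ?C" using step z False by auto
      moreover have "inj_on (inv_into UNIV (\<gamma> z)) ?C"
        by (rule inj_onI) (metis \<gamma>_inv(1) z)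
      ultimately have "inv_into UNIV (\<gamma> z) ` ?C = ?C" using fin endo_inj_surj by blast
      then have "\<gamma> z ` inv_into UNIV (\<gamma> z) ` ?C = \<gamma> z ` ?C" by simp
      then show ?thesis using z by (simp add: image_image)
    qed
  qed
  have img: "monoid_gen X S ` X = M.gen ` X" using gen by simp
  show ?thesis
    unfolding img M.Delta_pure_iff
  proof
    assume eq: "\<forall>x\<in>X. \<forall>y\<in>X. M.complement_gens x = M.complement_gens y"
    show "indecomposable X S"
    proof
      assume "decomposable X S"
      then have "\<exists>Y. Y \<noteq> {} \<and> Y \<subset> X \<and> (\<forall>z\<in>X. \<gamma> z ` Y \<subseteq> Y)"
        by (simp only: decomposable_iff)
      then obtain Y where "Y \<noteq> {} \<and> Y \<subset> X \<and> (\<forall>z\<in>X. \<gamma> z ` Y \<subseteq> Y)" by (rule exE)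
      then have Y: "Y \<noteq> {}" "Y \<subset> X" "\<And>z. z \<in> X \<Longrightarrow> \<gamma> z ` Y \<subseteq> Y" by auto
      obtain x y where xy: "x \<in> Y" "y \<in> X - Y" using Y by blast
      have "inv_into UNIV (\<gamma> z) a \<in> Y" if "z \<in> X" "a \<in> Y" for z a
      proof -
        have "a \<in> \<gamma> z ` Y" using \<gamma>_image_eq[OF that(1)] Y that by blast
        then show ?thesis using that(1) by auto
      qed
      then have "M.complement_gens x \<subseteq> Y"
        using xy(1) \<tau> by (intro M.complement_gens_invariant) auto
      moreover have "y \<in> M.complement_gens x"
        using eq xy Y(2) M.complement_gens_self[of y] by blast
      ultimately show False using xy by blast
    qed
  next
    assume ind: "indecomposable X S"
    have "M.complement_gens x = X" if x: "x \<in> X" for x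
    proof (rule ccontr)
      assume "M.complement_gens x \<noteq> X"
      then have "M.complement_gens x \<subset> X" using M.complement_gens_subset[OF x] by blast
      then have "decomposable X S"
        unfolding decomposable_iff using inv[OF x] M.complement_gens_self[of x]
        by (intro exI[of _ "M.complement_gens x"]) auto
      then show False using ind by blast
    qed
    then show "\<forall>x\<in>X. \<forall>y\<in>X. M.complement_gens x = M.complement_gens y" by blast
  qed
qed

end

theorem theorem2:
  fixes X :: "'a set" and S :: "'a \<times> 'a \<Rightarrow> 'a \<times> 'a"
  assumes "finite X"
    and "set_solution X S"
    and "nondegenerate X S"
    and "involutive X S"
    and "braided X S"
  shows "((\<exists>!\<Delta>. is_right_lcm (structure_monoid X S) (monoid_gen X S ` X) \<Delta>) \<and>
          garside_element (structure_monoid X S)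
            (right_lcm (structure_monoid X S) (monoid_gen X S ` X))) \<and>
         (homological_dimension TYPE('m::infinite) (structure_group X S) = enat (card X) \<and>
          cohomological_dimension TYPE('m::infinite) (structure_group X S) = enat (card X)) \<and>
         ((garside_monoid (structure_monoid X S) \<and>
           Delta_pure (structure_monoid X S) (monoid_gen X S ` X)) \<longleftrightarrow> indecomposable X S)"
proof -
  interpret yb_solution X S
    using assms by unfold_locales
  obtain v' \<tau>' where "bilattice_monoid (structure_monoid X S) X monoid_v monoid_\<tau> v' \<tau>'"
    using bilattice_structure_monoid by blast
  then interpret M: bilattice_monoid "structure_monoid X S" X monoid_v monoid_\<tau> v' \<tau>' .
  have "M.gen x = monoid_gen X S x" if "x \<in> X" for x
    using M.gen_eq[OF monoid_gen_closed[OF that] that gen_word(1)[OF that]] by simp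
  then have img: "M.gen ` X = monoid_gen X S ` X" by simp
  have "X \<noteq> {}" using assms(2) by (simp add: set_solution_def)
  note dim = lattice_cocycle.dimension[OF lattice_structure_group this]
  show ?thesis
    using M.garside_element_lcm M.garside delta_pure_iff_indecomposable dim unfolding img by blast
qed

end
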